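(* (ZF + AD) The quotient ${}^\omega2/E_0$ does not have the $3$-Jónsson property: there is a function $F:[{}^\omega2/E_0]^3_=\to{}^\omega2/E_0$ such that for every $X\subseteq{}^\omega2/E_0$ in bijection with ${}^\omega2/E_0$, $F[[X]^3_=]={}^\omega2/E_0$.
   Context: $E_0$ on ${}^\omega2$: $x\,E_0\,y$ iff $(\exists n)(\forall k>n)(x(k)=y(k))$. For a set $X$, $[X]^n_==\{(x_0,\dots,x_{n-1})\in{}^nX: x_i\neq x_j\text{ for } i\neq j\}$. A set $X$ has the $n$-Jónsson property iff for every function $f:[X]^n_=\to X$ there is $Y\subseteq X$ in bijection with $X$ such that $f[[Y]^n_=]\neq X$. AD is the axiom of determinacy; the ambient theory is ZF + AD (no choice). *)

theory Defs
  imports Main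
begin

text \<open>
  HOL proves the axiom of choice, so determinacy cannot be assumed of the sets of HOL. A theorem
  of ZF + AD is therefore rendered as a statement about all first-order structures
  (a type \<open>'a\<close> with a binary relation \<open>mem\<close>) that satisfy the axioms of ZF, including
  the full first-order schemes of separation and replacement, together with AD. No form of choice
  is required to hold in the structure. Everything is interpreted inside the structure: sets, functions,
  natural numbers, games and strategies are elements of \<open>'a\<close>, and all quantifiers range over
  \<open>'a\<close>. In particular \<open>omega\<close> need not be standard, and subsets of a set that are not
  elements of \<open>'a\<close> do not count.
\<close>

section \<open>First-order formulas of set theory\<close>

text \<open>De Bruijn indices: in the scope of \<^term>\<open>Forall\<close> the bound variable has index 0.\<close>

datatype fm = Mem nat nat | Eq nat nat | Neg fm | Conj fm fm | Forall fm

primrec sat :: "('a \<Rightarrow> 'a \<Rightarrow> bool) \<Rightarrow> (nat \<Rightarrow> 'a) \<Rightarrow> fm \<Rightarrow> bool" where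
  "sat E \<rho> (Mem i j) \<longleftrightarrow> E (\<rho> i) (\<rho> j)"
| "sat E \<rho> (Eq i j) \<longleftrightarrow> \<rho> i = \<rho> j"
| "sat E \<rho> (Neg \<phi>) \<longleftrightarrow> \<not> sat E \<rho> \<phi>"
| "sat E \<rho> (Conj \<phi> \<psi>) \<longleftrightarrow> sat E \<rho> \<phi> \<and> sat E \<rho> \<psi>"
| "sat E \<rho> (Forall \<phi>) \<longleftrightarrow> (\<forall>a. sat E (case_nat a \<rho>) \<phi>)"

section \<open>Set-theoretic notions inside a structure\<close>

locale set_universe =
  fixes mem :: "'a \<Rightarrow> 'a \<Rightarrow> bool"  (infix "\<epsilon>" 50)
begin

text \<open>
  The set with extension \<open>P\<close>, if there is one; otherwise the value is arbitrary. In a model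
  of ZF the sets needed for the operations below exist; see the end of this theory.
\<close>

definition setof :: "('a \<Rightarrow> bool) \<Rightarrow> 'a" where
  "setof P = (THE z. \<forall>w. w \<epsilon> z \<longleftrightarrow> P w)"

definition subset :: "'a \<Rightarrow> 'a \<Rightarrow> bool" where
  "subset x y \<longleftrightarrow> (\<forall>w. w \<epsilon> x \<longrightarrow> w \<epsilon> y)"

definition empty :: 'a where
  "empty = setof (\<lambda>w. False)"

definition upair :: "'a \<Rightarrow> 'a \<Rightarrow> 'a" where
  "upair x y = setof (\<lambda>w. w = x \<or> w = y)"

definition opair :: "'a \<Rightarrow> 'a \<Rightarrow> 'a" where
  "opair x y = upair (upair x x) (upair x y)"

definition succ :: "'a \<Rightarrow> 'a" where
  "succ x = setof (\<lambda>w. w \<epsilon> x \<or> w = x)"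

primrec num :: "nat \<Rightarrow> 'a" where
  "num 0 = empty"
| "num (Suc n) = succ (num n)"

definition is_inductive :: "'a \<Rightarrow> bool" where
  "is_inductive I \<longleftrightarrow> empty \<epsilon> I \<and> (\<forall>x. x \<epsilon> I \<longrightarrow> succ x \<epsilon> I)"

definition omega :: 'a where
  "omega = setof (\<lambda>n. \<forall>I. is_inductive I \<longrightarrow> n \<epsilon> I)"

definition func :: "'a \<Rightarrow> 'a \<Rightarrow> 'a \<Rightarrow> bool" where
  "func f A B \<longleftrightarrow>
     (\<forall>p. p \<epsilon> f \<longrightarrow> (\<exists>x y. x \<epsilon> A \<and> y \<epsilon> B \<and> p = opair x y)) \<and>
     (\<forall>x. x \<epsilon> A \<longrightarrow> (\<exists>!y. opair x y \<epsilon> f))"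

definition app :: "'a \<Rightarrow> 'a \<Rightarrow> 'a" where
  "app f x = (THE y. opair x y \<epsilon> f)"

definition fun_space :: "'a \<Rightarrow> 'a \<Rightarrow> 'a" where
  "fun_space A B = setof (\<lambda>f. func f A B)"

definition restrict :: "'a \<Rightarrow> 'a \<Rightarrow> 'a" where
  "restrict f A = setof (\<lambda>p. p \<epsilon> f \<and> (\<exists>x y. x \<epsilon> A \<and> p = opair x y))"

definition image :: "'a \<Rightarrow> 'a \<Rightarrow> 'a" where
  "image f A = setof (\<lambda>y. \<exists>x. x \<epsilon> A \<and> opair x y \<epsilon> f)"

definition bijection :: "'a \<Rightarrow> 'a \<Rightarrow> 'a \<Rightarrow> bool" where
  "bijection f A B \<longleftrightarrow>
     func f A B \<and> (\<forall>y. y \<epsilon> B \<longrightarrow> (\<exists>!x. x \<epsilon> A \<and> opair x y \<epsilon> f))"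

definition equipollent :: "'a \<Rightarrow> 'a \<Rightarrow> bool" where
  "equipollent A B \<longleftrightarrow> (\<exists>f. bijection f A B)"

subsection \<open>The axiom of determinacy\<close>

text \<open>
  Two players alternately choose elements of \<open>omega\<close>, player I moving at the even stages,
  and produce \<open>x\<close>; player I wins the game with payoff set \<open>A\<close> iff \<open>x\<close> is in
  \<open>A\<close>. A strategy is a function from finite sequences (the positions) to \<open>omega\<close>.
  Evenness is given by the unique alternating subset of \<open>omega\<close> that contains 0.
\<close>

definition even_nat :: "'a \<Rightarrow> bool" where
  "even_nat n \<longleftrightarrow> n \<epsilon> omega \<and>
     (\<exists>e. empty \<epsilon> e \<and> (\<forall>k. k \<epsilon> omega \<longrightarrow> (succ k \<epsilon> e \<longleftrightarrow> \<not> k \<epsilon> e)) \<and> n \<epsilon> e)"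

definition finite_seqs :: "'a \<Rightarrow> 'a" where
  "finite_seqs A = setof (\<lambda>s. \<exists>n. n \<epsilon> omega \<and> func s n A)"

definition strategy :: "'a \<Rightarrow> bool" where
  "strategy \<sigma> \<longleftrightarrow> func \<sigma> (finite_seqs omega) omega"

definition follows_I :: "'a \<Rightarrow> 'a \<Rightarrow> bool" where
  "follows_I \<sigma> x \<longleftrightarrow>
     (\<forall>n. n \<epsilon> omega \<and> even_nat n \<longrightarrow> app x n = app \<sigma> (restrict x n))"

definition follows_II :: "'a \<Rightarrow> 'a \<Rightarrow> bool" where
  "follows_II \<sigma> x \<longleftrightarrow>
     (\<forall>n. n \<epsilon> omega \<and> \<not> even_nat n \<longrightarrow> app x n = app \<sigma> (restrict x n))"

definition determined :: "'a \<Rightarrow> bool" where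
  "determined A \<longleftrightarrow>
     (\<exists>\<sigma>. strategy \<sigma> \<and> (\<forall>x. x \<epsilon> fun_space omega omega \<and> follows_I \<sigma> x \<longrightarrow> x \<epsilon> A)) \<or>
     (\<exists>\<sigma>. strategy \<sigma> \<and> (\<forall>x. x \<epsilon> fun_space omega omega \<and> follows_II \<sigma> x \<longrightarrow> \<not> x \<epsilon> A))"

definition AD :: bool where
  "AD \<longleftrightarrow> (\<forall>A. subset A (fun_space omega omega) \<longrightarrow> determined A)"

subsection \<open>The quotient by eventual equality\<close>

abbreviation cantor :: 'a where
  "cantor \<equiv> fun_space omega (num 2)"

text \<open>On natural numbers of the structure, \<open>n \<epsilon> k\<close> says that \<open>n < k\<close>.\<close>

definition E0 :: "'a \<Rightarrow> 'a \<Rightarrow> bool" where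
  "E0 x y \<longleftrightarrow>
     (\<exists>n. n \<epsilon> omega \<and> (\<forall>k. k \<epsilon> omega \<and> n \<epsilon> k \<longrightarrow> app x k = app y k))"

definition E0_class :: "'a \<Rightarrow> 'a" where
  "E0_class x = setof (\<lambda>y. y \<epsilon> cantor \<and> E0 x y)"

definition cantor_mod_E0 :: 'a where
  "cantor_mod_E0 = setof (\<lambda>c. \<exists>x. x \<epsilon> cantor \<and> c = E0_class x)"

subsection \<open>The Jonsson property\<close>

definition distinct_tuples :: "'a \<Rightarrow> 'a \<Rightarrow> 'a" where
  "distinct_tuples n X = setof (\<lambda>s. s \<epsilon> fun_space n X \<and>
     (\<forall>i j. i \<epsilon> n \<and> j \<epsilon> n \<and> i \<noteq> j \<longrightarrow> app s i \<noteq> app s j))"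

definition Jonsson :: "'a \<Rightarrow> 'a \<Rightarrow> bool" where
  "Jonsson n X \<longleftrightarrow> (\<forall>f. func f (distinct_tuples n X) X \<longrightarrow>
     (\<exists>Y. subset Y X \<and> equipollent Y X \<and> image f (distinct_tuples n Y) \<noteq> X))"

end

section \<open>Models of ZF\<close>

locale ZF_model = set_universe +
  assumes extensionality: "\<forall>x y. (\<forall>w. w \<epsilon> x \<longleftrightarrow> w \<epsilon> y) \<longrightarrow> x = y"
    and foundation: "\<forall>x. (\<exists>y. y \<epsilon> x) \<longrightarrow> (\<exists>y. y \<epsilon> x \<and> \<not> (\<exists>w. w \<epsilon> y \<and> w \<epsilon> x))"
    and pairing: "\<forall>x y. \<exists>z. \<forall>w. w \<epsilon> z \<longleftrightarrow> w = x \<or> w = y"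
    and union: "\<forall>x. \<exists>u. \<forall>w. w \<epsilon> u \<longleftrightarrow> (\<exists>y. w \<epsilon> y \<and> y \<epsilon> x)"
    and power_set: "\<forall>x. \<exists>p. \<forall>w. w \<epsilon> p \<longleftrightarrow> (\<forall>v. v \<epsilon> w \<longrightarrow> v \<epsilon> x)"
    and infinity: "\<exists>I. (\<exists>z. z \<epsilon> I \<and> (\<forall>w. \<not> w \<epsilon> z)) \<and>
      (\<forall>x. x \<epsilon> I \<longrightarrow> (\<exists>y. y \<epsilon> I \<and> (\<forall>w. w \<epsilon> y \<longleftrightarrow> w \<epsilon> x \<or> w = x)))"
    and separation: "\<forall>\<phi> \<rho> A. \<exists>B. \<forall>x. x \<epsilon> B \<longleftrightarrow> x \<epsilon> A \<and> sat mem (case_nat x \<rho>) \<phi>"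
    and replacement: "\<forall>\<phi> \<rho> A.
      (\<forall>x. x \<epsilon> A \<longrightarrow> (\<exists>!y. sat mem (case_nat x (case_nat y \<rho>)) \<phi>)) \<longrightarrow>
      (\<exists>B. \<forall>y. y \<epsilon> B \<longleftrightarrow> (\<exists>x. x \<epsilon> A \<and> sat mem (case_nat x (case_nat y \<rho>)) \<phi>))"
begin

subsection \<open>The sets denoted by the operations exist\<close>

lemma setof_eqI: "(\<And>w. w \<epsilon> z \<longleftrightarrow> P w) \<Longrightarrow> setof P = z"
  unfolding setof_def using extensionality by (intro the_equality) auto

lemma mem_setof: "\<exists>z. \<forall>w. w \<epsilon> z \<longleftrightarrow> P w \<Longrightarrow> w \<epsilon> setof P \<longleftrightarrow> P w"
  using setof_eqI [of _ P] by auto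

definition definable :: "((nat \<Rightarrow> 'a) \<Rightarrow> bool) \<Rightarrow> bool" where
  "definable P \<longleftrightarrow> (\<exists>\<phi>. \<forall>\<rho>. P \<rho> \<longleftrightarrow> sat mem \<rho> \<phi>)"

named_theorems definable_intros

lemma definable_mem [definable_intros]: "definable (\<lambda>\<rho>. \<rho> i \<epsilon> \<rho> j)"
  unfolding definable_def by (rule exI [of _ "Mem i j"]) simp

lemma definable_eq [definable_intros]: "definable (\<lambda>\<rho>. \<rho> i = \<rho> j)"
  unfolding definable_def by (rule exI [of _ "Eq i j"]) simp

lemma definable_cong: "definable P \<Longrightarrow> (\<And>\<rho>. Q \<rho> \<longleftrightarrow> P \<rho>) \<Longrightarrow> definable Q"
  by presburger

lemma definable_not [definable_intros]:
  assumes "definable P" shows "definable (\<lambda>\<rho>. \<not> P \<rho>)"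
proof -
  obtain \<phi> where "\<forall>\<rho>. P \<rho> \<longleftrightarrow> sat mem \<rho> \<phi>" using assms unfolding definable_def ..
  then show ?thesis unfolding definable_def by (intro exI [of _ "Neg \<phi>"]) simp
qed

lemma definable_conj [definable_intros]:
  assumes "definable P" "definable Q" shows "definable (\<lambda>\<rho>. P \<rho> \<and> Q \<rho>)"
proof -
  obtain \<phi> where \<phi>: "\<forall>\<rho>. P \<rho> \<longleftrightarrow> sat mem \<rho> \<phi>" using assms(1) unfolding definable_def ..
  obtain \<psi> where \<psi>: "\<forall>\<rho>. Q \<rho> \<longleftrightarrow> sat mem \<rho> \<psi>" using assms(2) unfolding definable_def ..
  show ?thesis unfolding definable_def by (intro exI [of _ "Conj \<phi> \<psi>"]) (simp add: \<phi> \<psi>)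
qed

lemma definable_disj [definable_intros]:
  assumes "definable P" "definable Q" shows "definable (\<lambda>\<rho>. P \<rho> \<or> Q \<rho>)"
  by (rule definable_cong [OF definable_not [OF definable_conj [OF assms [THEN definable_not]]]])
     blast

lemma definable_imp [definable_intros]:
  assumes "definable P" "definable Q" shows "definable (\<lambda>\<rho>. P \<rho> \<longrightarrow> Q \<rho>)"
  by (rule definable_cong [OF definable_disj [OF definable_not [OF assms(1)] assms(2)]]) blast

lemma definable_iff [definable_intros]:
  assumes "definable P" "definable Q" shows "definable (\<lambda>\<rho>. P \<rho> \<longleftrightarrow> Q \<rho>)"
  by (rule definable_cong
        [OF definable_conj [OF definable_imp [OF assms] definable_imp [OF assms(2,1)]]]) blast

lemma definable_all [definable_intros]:
  assumes "definable (\<lambda>\<rho>. P (\<rho> 0) (\<lambda>n. \<rho> (Suc n)))"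
  shows "definable (\<lambda>\<rho>. \<forall>x. P x \<rho>)"
proof -
  obtain \<phi> where "\<And>\<rho>. P (\<rho> 0) (\<lambda>n. \<rho> (Suc n)) \<longleftrightarrow> sat mem \<rho> \<phi>"
    using assms unfolding definable_def by blast
  from this [of "case_nat _ _"] show ?thesis
    unfolding definable_def by (intro exI [of _ "Forall \<phi>"]) simp
qed

lemma definable_ex [definable_intros]:
  assumes "definable (\<lambda>\<rho>. P (\<rho> 0) (\<lambda>n. \<rho> (Suc n)))"
  shows "definable (\<lambda>\<rho>. \<exists>x. P x \<rho>)"
proof -
  have "definable (\<lambda>\<rho>. \<not> (\<forall>x. \<not> P x \<rho>))"
    by (rule definable_not, rule definable_all, rule definable_not, rule assms)
  then show ?thesis by (rule definable_cong) blast
qed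

lemma definable_ex1 [definable_intros]:
  assumes "definable (\<lambda>\<rho>. \<exists>z. \<forall>x. P x \<rho> \<longleftrightarrow> x = z)"
  shows "definable (\<lambda>\<rho>. \<exists>!x. P x \<rho>)"
  by (rule definable_cong [OF assms]) auto

lemma separation_set:
  assumes "definable (\<lambda>\<rho>. P (\<rho> 0) (\<rho> (Suc 0)) (\<rho> (Suc (Suc 0))))"
  shows "\<exists>B. \<forall>x. x \<epsilon> B \<longleftrightarrow> x \<epsilon> A \<and> P x a b"
proof -
  obtain \<phi> where \<phi>: "\<And>\<rho>. P (\<rho> 0) (\<rho> (Suc 0)) (\<rho> (Suc (Suc 0))) \<longleftrightarrow> sat mem \<rho> \<phi>"
    using assms unfolding definable_def by blast
  show ?thesis
    using separation [rule_format, of A "case_nat a (case_nat b (\<lambda>_. a))" \<phi>]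
    by (simp flip: \<phi>)
qed

lemma mem_setof_separation:
  assumes "definable (\<lambda>\<rho>. P (\<rho> 0) (\<rho> (Suc 0)) (\<rho> (Suc (Suc 0))))"
    and "\<And>x. P x a b \<Longrightarrow> x \<epsilon> A"
  shows "w \<epsilon> setof (\<lambda>x. P x a b) \<longleftrightarrow> P w a b"
  by (rule mem_setof) (use separation_set [of P A a b] assms in metis)

lemma mem_empty [simp]: "\<not> w \<epsilon> empty"
  unfolding empty_def using mem_setof [of "\<lambda>w. False" w] infinity by blast

lemma mem_upair [simp]: "w \<epsilon> upair x y \<longleftrightarrow> w = x \<or> w = y"
  unfolding upair_def by (rule mem_setof) (use pairing in blast)

lemma opair_eq_iff [simp]: "opair x y = opair x' y' \<longleftrightarrow> x = x' \<and> y = y'"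
proof
  assume eq: "opair x y = opair x' y'"
  have 1: "\<And>w. w = upair x x \<or> w = upair x y \<longleftrightarrow> w = upair x' x' \<or> w = upair x' y'"
    using eq unfolding opair_def by (metis mem_upair)
  show "x = x' \<and> y = y'"
    using 1 by (metis mem_upair)
qed simp

lemma is_upair_iff: "z = upair x y \<longleftrightarrow> (\<forall>w. w \<epsilon> z \<longleftrightarrow> w = x \<or> w = y)"
  using extensionality mem_upair by metis

lemma is_opair_iff:
  "z = opair x y \<longleftrightarrow> (\<forall>w. w \<epsilon> z \<longleftrightarrow>
     (\<forall>v. v \<epsilon> w \<longleftrightarrow> v = x) \<or> (\<forall>v. v \<epsilon> w \<longleftrightarrow> v = x \<or> v = y))"
  unfolding opair_def is_upair_iff by simp

lemma definable_opair [definable_intros]: "definable (\<lambda>\<rho>. \<rho> i = opair (\<rho> j) (\<rho> k))"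
  unfolding is_opair_iff by (intro definable_intros)

lemma definable_opair_mem [definable_intros]: "definable (\<lambda>\<rho>. opair (\<rho> j) (\<rho> k) \<epsilon> \<rho> i)"
proof -
  have "opair x y \<epsilon> z \<longleftrightarrow> (\<exists>p. p = opair x y \<and> p \<epsilon> z)" for x y z
    by simp
  then show ?thesis by (simp only:) (intro definable_intros)
qed

lemma definable_func [definable_intros]: "definable (\<lambda>\<rho>. func (\<rho> i) (\<rho> j) (\<rho> k))"
  unfolding func_def by (intro definable_intros)

lemma ex_union2: "\<exists>u. \<forall>w. w \<epsilon> u \<longleftrightarrow> w \<epsilon> x \<or> w \<epsilon> y"
  using union [rule_format, of "upair x y"] by auto

lemma mem_succ [simp]: "w \<epsilon> succ x \<longleftrightarrow> w \<epsilon> x \<or> w = x"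
  unfolding succ_def by (rule mem_setof) (use ex_union2 [of x "upair x x"] in simp)

lemma is_empty_iff: "z = empty \<longleftrightarrow> (\<forall>w. \<not> w \<epsilon> z)"
  using extensionality mem_empty by metis

lemma is_succ_iff: "z = succ x \<longleftrightarrow> (\<forall>w. w \<epsilon> z \<longleftrightarrow> w \<epsilon> x \<or> w = x)"
  using extensionality mem_succ by metis

lemma is_inductive_iff:
  "is_inductive I \<longleftrightarrow> (\<exists>z. z \<epsilon> I \<and> (\<forall>w. \<not> w \<epsilon> z)) \<and>
     (\<forall>x. x \<epsilon> I \<longrightarrow> (\<exists>y. y \<epsilon> I \<and> (\<forall>w. w \<epsilon> y \<longleftrightarrow> w \<epsilon> x \<or> w = x)))"
  unfolding is_inductive_def is_empty_iff [symmetric] is_succ_iff [symmetric] by blast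

lemma mem_omega: "n \<epsilon> omega \<longleftrightarrow> (\<forall>I. is_inductive I \<longrightarrow> n \<epsilon> I)"
proof -
  obtain J where "is_inductive J" using infinity is_inductive_iff by blast
  then show ?thesis
    unfolding omega_def
    by (intro mem_setof_separation [where A = J and P = "\<lambda>n _ _. \<forall>I. is_inductive I \<longrightarrow> n \<epsilon> I"])
       (unfold is_inductive_iff, intro definable_intros, blast)
qed

lemma ex_product: "\<exists>P. \<forall>x y. x \<epsilon> A \<longrightarrow> y \<epsilon> B \<longrightarrow> opair x y \<epsilon> P"
proof -
  obtain U where U: "\<And>w. w \<epsilon> U \<longleftrightarrow> w \<epsilon> A \<or> w \<epsilon> B" using ex_union2 by blast
  obtain P where P: "\<And>w. w \<epsilon> P \<longleftrightarrow> (\<forall>v. v \<epsilon> w \<longrightarrow> v \<epsilon> U)" using power_set by blast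
  obtain Q where Q: "\<And>w. w \<epsilon> Q \<longleftrightarrow> (\<forall>v. v \<epsilon> w \<longrightarrow> v \<epsilon> P)" using power_set by blast
  show ?thesis by (rule exI [of _ Q]) (auto simp: Q P U opair_def)
qed

lemma ex_relations: "\<exists>P. \<forall>f. (\<forall>p. p \<epsilon> f \<longrightarrow> (\<exists>x y. x \<epsilon> A \<and> y \<epsilon> B \<and> p = opair x y)) \<longrightarrow> f \<epsilon> P"
proof -
  obtain Q where Q: "\<And>x y. x \<epsilon> A \<Longrightarrow> y \<epsilon> B \<Longrightarrow> opair x y \<epsilon> Q" using ex_product by blast
  obtain P where P: "\<And>w. w \<epsilon> P \<longleftrightarrow> (\<forall>v. v \<epsilon> w \<longrightarrow> v \<epsilon> Q)" using power_set by blast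
  show ?thesis by (rule exI [of _ P]) (auto simp: P intro: Q)
qed

lemma mem_fun_space: "f \<epsilon> fun_space A B \<longleftrightarrow> func f A B"
proof -
  obtain P where P: "\<And>f. (\<forall>p. p \<epsilon> f \<longrightarrow> (\<exists>x y. x \<epsilon> A \<and> y \<epsilon> B \<and> p = opair x y)) \<Longrightarrow> f \<epsilon> P"
    using ex_relations [of A B] by blast
  show ?thesis
    unfolding fun_space_def
    by (rule mem_setof_separation [where A = P and P = "\<lambda>f A B. func f A B"])
       (intro definable_intros, auto simp: func_def intro!: P)
qed

lemma app_eq_iff:
  assumes "func f A B" "x \<epsilon> A"
  shows "app f x = y \<longleftrightarrow> opair x y \<epsilon> f"
proof -
  have ex1: "\<exists>!y. opair x y \<epsilon> f" using assms unfolding func_def by blast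
  show ?thesis
    unfolding app_def using theI' [OF ex1] the1_equality [OF ex1, of y] by auto
qed

lemma app_mem: "func f A B \<Longrightarrow> x \<epsilon> A \<Longrightarrow> app f x \<epsilon> B"
  using app_eq_iff [of f A B x "app f x"] unfolding func_def by fastforce

lemma mem_restrict: "p \<epsilon> restrict f A \<longleftrightarrow> p \<epsilon> f \<and> (\<exists>x y. x \<epsilon> A \<and> p = opair x y)"
  unfolding restrict_def
  by (rule mem_setof_separation
        [where A = f and P = "\<lambda>p f A. p \<epsilon> f \<and> (\<exists>x y. x \<epsilon> A \<and> p = opair x y)"])
     (intro definable_intros, blast)

lemma mem_image:
  assumes "func f C B"
  shows "y \<epsilon> image f A \<longleftrightarrow> (\<exists>x. x \<epsilon> A \<and> opair x y \<epsilon> f)"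
  unfolding image_def
  by (rule mem_setof_separation [where A = B and P = "\<lambda>y f A. \<exists>x. x \<epsilon> A \<and> opair x y \<epsilon> f"])
     (intro definable_intros, use assms in \<open>fastforce simp: func_def\<close>)

lemma omega_induct_set:
  assumes "is_inductive e" "n \<epsilon> omega" shows "n \<epsilon> e"
  using assms mem_omega by blast

lemma omega_trans: "n \<epsilon> omega \<Longrightarrow> k \<epsilon> n \<Longrightarrow> k \<epsilon> omega"
proof -
  have "\<exists>B. \<forall>n. n \<epsilon> B \<longleftrightarrow> n \<epsilon> omega \<and> (\<forall>k. k \<epsilon> n \<longrightarrow> k \<epsilon> omega)"
    by (rule separation_set [where P = "\<lambda>n om _. \<forall>k. k \<epsilon> n \<longrightarrow> k \<epsilon> om" and b = omega])
       (intro definable_intros)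
  then obtain B where B: "\<And>n. n \<epsilon> B \<longleftrightarrow> n \<epsilon> omega \<and> (\<forall>k. k \<epsilon> n \<longrightarrow> k \<epsilon> omega)" by blast
  have "is_inductive B"
    unfolding is_inductive_def B by (auto simp: mem_omega is_inductive_def)
  then show "n \<epsilon> omega \<Longrightarrow> k \<epsilon> n \<Longrightarrow> k \<epsilon> omega"
    using omega_induct_set B by blast
qed

lemma mem_finite_seqs: "s \<epsilon> finite_seqs A \<longleftrightarrow> (\<exists>n. n \<epsilon> omega \<and> func s n A)"
proof -
  obtain P where P: "\<And>f. (\<forall>p. p \<epsilon> f \<longrightarrow> (\<exists>x y. x \<epsilon> omega \<and> y \<epsilon> A \<and> p = opair x y)) \<Longrightarrow> f \<epsilon> P"
    using ex_relations [of omega A] by blast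
  have in_P: "s \<epsilon> P" if "n \<epsilon> omega" "func s n A" for s n
    by (rule P) (use that omega_trans in \<open>unfold func_def, blast\<close>)
  show ?thesis
    unfolding finite_seqs_def
    by (rule mem_setof_separation [where A = P and P = "\<lambda>s om A. \<exists>n. n \<epsilon> om \<and> func s n A"])
       (intro definable_intros, use in_P in blast)
qed

lemma mem_distinct_tuples:
  "s \<epsilon> distinct_tuples n X \<longleftrightarrow> func s n X \<and>
     (\<forall>i j. i \<epsilon> n \<and> j \<epsilon> n \<and> i \<noteq> j \<longrightarrow> app s i \<noteq> app s j)"
proof -
  have eq: "s \<epsilon> fun_space n X \<and> (\<forall>i j. i \<epsilon> n \<and> j \<epsilon> n \<and> i \<noteq> j \<longrightarrow> app s i \<noteq> app s j) \<longleftrightarrow>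
      func s n X \<and> (\<forall>i j. i \<epsilon> n \<and> j \<epsilon> n \<and> i \<noteq> j \<longrightarrow> \<not> (\<exists>v. opair i v \<epsilon> s \<and> opair j v \<epsilon> s))" for s
  proof (cases "func s n X")
    case True
    have "app s i = app s j \<longleftrightarrow> (\<exists>v. opair i v \<epsilon> s \<and> opair j v \<epsilon> s)" if "i \<epsilon> n" "j \<epsilon> n" for i j
      by (auto simp flip: app_eq_iff [OF True that(1)] app_eq_iff [OF True that(2)])
    then show ?thesis unfolding mem_fun_space by blast
  qed (simp add: mem_fun_space)
  have "s \<epsilon> distinct_tuples n X \<longleftrightarrow>
      func s n X \<and> (\<forall>i j. i \<epsilon> n \<and> j \<epsilon> n \<and> i \<noteq> j \<longrightarrow> \<not> (\<exists>v. opair i v \<epsilon> s \<and> opair j v \<epsilon> s))"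
    unfolding distinct_tuples_def eq
    by (rule mem_setof_separation [where A = "fun_space n X" and
          P = "\<lambda>s n X. func s n X \<and>
            (\<forall>i j. i \<epsilon> n \<and> j \<epsilon> n \<and> i \<noteq> j \<longrightarrow> \<not> (\<exists>v. opair i v \<epsilon> s \<and> opair j v \<epsilon> s))"])
       (intro definable_intros, simp add: mem_fun_space)
  then show ?thesis unfolding eq [symmetric] mem_fun_space .
qed

lemma E0_iff:
  assumes "x \<epsilon> cantor" "y \<epsilon> cantor"
  shows "E0 x y \<longleftrightarrow> (\<exists>n. n \<epsilon> omega \<and> (\<forall>k. k \<epsilon> omega \<and> n \<epsilon> k \<longrightarrow>
    (\<exists>v. opair k v \<epsilon> x \<and> opair k v \<epsilon> y)))"
proof -
  have "app x k = app y k \<longleftrightarrow> (\<exists>v. opair k v \<epsilon> x \<and> opair k v \<epsilon> y)" if "k \<epsilon> omega" for k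
    by (auto simp flip: app_eq_iff [OF assms(1) [unfolded mem_fun_space] that]
        app_eq_iff [OF assms(2) [unfolded mem_fun_space] that])
  then show ?thesis unfolding E0_def by (simp cong: conj_cong imp_cong)
qed

lemma mem_E0_class:
  assumes x: "x \<epsilon> cantor"
  shows "y \<epsilon> E0_class x \<longleftrightarrow> y \<epsilon> cantor \<and> E0 x y"
proof -
  let ?D = "\<lambda>y om x. \<exists>n. n \<epsilon> om \<and>
    (\<forall>k. k \<epsilon> om \<and> n \<epsilon> k \<longrightarrow> (\<exists>v. opair k v \<epsilon> x \<and> opair k v \<epsilon> y))"
  have "\<exists>B. \<forall>y. y \<epsilon> B \<longleftrightarrow> y \<epsilon> cantor \<and> ?D y omega x"
    by (rule separation_set [where P = ?D]) (intro definable_intros)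
  then have "\<exists>B. \<forall>y. y \<epsilon> B \<longleftrightarrow> y \<epsilon> cantor \<and> E0 x y"
    using E0_iff [OF x] by (simp cong: conj_cong)
  then show ?thesis unfolding E0_class_def by (rule mem_setof)
qed

lemma mem_cantor_mod_E0: "c \<epsilon> cantor_mod_E0 \<longleftrightarrow> (\<exists>x. x \<epsilon> cantor \<and> c = E0_class x)"
proof -
  obtain P where P: "\<And>w. w \<epsilon> P \<longleftrightarrow> (\<forall>v. v \<epsilon> w \<longrightarrow> v \<epsilon> cantor)" using power_set by blast
  let ?D = "\<lambda>c om C. \<exists>x. x \<epsilon> C \<and> (\<forall>y. y \<epsilon> c \<longleftrightarrow> y \<epsilon> C \<and> (\<exists>n. n \<epsilon> om \<and>
      (\<forall>k. k \<epsilon> om \<and> n \<epsilon> k \<longrightarrow> (\<exists>v. opair k v \<epsilon> x \<and> opair k v \<epsilon> y))))"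
  have eq: "(\<exists>x. x \<epsilon> cantor \<and> c = E0_class x) \<longleftrightarrow> ?D c omega cantor" for c
  proof -
    have "c = E0_class x \<longleftrightarrow> (\<forall>y. y \<epsilon> c \<longleftrightarrow> y \<epsilon> cantor \<and> E0 x y)" if "x \<epsilon> cantor" for x
      using extensionality mem_E0_class [OF that] by auto
    moreover have "(y \<epsilon> cantor \<and> E0 x y) \<longleftrightarrow> y \<epsilon> cantor \<and> (\<exists>n. n \<epsilon> omega \<and>
        (\<forall>k. k \<epsilon> omega \<and> n \<epsilon> k \<longrightarrow> (\<exists>v. opair k v \<epsilon> x \<and> opair k v \<epsilon> y)))"
      if "x \<epsilon> cantor" for x y
      using E0_iff [OF that] by blast
    ultimately show ?thesis by (simp cong: conj_cong)
  qed
  show ?thesis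
    unfolding cantor_mod_E0_def eq
    by (rule mem_setof_separation [where A = P and P = ?D])
       (intro definable_intros, use P in blast)
qed

end

end

theory Submission
  imports Defs
begin

text \<open>
  For three reals \<open>x, y, z\<close> that are pairwise not \<open>E\<^sub>0\<close>-equivalent, record at each position which of
  the three is the odd one out. A counter climbs when the second and the first real are odd
  alternately and is reset when the third one is odd; the numbers at which it is reset, up to finitely
  many, depend only on the three \<open>E\<^sub>0\<close>-classes and code an \<open>E\<^sub>0\<close>-class. This is the map.

  Let \<open>X\<close> be in bijection with the quotient. The relation ``\<open>v\<close> lies in the class of \<open>X\<close> that
  corresponds to the class of \<open>u\<close>'' is total, so in the unfolded Banach-Mazur game player I
  has no winning strategy (a generic \<open>u\<close> defeats it), and a winning strategy of player II builds pairs
  \<open>(u, v)\<close> in the relation by finite approximations. Two runs whose \<open>u\<close> are extended synchronously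
  yield \<open>E\<^sub>0\<close>-equivalent \<open>v\<close>, so after a finite synchronous extension the digits
  of \<open>v\<close> beyond some \<open>N\<close> are forced to agree; two runs whose \<open>u\<close> differ infinitely often
  yield digits that differ somewhere beyond \<open>N\<close>. Keeping two of three runs synchronised and the third
  one not makes the third digit sequence the odd one out on a new segment. Iterating this, every
  pattern of odd ones, hence every \<open>E\<^sub>0\<close>-class, arises from three elements of \<open>X\<close>.
\<close>

section \<open>Definability with parameters\<close>

context ZF_model
begin

text \<open>The counter alternates because a segment gives little control: a chosen real can be made
  the odd one at some position of the segment, with no other real being odd there, but the number of
  such positions is unknown. The parity test lets the counter climb exactly once per segment. The
  reset gives invariance: the next reset wipes out what came before, and a value read at position
  \<open>i\<close> is at most \<open>i\<close>, so early resets affect early bits only. Value 0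
  carries no information, because all resets of a segment but its first read 0; hence bit
  \<open>n\<close> is coded by the value \<open>n + 1\<close>.

  Two runs cannot be kept synchronised on positions of the game alone, since the replies of player
  II extend the string in an uncontrolled way. A condition therefore carries a pending string, into
  which an extension made in one run is copied in the other.

  The structure need not satisfy choice, and its \<open>omega\<close> may be nonstandard. Infinite
  constructions pick elements of least code from countable sets, and inductions are made on
  definable statements only; this is why definability is tracked from the start.\<close>

definition merge :: "(nat \<Rightarrow> 'a) \<Rightarrow> (nat \<Rightarrow> 'a) \<Rightarrow> nat \<Rightarrow> 'a" where
  "merge \<rho> \<sigma> n = (if even n then \<rho> (n div 2) else \<sigma> (n div 2))"

text \<open>The parameters \<open>\<sigma>\<close> sit at the odd indices.\<close>

definition pdef :: "((nat \<Rightarrow> 'a) \<Rightarrow> bool) \<Rightarrow> bool" where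
  "pdef P \<longleftrightarrow> (\<exists>Q \<sigma>. definable Q \<and> (\<forall>\<rho>. P \<rho> \<longleftrightarrow> Q (merge \<rho> \<sigma>)))"

text \<open>A term counts as definable when its graph is. Variable 0 of the graph holds the value,
  which shifts the arguments by one.\<close>

definition pterm :: "((nat \<Rightarrow> 'a) \<Rightarrow> 'a) \<Rightarrow> bool" where
  "pterm t \<longleftrightarrow> pdef (\<lambda>\<rho>. \<rho> 0 = t (\<lambda>n. \<rho> (Suc n)))"

section \<open>Renaming of variables and closure under connectives and quantifiers\<close>

primrec rename :: "(nat \<Rightarrow> nat) \<Rightarrow> fm \<Rightarrow> fm" where
  "rename r (Mem i j) = Mem (r i) (r j)"
| "rename r (Eq i j) = Eq (r i) (r j)"
| "rename r (Neg \<phi>) = Neg (rename r \<phi>)"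
| "rename r (Conj \<phi> \<psi>) = Conj (rename r \<phi>) (rename r \<psi>)"
| "rename r (Forall \<phi>) = Forall (rename (case_nat 0 (\<lambda>n. Suc (r n))) \<phi>)"

lemma sat_rename: "sat E \<rho> (rename r \<phi>) \<longleftrightarrow> sat E (\<lambda>n. \<rho> (r n)) \<phi>"
proof (induction \<phi> arbitrary: \<rho> r)
  case (Forall \<phi>)
  have "(\<lambda>n. case_nat a \<rho> (case_nat 0 (\<lambda>n. Suc (r n)) n)) = case_nat a (\<lambda>n. \<rho> (r n))" for a
    by (auto split: nat.splits)
  then show ?case by (simp add: Forall.IH)
qed auto

lemma definable_rename: "definable P \<Longrightarrow> definable (\<lambda>\<rho>. P (\<lambda>n. \<rho> (r n)))"
  unfolding definable_def using sat_rename by metis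

lemma pdef_renameI:
  assumes "definable Q" "\<And>\<rho>. P \<rho> \<longleftrightarrow> Q (\<lambda>n. merge \<rho> \<sigma> (r n))"
  shows "pdef P"
  unfolding pdef_def using definable_rename [OF assms(1), of r] assms(2) by blast

named_theorems pdef_intros

lemma pdef_cong: "pdef P \<Longrightarrow> (\<And>\<rho>. Q \<rho> \<longleftrightarrow> P \<rho>) \<Longrightarrow> pdef Q"
  by presburger

lemma pdef_mem_var: "pdef (\<lambda>\<rho>. \<rho> i \<epsilon> \<rho> j)"
  by (rule pdef_renameI [OF definable_mem [of 0 1], where r = "case_nat (2*i) (\<lambda>_. 2*j)"])
    (auto simp: merge_def)

lemma pdef_eq_var: "pdef (\<lambda>\<rho>. \<rho> i = \<rho> j)"
  by (rule pdef_renameI [OF definable_eq [of 0 1], where r = "case_nat (2*i) (\<lambda>_. 2*j)"])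
    (auto simp: merge_def)

lemma pdef_not [pdef_intros]: "pdef P \<Longrightarrow> pdef (\<lambda>\<rho>. \<not> P \<rho>)"
  unfolding pdef_def using definable_not by fast

lemma pdef_conj [pdef_intros]:
  assumes "pdef P" "pdef P'" shows "pdef (\<lambda>\<rho>. P \<rho> \<and> P' \<rho>)"
proof -
  obtain Q \<sigma> where Q: "definable Q" "\<And>\<rho>. P \<rho> \<longleftrightarrow> Q (merge \<rho> \<sigma>)"
    using assms(1) unfolding pdef_def by blast
  obtain Q' \<sigma>' where Q': "definable Q'" "\<And>\<rho>. P' \<rho> \<longleftrightarrow> Q' (merge \<rho> \<sigma>')"
    using assms(2) unfolding pdef_def by blast
  \<comment> \<open>Both parameter lists are stored in a single one: \<open>\<sigma>\<close> is
    moved to the indices \<open>4 k + 1\<close> and \<open>\<sigma>'\<close> to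
    \<open>4 k + 3\<close>, while the variables at the even indices stay.\<close>
  let ?r = "\<lambda>n. if even n then n else 4 * (n div 2) + 1"
  let ?r' = "\<lambda>n. if even n then n else 4 * (n div 2) + 3"
  have d3: "(4 * k + 3) div 2 = Suc (2 * k)" for k :: nat by simp
  have 1: "(\<lambda>n. merge \<rho> (merge \<sigma> \<sigma>') (?r n)) = merge \<rho> \<sigma>" for \<rho>
    by (auto simp: merge_def fun_eq_iff elim!: oddE)
  have 2: "(\<lambda>n. merge \<rho> (merge \<sigma> \<sigma>') (?r' n)) = merge \<rho> \<sigma>'" for \<rho>
    by (auto simp: merge_def fun_eq_iff d3 elim!: oddE)
  have "definable (\<lambda>\<rho>. Q (\<lambda>n. \<rho> (?r n)) \<and> Q' (\<lambda>n. \<rho> (?r' n)))"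
    by (rule definable_conj [OF definable_rename [OF Q(1)] definable_rename [OF Q'(1)]])
  then show ?thesis
    unfolding pdef_def Q(2) Q'(2)
    by (intro exI [of _ "\<lambda>\<rho>. Q (\<lambda>n. \<rho> (?r n)) \<and> Q' (\<lambda>n. \<rho> (?r' n))"]
      exI [of _ "merge \<sigma> \<sigma>'"] conjI allI) (simp_all only: 1 2)
qed

lemma pdef_disj [pdef_intros]:
  assumes "pdef P" "pdef Q" shows "pdef (\<lambda>\<rho>. P \<rho> \<or> Q \<rho>)"
  by (rule pdef_cong [OF pdef_not [OF pdef_conj [OF assms [THEN pdef_not]]]]) blast

lemma pdef_imp [pdef_intros]:
  assumes "pdef P" "pdef Q" shows "pdef (\<lambda>\<rho>. P \<rho> \<longrightarrow> Q \<rho>)"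
  by (rule pdef_cong [OF pdef_disj [OF pdef_not [OF assms(1)] assms(2)]]) blast

lemma pdef_iff [pdef_intros]:
  assumes "pdef P" "pdef Q" shows "pdef (\<lambda>\<rho>. P \<rho> \<longleftrightarrow> Q \<rho>)"
  by (rule pdef_cong [OF pdef_conj [OF pdef_imp [OF assms] pdef_imp [OF assms(2,1)]]]) blast

lemma pdef_all [pdef_intros]:
  assumes "pdef (\<lambda>\<rho>. P (\<rho> 0) (\<lambda>n. \<rho> (Suc n)))"
  shows "pdef (\<lambda>\<rho>. \<forall>x. P x \<rho>)"
proof -
  obtain Q \<sigma> where Q: "definable Q" "\<And>\<rho>. P (\<rho> 0) (\<lambda>n. \<rho> (Suc n)) \<longleftrightarrow> Q (merge \<rho> \<sigma>)"
    using assms unfolding pdef_def by blast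
  \<comment> \<open>After the quantifier has pushed the bound value to index 0, the outer variable
    \<open>k\<close> sits at index \<open>2 k + 1\<close> and the parameter \<open>k\<close> at
    \<open>2 k + 2\<close>. The body expects them at \<open>2 k + 2\<close> and
    \<open>2 k + 1\<close>, so \<open>r\<close> exchanges these.\<close>
  define r where "r n = (if n = 0 then 0 else if even n then n - 1 else Suc n)" for n :: nat
  have 1: "(\<lambda>n. case_nat x (merge \<rho> \<sigma>) (r n)) = merge (case_nat x \<rho>) \<sigma>" for x \<rho>
  proof
    fix n show "case_nat x (merge \<rho> \<sigma>) (r n) = merge (case_nat x \<rho>) \<sigma> n"
    proof (cases "even n")
      case True
      then obtain k where "n = 2 * k" by blast
      then show ?thesis by (cases k) (auto simp: r_def merge_def)
    next
      case False
      then show ?thesis by (auto simp: r_def merge_def elim!: oddE)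
    qed
  qed
  have "definable (\<lambda>\<rho>. \<forall>x. Q (\<lambda>n. case_nat x \<rho> (r n)))"
  proof (rule definable_all)
    have "case_nat (\<rho> 0) (\<lambda>n. \<rho> (Suc n)) = \<rho>" for \<rho> :: "nat \<Rightarrow> 'a"
      by (auto split: nat.splits)
    then show "definable (\<lambda>\<rho>. Q (\<lambda>n. case_nat (\<rho> 0) (\<lambda>n. \<rho> (Suc n)) (r n)))"
      by (simp add: definable_rename [OF Q(1)])
  qed
  moreover have "(\<forall>x. P x \<rho>) \<longleftrightarrow> (\<forall>x. Q (\<lambda>n. case_nat x (merge \<rho> \<sigma>) (r n)))" for \<rho>
    using Q(2) [of "case_nat _ \<rho>"] by (simp add: 1)
  ultimately show ?thesis unfolding pdef_def by blast
qed

lemma pdef_ex [pdef_intros]: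
  assumes "pdef (\<lambda>\<rho>. P (\<rho> 0) (\<lambda>n. \<rho> (Suc n)))"
  shows "pdef (\<lambda>\<rho>. \<exists>x. P x \<rho>)"
proof -
  have "pdef (\<lambda>\<rho>. \<not> (\<forall>x. \<not> P x \<rho>))"
    by (rule pdef_not, rule pdef_all, rule pdef_not, rule assms)
  then show ?thesis by (rule pdef_cong) blast
qed

lemma pdef_rename:
  assumes "pdef P" shows "pdef (\<lambda>\<rho>. P (\<lambda>n. \<rho> (r n)))"
proof -
  obtain Q \<sigma> where Q: "definable Q" "\<And>\<rho>. P \<rho> \<longleftrightarrow> Q (merge \<rho> \<sigma>)"
    using assms unfolding pdef_def by blast
  have "merge (\<lambda>n. \<rho> (r n)) \<sigma> = (\<lambda>n. merge \<rho> \<sigma> (if even n then 2 * r (n div 2) else n))" for \<rho>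
    by (auto simp: merge_def fun_eq_iff)
  then show ?thesis using Q by (intro pdef_renameI [OF Q(1)]) simp
qed

text \<open>The values of all variables but the first are frozen as additional parameters,
  interleaved with the old ones in \<open>merge \<rho> \<sigma>\<close>.\<close>

lemma pdef_inst:
  assumes "pdef P" shows "pdef (\<lambda>\<rho>'. P (case_nat (\<rho>' 0) \<rho>))"
proof -
  obtain Q \<sigma> where Q: "definable Q" "\<And>\<rho>. P \<rho> \<longleftrightarrow> Q (merge \<rho> \<sigma>)"
    using assms unfolding pdef_def by blast
  have "merge (case_nat (\<rho>' 0) \<rho>) \<sigma> = (\<lambda>n. merge \<rho>' (merge \<rho> \<sigma>)
      (if n = 0 then 0 else if even n then 2 * (n - 2) + 1 else 2 * n + 1))" for \<rho>'
  proof
    fix n show "merge (case_nat (\<rho>' 0) \<rho>) \<sigma> n = merge \<rho>' (merge \<rho> \<sigma>)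
      (if n = 0 then 0 else if even n then 2 * (n - 2) + 1 else 2 * n + 1)"
    proof (cases "even n")
      case True
      then obtain k where "n = 2 * k" by blast
      then show ?thesis by (cases k) (auto simp: merge_def)
    next
      case False
      then show ?thesis by (auto simp: merge_def elim!: oddE)
    qed
  qed
  then show ?thesis using Q by (intro pdef_renameI [OF Q(1)]) simp
qed

lemma pdef_inst':
  assumes "pdef (\<lambda>\<rho>. P (\<rho> 0) (\<lambda>n. \<rho> (Suc n)))" shows "pdef (\<lambda>\<rho>'. P (\<rho>' 0) \<rho>)"
  using pdef_inst [OF assms, of \<rho>] by simp

section \<open>Definable terms and substitution\<close>

lemma pterm_var [pdef_intros]: "pterm (\<lambda>\<rho>. \<rho> i)"
  unfolding pterm_def by (rule pdef_eq_var)

lemma pterm_const [pdef_intros]: "pterm (\<lambda>\<rho>. c)"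
  unfolding pterm_def
  by (rule pdef_renameI [OF definable_eq [of 0 1], where r = id and \<sigma> = "\<lambda>_. c"]) (auto simp: merge_def)

lemma pterm_at:
  assumes "pterm t" shows "pdef (\<lambda>\<rho>. \<rho> i = t (\<lambda>n. \<rho> (k + n)))"
  using pdef_rename [OF assms [unfolded pterm_def], of "case_nat i (\<lambda>n. k + n)"] by simp

text \<open>The value of the term is named by a quantified variable, so the definability of its
  graph suffices.\<close>

lemma pdef_subst1:
  assumes "pdef (\<lambda>\<rho>. P (\<rho> 0))" "pterm t" shows "pdef (\<lambda>\<rho>. P (t \<rho>))"
proof (rule pdef_cong)
  show "pdef (\<lambda>\<rho>. \<exists>x. x = t \<rho> \<and> P x)"
    by (intro pdef_ex pdef_conj assms(1)) (use assms(2) in \<open>simp add: pterm_def\<close>)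
qed simp

lemma pdef_subst2:
  assumes "pdef (\<lambda>\<rho>. P (\<rho> 0) (\<rho> 1))" "pterm t" "pterm u" shows "pdef (\<lambda>\<rho>. P (t \<rho>) (u \<rho>))"
proof (rule pdef_cong)
  show "pdef (\<lambda>\<rho>. \<exists>y x. x = t \<rho> \<and> y = u \<rho> \<and> P x y)"
    by (intro pdef_ex pdef_conj) (use assms(1) pterm_at [OF assms(2), of 0 2]
      pterm_at [OF assms(3), of 1 2] in simp_all)
qed simp

lemma pdef_subst3:
  assumes "pdef (\<lambda>\<rho>. P (\<rho> 0) (\<rho> 1) (\<rho> 2))" "pterm t" "pterm u" "pterm v"
  shows "pdef (\<lambda>\<rho>. P (t \<rho>) (u \<rho>) (v \<rho>))"
proof (rule pdef_cong)
  show "pdef (\<lambda>\<rho>. \<exists>z y x. x = t \<rho> \<and> y = u \<rho> \<and> z = v \<rho> \<and> P x y z)"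
    by (intro pdef_ex pdef_conj) (use assms(1) pterm_at [OF assms(2), of 0 3]
      pterm_at [OF assms(3), of 1 3] pterm_at [OF assms(4), of 2 3] in
      \<open>simp_all add: numeral_eq_Suc\<close>)
qed simp

lemma pdef_subst4:
  assumes "pdef (\<lambda>\<rho>. P (\<rho> 0) (\<rho> 1) (\<rho> 2) (\<rho> 3))" "pterm t" "pterm u" "pterm v" "pterm w"
  shows "pdef (\<lambda>\<rho>. P (t \<rho>) (u \<rho>) (v \<rho>) (w \<rho>))"
proof (rule pdef_cong)
  show "pdef (\<lambda>\<rho>. \<exists>a z y x. x = t \<rho> \<and> y = u \<rho> \<and> z = v \<rho> \<and> a = w \<rho> \<and> P x y z a)"
    by (intro pdef_ex pdef_conj) (use assms(1) pterm_at [OF assms(2), of 0 4]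
      pterm_at [OF assms(3), of 1 4] pterm_at [OF assms(4), of 2 4] pterm_at [OF assms(5), of 3 4] in
      \<open>simp_all add: numeral_eq_Suc\<close>)
qed simp

lemma pdef_mem [pdef_intros]: "pterm t \<Longrightarrow> pterm u \<Longrightarrow> pdef (\<lambda>\<rho>. t \<rho> \<epsilon> u \<rho>)"
  by (rule pdef_subst2 [where P = "(\<epsilon>)", OF pdef_mem_var])

lemma pdef_eq [pdef_intros]: "pterm t \<Longrightarrow> pterm u \<Longrightarrow> pdef (\<lambda>\<rho>. t \<rho> = u \<rho>)"
  by (rule pdef_subst2 [where P = "(=)", OF pdef_eq_var])

lemma pdef_const [pdef_intros]: "pdef (\<lambda>\<rho>. c)"
proof -
  have T: "pdef (\<lambda>\<rho>. empty = empty)" by (intro pdef_intros)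
  show ?thesis using T pdef_not [OF T] by (cases c) auto
qed

lemma pterm_if [pdef_intros]:
  assumes "pdef P" "pterm t" "pterm u" shows "pterm (\<lambda>\<rho>. if P \<rho> then t \<rho> else u \<rho>)"
proof -
  have P: "pdef (\<lambda>\<rho>. P (\<lambda>n. \<rho> (Suc n)))" by (rule pdef_rename [OF assms(1)])
  show ?thesis
    unfolding pterm_def
    by (rule pdef_cong [OF pdef_disj [OF
          pdef_conj [OF P assms(2) [unfolded pterm_def]]
          pdef_conj [OF pdef_not [OF P] assms(3) [unfolded pterm_def]]]]) auto
qed

text \<open>
  Unlike that of \<open>THE\<close>, the value of \<open>iota\<close> is fixed also when there is no unique
  witness, so that terms built with it remain definable.
\<close>

definition iota :: "('a \<Rightarrow> bool) \<Rightarrow> 'a" where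
  "iota P = (if \<exists>!x. P x then THE x. P x else empty)"

lemma iota_eq:
  assumes "P x" "\<And>y. P y \<Longrightarrow> y = x" shows "iota P = x"
proof -
  have 1: "\<exists>!x. P x" using assms by (rule ex1I)
  show ?thesis unfolding iota_def using 1 the1_equality [OF 1 assms(1)] by simp
qed

lemma iotaI: "\<exists>!x. P x \<Longrightarrow> P (iota P)"
  unfolding iota_def using theI' [of P] by simp

lemma pterm_iota [pdef_intros]:
  assumes "pdef (\<lambda>\<rho>. P (\<rho> 0) (\<lambda>n. \<rho> (Suc n)))"
  shows "pterm (\<lambda>\<rho>. iota (\<lambda>x. P x \<rho>))"
proof -
  have shift: "pdef (\<lambda>\<rho>. P (\<rho> 0) (\<lambda>n. \<rho> (k + n)))" if "k > 0" for k
    using pdef_rename [OF assms, of "case_nat 0 (\<lambda>n. k + n)"] that by (simp add: ac_simps)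
  have a: "z = iota Q \<longleftrightarrow> (Q z \<and> (\<forall>y. Q y \<longrightarrow> y = z)) \<or> (\<not> (\<exists>x. Q x \<and> (\<forall>y. Q y \<longrightarrow> y = x)) \<and> z = empty)" for z Q
  proof (cases "\<exists>!x. Q x")
    case True
    then have "Q (iota Q)" by (rule iotaI)
    with True show ?thesis by blast
  next
    case False
    then have "iota Q = empty" by (auto simp: iota_def)
    with False show ?thesis by auto
  qed
  have 1: "pdef (\<lambda>\<rho>. \<forall>y. P y (\<lambda>n. \<rho> (Suc n)) \<longrightarrow> y = \<rho> 0)"
    using shift [of 2] by (intro pdef_intros) simp
  have 2: "pdef (\<lambda>\<rho>. \<exists>x. P x (\<lambda>n. \<rho> (Suc n)) \<and> (\<forall>y. P y (\<lambda>n. \<rho> (Suc n)) \<longrightarrow> y = x))"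
    using shift [of 3] shift [of 2] by (intro pdef_intros) (simp_all add: numeral_eq_Suc)
  have 0: "pdef (\<lambda>\<rho>. P (\<rho> 0) (\<lambda>n. \<rho> (Suc n)))" using shift [of 1] by simp
  show ?thesis
    unfolding pterm_def
    by (rule pdef_cong [OF pdef_disj [OF pdef_conj [OF 0 1] pdef_conj [OF pdef_not [OF 2]
          pdef_eq [OF pterm_var pterm_const]]]]) (rule a)
qed

section \<open>Separation and replacement with parameters\<close>

text \<open>Takes the place of \<open>setof\<close>, whose \<open>THE\<close> has an unspecified
  value when there is no such set and hence does not yield a definable term.\<close>

definition Set :: "('a \<Rightarrow> bool) \<Rightarrow> 'a" where
  "Set P = iota (\<lambda>z. \<forall>w. w \<epsilon> z \<longleftrightarrow> P w)"

lemma Set_eqI: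
  assumes "\<And>w. w \<epsilon> z \<longleftrightarrow> P w" shows "Set P = z"
  unfolding Set_def
proof (rule iota_eq)
  show "\<forall>w. w \<epsilon> z \<longleftrightarrow> P w" using assms by simp
  show "y = z" if "\<forall>w. w \<epsilon> y \<longleftrightarrow> P w" for y
    using extensionality that assms by simp
qed

lemma mem_Set: "\<exists>z. \<forall>w. w \<epsilon> z \<longleftrightarrow> P w \<Longrightarrow> w \<epsilon> Set P \<longleftrightarrow> P w"
  using Set_eqI [of _ P] by auto

lemma pterm_Set [pdef_intros]:
  assumes "pdef (\<lambda>\<rho>. P (\<rho> 0) (\<lambda>n. \<rho> (Suc n)))"
  shows "pterm (\<lambda>\<rho>. Set (\<lambda>x. P x \<rho>))"
proof -
  have "pdef (\<lambda>\<rho>. P (\<rho> 0) (\<lambda>n. \<rho> (Suc (Suc n))))"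
    using pdef_rename [OF assms, of "case_nat 0 (\<lambda>n. 2 + n)"] by simp
  then show ?thesis unfolding Set_def by (intro pdef_intros) simp_all
qed

lemma sep_ex:
  assumes "pdef (\<lambda>\<rho>. P (\<rho> 0))" shows "\<exists>B. \<forall>x. x \<epsilon> B \<longleftrightarrow> x \<epsilon> A \<and> P x"
proof -
  obtain Q \<sigma> where Q: "definable Q" "\<And>\<rho>. P (\<rho> 0) \<longleftrightarrow> Q (merge \<rho> \<sigma>)"
    using assms unfolding pdef_def by blast
  obtain \<phi> where \<phi>: "\<And>\<rho>. Q \<rho> \<longleftrightarrow> sat mem \<rho> \<phi>" using Q(1) unfolding definable_def by blast
  \<comment> \<open>The variables other than \<open>x\<close> do not matter for \<open>P\<close>, so
    their places may be filled with \<open>\<sigma>\<close> too.\<close>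
  have *: "case_nat x (\<lambda>n. merge \<sigma> \<sigma> (Suc n)) = merge (case_nat x (\<lambda>n. \<sigma> (Suc n))) \<sigma>" for x
  proof
    fix n show "case_nat x (\<lambda>n. merge \<sigma> \<sigma> (Suc n)) n = merge (case_nat x (\<lambda>n. \<sigma> (Suc n))) \<sigma> n"
    proof (cases "even n")
      case True
      then obtain k where "n = 2 * k" by blast
      then show ?thesis by (cases k) (auto simp: merge_def)
    next
      case False
      then show ?thesis by (auto simp: merge_def elim!: oddE)
    qed
  qed
  have "sat mem (case_nat x (\<lambda>n. merge \<sigma> \<sigma> (Suc n))) \<phi> \<longleftrightarrow> P x" for x
    using Q(2) [of "case_nat x (\<lambda>n. \<sigma> (Suc n))"] by (simp add: * \<phi>)
  then show ?thesis using separation [rule_format, of A "\<lambda>n. merge \<sigma> \<sigma> (Suc n)" \<phi>] by simp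
qed

lemma mem_Set_sep:
  assumes "pdef (\<lambda>\<rho>. P (\<rho> 0))" "\<And>x. P x \<Longrightarrow> x \<epsilon> A"
  shows "w \<epsilon> Set P \<longleftrightarrow> P w"
  by (rule mem_Set) (use sep_ex [OF assms(1), of A] assms(2) in blast)

lemma repl_ex:
  assumes "pdef (\<lambda>\<rho>. \<rho> 0 = t (\<rho> 1))"
  shows "\<exists>B. \<forall>y. y \<epsilon> B \<longleftrightarrow> (\<exists>x. x \<epsilon> A \<and> y = t x)"
proof -
  obtain Q \<sigma> where Q: "definable Q" "\<And>\<rho>. \<rho> 0 = t (\<rho> 1) \<longleftrightarrow> Q (merge \<rho> \<sigma>)"
    using assms unfolding pdef_def by blast
  obtain \<phi> where \<phi>: "\<And>\<rho>. Q \<rho> \<longleftrightarrow> sat mem \<rho> \<phi>" using Q(1) unfolding definable_def by blast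
  define \<rho> where "\<rho> = merge \<sigma> \<sigma>"
  \<comment> \<open>The axiom expects the argument at index 0 and the value at index 1, whereas the
    merged graph has the value at index 0 and the argument at index 2.\<close>
  let ?r = "\<lambda>n::nat. if n = 0 then 1 else if n = 2 then 0 else n + 2"
  have *: "sat mem (case_nat x (case_nat y \<rho>)) (rename ?r \<phi>) \<longleftrightarrow> y = t x" for x y
  proof -
    have "(\<lambda>n. case_nat x (case_nat y \<rho>) (?r n))
       = merge (case_nat y (case_nat x (\<lambda>n. \<sigma> (Suc (Suc n))))) \<sigma>" (is "?l = ?m")
    proof
      fix n show "?l n = ?m n"
      proof (cases "even n")
        case True
        then obtain k where k: "n = 2 * k" by blast
        show ?thesis
        proof (cases k)
          case (Suc l)
          then show ?thesis using k by (cases l) (auto simp: \<rho>_def merge_def)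
        qed (use k in \<open>auto simp: merge_def\<close>)
      next
        case False
        then show ?thesis by (auto simp: \<rho>_def merge_def elim!: oddE)
      qed
    qed
    then show ?thesis
      using Q(2) [of "case_nat y (case_nat x (\<lambda>n. \<sigma> (Suc (Suc n))))"] by (simp add: sat_rename \<phi>)
  qed
  show ?thesis using replacement [rule_format, of A \<rho> "rename ?r \<phi>"] by (auto simp: *)
qed

lemma repl_ex':
  assumes "pterm (\<lambda>\<rho>. t (\<rho> 0))"
  shows "\<exists>B. \<forall>y. y \<epsilon> B \<longleftrightarrow> (\<exists>x. x \<epsilon> A \<and> y = t x)"
  using assms unfolding pterm_def by (intro repl_ex) simp

section \<open>Functions, natural numbers and recursion\<close>

lemma pdef_definable: "definable P \<Longrightarrow> pdef P"
  by (rule pdef_renameI [of P _ _ "\<lambda>n. 2 * n"]) (auto simp: merge_def)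

lemma pterm_rename: "pterm t \<Longrightarrow> pterm (\<lambda>\<rho>. t (\<lambda>n. \<rho> (r n)))"
  unfolding pterm_def using pdef_rename [of "\<lambda>\<rho>. \<rho> 0 = t (\<lambda>n. \<rho> (Suc n))" "case_nat 0 (\<lambda>n. Suc (r n))"]
  by simp

lemma pterm_subst1:
  assumes "pdef (\<lambda>\<rho>. \<rho> 0 = f (\<rho> 1))" "pterm t" shows "pterm (\<lambda>\<rho>. f (t \<rho>))"
  unfolding pterm_def
  by (rule pdef_subst2 [where P = "\<lambda>z x. z = f x", OF assms(1) pterm_var pterm_rename [OF assms(2)]])

lemma pterm_subst2:
  assumes "pdef (\<lambda>\<rho>. \<rho> 0 = f (\<rho> 1) (\<rho> 2))" "pterm t" "pterm u" shows "pterm (\<lambda>\<rho>. f (t \<rho>) (u \<rho>))"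
  unfolding pterm_def
  by (rule pdef_subst3 [where P = "\<lambda>z x y. z = f x y", OF assms(1) pterm_var
        pterm_rename [OF assms(2)] pterm_rename [OF assms(3)]])

lemma pterm_opair [pdef_intros]: "pterm t \<Longrightarrow> pterm u \<Longrightarrow> pterm (\<lambda>\<rho>. opair (t \<rho>) (u \<rho>))"
  by (rule pterm_subst2 [where f = opair, OF pdef_definable [OF definable_opair]])

lemma pterm_succ [pdef_intros]: "pterm t \<Longrightarrow> pterm (\<lambda>\<rho>. succ (t \<rho>))"
  by (rule pterm_subst1) (unfold is_succ_iff, intro pdef_intros)

lemma pdef_func [pdef_intros]:
  "pterm f \<Longrightarrow> pterm A \<Longrightarrow> pterm B \<Longrightarrow> pdef (\<lambda>\<rho>. func (f \<rho>) (A \<rho>) (B \<rho>))"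
  by (rule pdef_subst3 [where P = func, OF pdef_definable [OF definable_func]])

lemma pdef_subset [pdef_intros]: "pterm t \<Longrightarrow> pterm u \<Longrightarrow> pdef (\<lambda>\<rho>. subset (t \<rho>) (u \<rho>))"
  by (rule pdef_subst2 [where P = subset]) (unfold subset_def, intro pdef_intros)

lemma pterm_restrict [pdef_intros]: "pterm t \<Longrightarrow> pterm u \<Longrightarrow> pterm (\<lambda>\<rho>. restrict (t \<rho>) (u \<rho>))"
proof (rule pterm_subst2 [where f = restrict])
  have "z = restrict f A \<longleftrightarrow> (\<forall>p. p \<epsilon> z \<longleftrightarrow> p \<epsilon> f \<and> (\<exists>x y. x \<epsilon> A \<and> p = opair x y))" for z f A
    using extensionality mem_restrict by metis
  then show "pdef (\<lambda>\<rho>. \<rho> 0 = restrict (\<rho> 1) (\<rho> 2))"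
    by (simp only:) (intro pdef_intros)
qed

text \<open>Agrees with \<open>app\<close> on the domain of a function, but is built on
  \<open>iota\<close> and so remains a definable term without side conditions.\<close>

definition ap :: "'a \<Rightarrow> 'a \<Rightarrow> 'a"  (infixl "\<cdot>" 90) where
  "ap f x = iota (\<lambda>y. opair x y \<epsilon> f)"

definition dm :: "'a \<Rightarrow> 'a" where
  "dm f = Set (\<lambda>x. \<exists>y. opair x y \<epsilon> f)"

definition Lam :: "'a \<Rightarrow> ('a \<Rightarrow> 'a) \<Rightarrow> 'a" where
  "Lam A t = Set (\<lambda>p. \<exists>x. x \<epsilon> A \<and> p = opair x (t x))"

definition snoc :: "'a \<Rightarrow> 'a \<Rightarrow> 'a" where
  "snoc s m = Set (\<lambda>p. p \<epsilon> s \<or> p = opair (dm s) m)"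

definition prod :: "'a \<Rightarrow> 'a \<Rightarrow> 'a" where
  "prod A B = Set (\<lambda>p. \<exists>x y. x \<epsilon> A \<and> y \<epsilon> B \<and> p = opair x y)"

definition pfst :: "'a \<Rightarrow> 'a" where
  "pfst p = iota (\<lambda>x. \<exists>y. p = opair x y)"

definition psnd :: "'a \<Rightarrow> 'a" where
  "psnd p = iota (\<lambda>y. \<exists>x. p = opair x y)"

lemma pterm_ap [pdef_intros]: "pterm t \<Longrightarrow> pterm u \<Longrightarrow> pterm (\<lambda>\<rho>. t \<rho> \<cdot> u \<rho>)"
  by (rule pterm_subst2 [where f = "(\<cdot>)"]) (unfold ap_def, intro pdef_intros)

lemma pterm_dm [pdef_intros]: "pterm t \<Longrightarrow> pterm (\<lambda>\<rho>. dm (t \<rho>))"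
  by (rule pterm_subst1) (unfold dm_def, intro pdef_intros)

lemma pterm_snoc [pdef_intros]: "pterm t \<Longrightarrow> pterm u \<Longrightarrow> pterm (\<lambda>\<rho>. snoc (t \<rho>) (u \<rho>))"
  by (rule pterm_subst2 [where f = snoc]) (unfold snoc_def, intro pdef_intros)

lemma pterm_prod [pdef_intros]: "pterm t \<Longrightarrow> pterm u \<Longrightarrow> pterm (\<lambda>\<rho>. prod (t \<rho>) (u \<rho>))"
  by (rule pterm_subst2 [where f = prod]) (unfold prod_def, intro pdef_intros)

lemma pterm_pfst [pdef_intros]: "pterm t \<Longrightarrow> pterm (\<lambda>\<rho>. pfst (t \<rho>))"
  by (rule pterm_subst1) (unfold pfst_def, intro pdef_intros)

lemma pterm_psnd [pdef_intros]: "pterm t \<Longrightarrow> pterm (\<lambda>\<rho>. psnd (t \<rho>))"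
  by (rule pterm_subst1) (unfold psnd_def, intro pdef_intros)

lemma pterm_Lam [pdef_intros]:
  assumes "pterm A" "pterm (\<lambda>\<rho>. t (\<rho> 0) (\<lambda>n. \<rho> (Suc n)))"
  shows "pterm (\<lambda>\<rho>. Lam (A \<rho>) (\<lambda>x. t x \<rho>))"
proof -
  have A: "pterm (\<lambda>\<rho>. A (\<lambda>n. \<rho> (Suc (Suc n))))" by (rule pterm_rename [OF assms(1)])
  have t: "pterm (\<lambda>\<rho>. t (\<rho> 0) (\<lambda>n. \<rho> (Suc (Suc n))))"
    using pterm_rename [OF assms(2), of "case_nat 0 (\<lambda>n. Suc (Suc n))"] by simp
  show ?thesis unfolding Lam_def
    by (intro pterm_Set pdef_ex pdef_conj pdef_mem pdef_eq pterm_opair A t pterm_var)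
qed

lemma pfst_opair [simp]: "pfst (opair x y) = x"
  unfolding pfst_def by (rule iota_eq) auto

lemma psnd_opair [simp]: "psnd (opair x y) = y"
  unfolding psnd_def by (rule iota_eq) auto

lemma set_eqI: "(\<And>w. w \<epsilon> x \<longleftrightarrow> w \<epsilon> y) \<Longrightarrow> x = y"
  using extensionality by simp

lemma mem_prod: "p \<epsilon> prod A B \<longleftrightarrow> (\<exists>x y. x \<epsilon> A \<and> y \<epsilon> B \<and> p = opair x y)"
proof -
  obtain Q where Q: "\<And>x y. x \<epsilon> A \<Longrightarrow> y \<epsilon> B \<Longrightarrow> opair x y \<epsilon> Q" using ex_product by blast
  show ?thesis unfolding prod_def
    by (rule mem_Set_sep [where A = Q]) (intro pdef_intros, use Q in blast)
qed

lemma opair_mem_prod [simp]: "opair x y \<epsilon> prod A B \<longleftrightarrow> x \<epsilon> A \<and> y \<epsilon> B"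
  by (simp add: mem_prod)

lemma prodE:
  assumes "p \<epsilon> prod A B"
  obtains x y where "x \<epsilon> A" "y \<epsilon> B" "p = opair x y"
  using assms unfolding mem_prod by blast

lemma func_opair_iff:
  assumes "func f A B"
  shows "opair x y \<epsilon> f \<longleftrightarrow> x \<epsilon> A \<and> y = f \<cdot> x"
proof
  have *: "opair x y \<epsilon> f \<Longrightarrow> x \<epsilon> A" for x y using assms unfolding func_def by fastforce
  have ex1: "x \<epsilon> A \<Longrightarrow> \<exists>!y. opair x y \<epsilon> f" for x using assms unfolding func_def by blast
  {
    assume 1: "opair x y \<epsilon> f"
    then have "f \<cdot> x = y" unfolding ap_def using ex1 [OF * [OF 1]] by (intro iota_eq) auto
    then show "x \<epsilon> A \<and> y = f \<cdot> x" using * [OF 1] by simp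
  }
  assume "x \<epsilon> A \<and> y = f \<cdot> x"
  then show "opair x y \<epsilon> f" using iotaI [OF ex1] unfolding ap_def by simp
qed

lemma func_mem_iff:
  assumes "func f A B"
  shows "p \<epsilon> f \<longleftrightarrow> (\<exists>x. x \<epsilon> A \<and> p = opair x (f \<cdot> x))"
proof
  assume "p \<epsilon> f"
  then obtain x y where "p = opair x y" using assms unfolding func_def by blast
  then show "\<exists>x. x \<epsilon> A \<and> p = opair x (f \<cdot> x)"
    using func_opair_iff [OF assms] \<open>p \<epsilon> f\<close> by auto
qed (use func_opair_iff [OF assms] in auto)

lemma ap_mem: "func f A B \<Longrightarrow> x \<epsilon> A \<Longrightarrow> f \<cdot> x \<epsilon> B"
  using func_opair_iff [of f A B x "f \<cdot> x"] unfolding func_def by fastforce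

lemma app_ap: "func f A B \<Longrightarrow> x \<epsilon> A \<Longrightarrow> app f x = f \<cdot> x"
  using func_opair_iff app_eq_iff by metis

lemma func_eqI:
  assumes "func f A B" "func g A C" "\<And>x. x \<epsilon> A \<Longrightarrow> f \<cdot> x = g \<cdot> x"
  shows "f = g"
  by (rule set_eqI) (use assms in \<open>auto simp: func_mem_iff [OF assms(1)] func_mem_iff [OF assms(2)]\<close>)

lemma funcI:
  assumes "\<And>p. p \<epsilon> f \<longleftrightarrow> (\<exists>x. x \<epsilon> A \<and> p = opair x (t x))" "\<And>x. x \<epsilon> A \<Longrightarrow> t x \<epsilon> B"
  shows "func f A B"
  unfolding func_def using assms by auto

lemma ap_eqI:
  assumes "\<And>p. p \<epsilon> f \<longleftrightarrow> (\<exists>x. x \<epsilon> A \<and> p = opair x (t x))" "x \<epsilon> A"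
  shows "f \<cdot> x = t x"
  unfolding ap_def by (rule iota_eq) (use assms in auto)

lemma func_cod: "func f A B \<Longrightarrow> (\<And>x. x \<epsilon> A \<Longrightarrow> f \<cdot> x \<epsilon> C) \<Longrightarrow> func f A C"
  by (rule funcI [where t = "\<lambda>x. f \<cdot> x"]) (auto simp: func_mem_iff)

lemma dm_func: "func f A B \<Longrightarrow> dm f = A"
  unfolding dm_def by (rule Set_eqI) (auto simp: func_opair_iff)

lemma mem_Lam:
  assumes "pterm (\<lambda>\<rho>. t (\<rho> 0))"
  shows "p \<epsilon> Lam A t \<longleftrightarrow> (\<exists>x. x \<epsilon> A \<and> p = opair x (t x))"
  unfolding Lam_def
  by (rule mem_Set [OF repl_ex']) (intro pdef_intros assms)

lemma func_Lam:
  assumes "pterm (\<lambda>\<rho>. t (\<rho> 0))" "\<And>x. x \<epsilon> A \<Longrightarrow> t x \<epsilon> B"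
  shows "func (Lam A t) A B"
  by (rule funcI [where t = t]) (auto simp: mem_Lam assms)

lemma ap_Lam:
  assumes "pterm (\<lambda>\<rho>. t (\<rho> 0))" "x \<epsilon> A" shows "Lam A t \<cdot> x = t x"
  by (rule ap_eqI) (auto simp: mem_Lam assms)

lemma restrict_ap:
  assumes "func f A B" "\<And>x. x \<epsilon> C \<Longrightarrow> x \<epsilon> A"
  shows func_restrict: "func (restrict f C) C B" and "x \<epsilon> C \<Longrightarrow> restrict f C \<cdot> x = f \<cdot> x"
proof -
  have *: "p \<epsilon> restrict f C \<longleftrightarrow> (\<exists>x. x \<epsilon> C \<and> p = opair x (f \<cdot> x))" for p
    unfolding mem_restrict func_mem_iff [OF assms(1)] using assms(2) by auto
  show "func (restrict f C) C B" by (rule funcI [OF *]) (use ap_mem assms in auto)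
  show "x \<epsilon> C \<Longrightarrow> restrict f C \<cdot> x = f \<cdot> x" by (rule ap_eqI [OF *])
qed

lemma func_subset:
  assumes "func f A B" "func g C D" "\<And>x. x \<epsilon> A \<Longrightarrow> x \<epsilon> C" "\<And>x. x \<epsilon> A \<Longrightarrow> f \<cdot> x = g \<cdot> x"
  shows "subset f g"
  unfolding subset_def func_mem_iff [OF assms(1)] func_mem_iff [OF assms(2)] using assms(3,4) by auto

lemma subset_ap:
  assumes "func f A B" "func g C D" "subset f g"
  shows subset_dom: "x \<epsilon> A \<Longrightarrow> x \<epsilon> C" and "x \<epsilon> A \<Longrightarrow> g \<cdot> x = f \<cdot> x"
proof -
  assume "x \<epsilon> A"
  then have "opair x (f \<cdot> x) \<epsilon> g" using assms(3) unfolding subset_def func_mem_iff [OF assms(1)] by blast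
  then show "x \<epsilon> C" "g \<cdot> x = f \<cdot> x" using func_opair_iff [OF assms(2)] by auto
qed

lemma subset_refl [simp]: "subset x x" by (simp add: subset_def)

lemma subset_trans: "subset x y \<Longrightarrow> subset y z \<Longrightarrow> subset x z" by (simp add: subset_def)

section \<open>The natural numbers of the structure\<close>

lemma om_0 [simp]: "empty \<epsilon> omega"
  by (simp add: mem_omega is_inductive_def)

lemma om_succ [simp]: "n \<epsilon> omega \<Longrightarrow> succ n \<epsilon> omega"
  by (simp add: mem_omega is_inductive_def)

text \<open>As \<open>omega\<close> may be nonstandard, induction is available for definable
  predicates only; each use begins with a definability goal, the case \<open>def\<close>.\<close>

lemma om_induct [consumes 1, case_names def 0 succ]:
  assumes "n \<epsilon> omega" "pdef (\<lambda>\<rho>. P (\<rho> 0))" "P empty" "\<And>n. n \<epsilon> omega \<Longrightarrow> P n \<Longrightarrow> P (succ n)"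
  shows "P n"
proof -
  obtain B where B: "\<And>x. x \<epsilon> B \<longleftrightarrow> x \<epsilon> omega \<and> P x" using sep_ex [OF assms(2)] by blast
  have "is_inductive B" unfolding is_inductive_def using B assms by simp
  then show ?thesis using omega_induct_set assms(1) B by blast
qed

lemma not_mem_self [simp]: "\<not> x \<epsilon> x"
  using foundation [rule_format, of "upair x x"] by auto

lemma mem_asym: "x \<epsilon> y \<Longrightarrow> \<not> y \<epsilon> x"
  using foundation [rule_format, of "upair x y"] by auto

lemma succ_neq [simp]: "succ x \<noteq> empty" "empty \<noteq> succ x" "succ x \<noteq> x" "x \<noteq> succ x"
proof -
  have "x \<epsilon> succ x" by simp
  then show "succ x \<noteq> empty" "empty \<noteq> succ x" "succ x \<noteq> x" "x \<noteq> succ x"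
    by (metis mem_empty, metis mem_empty, metis not_mem_self, metis not_mem_self)
qed

lemma succ_inj [simp]: "succ m = succ n \<longleftrightarrow> m = n"
proof
  assume "succ m = succ n"
  then have "m \<epsilon> succ n" "n \<epsilon> succ m" using mem_succ [of m m] mem_succ [of n n] by auto
  then show "m = n" using mem_asym by auto
qed simp

lemma om_trans: "k \<epsilon> m \<Longrightarrow> m \<epsilon> n \<Longrightarrow> n \<epsilon> omega \<Longrightarrow> k \<epsilon> n"
proof -
  have "n \<epsilon> omega \<Longrightarrow> \<forall>m k. m \<epsilon> n \<longrightarrow> k \<epsilon> m \<longrightarrow> k \<epsilon> n"
    by (induction n rule: om_induct) (intro pdef_intros, auto)
  then show "k \<epsilon> m \<Longrightarrow> m \<epsilon> n \<Longrightarrow> n \<epsilon> omega \<Longrightarrow> k \<epsilon> n" by blast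
qed

lemma om_zero_cases: "n \<epsilon> omega \<Longrightarrow> n = empty \<or> empty \<epsilon> n"
  by (induction n rule: om_induct) (intro pdef_intros, auto)

lemma zero_mem_succ [simp]: "n \<epsilon> omega \<Longrightarrow> empty \<epsilon> succ n"
  using om_zero_cases by auto

lemma om_succ_mono: "n \<epsilon> omega \<Longrightarrow> m \<epsilon> n \<Longrightarrow> succ m \<epsilon> succ n"
proof -
  have "n \<epsilon> omega \<Longrightarrow> \<forall>m. m \<epsilon> n \<longrightarrow> succ m \<epsilon> succ n"
    by (induction n rule: om_induct) (intro pdef_intros, auto)
  then show "n \<epsilon> omega \<Longrightarrow> m \<epsilon> n \<Longrightarrow> succ m \<epsilon> succ n" by blast
qed

lemma om_linear: "m \<epsilon> omega \<Longrightarrow> n \<epsilon> omega \<Longrightarrow> m \<epsilon> n \<or> m = n \<or> n \<epsilon> m"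
proof (induction m rule: om_induct)
  case def show ?case by (intro pdef_intros)
next
  case 0 then show ?case using om_zero_cases by auto
next
  case (succ m) then show ?case using om_succ_mono [of n m] by auto
qed

lemma om_succ_mono_iff: "n \<epsilon> omega \<Longrightarrow> m \<epsilon> omega \<Longrightarrow> succ m \<epsilon> succ n \<longleftrightarrow> m \<epsilon> n"
  using om_succ_mono om_linear [of m n] mem_asym om_succ_mono [of m n] by (auto dest: mem_asym)

text \<open>Here and below, \<open>m \<epsilon> succ n\<close> expresses that \<open>m\<close> is at
  most \<open>n\<close>.\<close>

lemma om_not_mem: "m \<epsilon> omega \<Longrightarrow> n \<epsilon> omega \<Longrightarrow> \<not> m \<epsilon> n \<longleftrightarrow> n \<epsilon> succ m"
  using om_linear [of m n] mem_asym by auto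

lemma om_cases: "n \<epsilon> omega \<Longrightarrow> n = empty \<or> (\<exists>m. m \<epsilon> omega \<and> n = succ m)"
  by (induction n rule: om_induct) (intro pdef_intros, auto)

text \<open>Foundation, applied to the set of all witnesses in \<open>omega\<close>, yields a
  minimal one.\<close>

lemma om_least:
  assumes "pdef (\<lambda>\<rho>. P (\<rho> 0))" "n \<epsilon> omega" "P n"
  shows "\<exists>m. m \<epsilon> omega \<and> P m \<and> (\<forall>k. k \<epsilon> m \<longrightarrow> \<not> P k)"
proof -
  obtain B where B: "\<And>x. x \<epsilon> B \<longleftrightarrow> x \<epsilon> omega \<and> P x" using sep_ex [OF assms(1)] by blast
  then obtain m where "m \<epsilon> B" "\<not> (\<exists>w. w \<epsilon> m \<and> w \<epsilon> B)" using foundation assms by blast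
  then show ?thesis using B omega_trans by blast
qed

lemma om_upper2: "m \<epsilon> omega \<Longrightarrow> n \<epsilon> omega \<Longrightarrow> \<exists>k. k \<epsilon> omega \<and> m \<epsilon> k \<and> n \<epsilon> k"
  using om_linear [of m n] mem_succ om_succ by metis

section \<open>Finite sequences\<close>

lemma func_empty: "func empty empty A"
  by (simp add: func_def)

lemma mem_fseq: "s \<epsilon> finite_seqs A \<longleftrightarrow> (\<exists>n. n \<epsilon> omega \<and> func s n A)"
  by (rule mem_finite_seqs)

lemma fseqD: "s \<epsilon> finite_seqs A \<Longrightarrow> dm s \<epsilon> omega" "s \<epsilon> finite_seqs A \<Longrightarrow> func s (dm s) A"
  unfolding mem_fseq using dm_func by auto

lemma fseqI: "func s n A \<Longrightarrow> n \<epsilon> omega \<Longrightarrow> s \<epsilon> finite_seqs A"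
  unfolding mem_fseq by blast

lemma empty_fseq [simp]: "empty \<epsilon> finite_seqs A"
  using fseqI [OF func_empty] by simp

lemma dm_empty [simp]: "dm empty = empty" by (rule dm_func [OF func_empty])

lemma mem_snoc: "p \<epsilon> snoc s m \<longleftrightarrow> p \<epsilon> s \<or> p = opair (dm s) m"
  unfolding snoc_def
  by (rule mem_Set) (use ex_union2 [of s "upair (opair (dm s) m) (opair (dm s) m)"] in simp)

lemma
  assumes "func s n A" "n \<epsilon> omega" "m \<epsilon> A"
  shows func_snoc: "func (snoc s m) (succ n) A"
    and ap_snoc: "k \<epsilon> n \<Longrightarrow> snoc s m \<cdot> k = s \<cdot> k"
    and ap_snoc_last: "snoc s m \<cdot> n = m"
proof -
  have 1: "k \<epsilon> succ n \<and> p = opair k (if k = n then m else s \<cdot> k) \<longleftrightarrow>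
    k \<epsilon> n \<and> p = opair k (s \<cdot> k) \<or> k = n \<and> p = opair n m" for k p
    by auto
  have *: "p \<epsilon> snoc s m \<longleftrightarrow> (\<exists>k. k \<epsilon> succ n \<and> p = opair k (if k = n then m else s \<cdot> k))" for p
    unfolding mem_snoc func_mem_iff [OF assms(1)] dm_func [OF assms(1)] 1 by blast
  show "func (snoc s m) (succ n) A" by (rule funcI [OF *]) (use ap_mem [OF assms(1)] assms in auto)
  show "k \<epsilon> n \<Longrightarrow> snoc s m \<cdot> k = s \<cdot> k" using ap_eqI [OF *, of k] not_mem_self [of n] by (auto split: if_splits)
  show "snoc s m \<cdot> n = m" using ap_eqI [OF *, of n] by auto
qed

lemma dm_snoc: "s \<epsilon> finite_seqs A \<Longrightarrow> m \<epsilon> A \<Longrightarrow> dm (snoc s m) = succ (dm s)"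
  using func_snoc fseqD dm_func by metis

lemma snoc_fseq: "s \<epsilon> finite_seqs A \<Longrightarrow> m \<epsilon> A \<Longrightarrow> snoc s m \<epsilon> finite_seqs A"
  using func_snoc fseqD fseqI om_succ by metis

lemma subset_snoc [simp]: "subset s (snoc s m)"
  by (simp add: subset_def mem_snoc)

lemma snoc_restrict:
  assumes "func t A B" "succ n \<epsilon> omega" "\<And>k. k \<epsilon> succ n \<Longrightarrow> k \<epsilon> A"
  shows "restrict t (succ n) = snoc (restrict t n) (t \<cdot> n)"
proof -
  have n: "n \<epsilon> omega" using omega_trans [OF assms(2)] by simp
  have 1: "func (restrict t n) n B" and r1: "k \<epsilon> n \<Longrightarrow> restrict t n \<cdot> k = t \<cdot> k" for k
    using restrict_ap [OF assms(1), of n] assms(3) by auto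
  have 2: "func (restrict t (succ n)) (succ n) B"
    and r2: "k \<epsilon> succ n \<Longrightarrow> restrict t (succ n) \<cdot> k = t \<cdot> k" for k
    using restrict_ap [OF assms(1), of "succ n"] assms(3) by auto
  have m: "t \<cdot> n \<epsilon> B" using ap_mem [OF assms(1)] assms(3) by simp
  note s = func_snoc [OF 1 n m] ap_snoc [OF 1 n m] ap_snoc_last [OF 1 n m]
  show ?thesis by (rule func_eqI [OF 2 s(1)]) (use r2 r1 s in auto)
qed

lemma fseq_cases:
  assumes "s \<epsilon> finite_seqs A"
  obtains "s = empty" | t m where "t \<epsilon> finite_seqs A" "m \<epsilon> A" "s = snoc t m" "dm s = succ (dm t)"
proof -
  from om_cases [OF fseqD(1) [OF assms]] consider "dm s = empty" | n where "n \<epsilon> omega" "dm s = succ n" by blast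
  then show thesis
  proof cases
    case 1
    then have "s = empty" using func_eqI [OF fseqD(2) [OF assms], of empty A] func_empty by auto
    then show thesis by (rule that(1))
  next
    case 2
    have f: "func s (succ n) A" using fseqD(2) [OF assms] 2 by simp
    have 3: "restrict s (succ n) = s"
      by (rule func_eqI [OF restrict_ap(1) [OF f] f]) (simp_all only: restrict_ap(2) [OF f])
    have 4: "func (restrict s n) n A" by (rule restrict_ap [OF f]) auto
    show thesis
    proof (rule that(2))
      show "restrict s n \<epsilon> finite_seqs A" using 4 2 fseqI by blast
      show "s \<cdot> n \<epsilon> A" using ap_mem [OF f] by simp
      show "s = snoc (restrict s n) (s \<cdot> n)" using snoc_restrict [OF f, of n] 2 3 by simp
      show "dm s = succ (dm (restrict s n))" using dm_func [OF 4] 2 by simp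
    qed
  qed
qed

section \<open>Recursion inside the structure\<close>

text \<open>Approximations on initial segments exist and agree wherever both are defined, both by
  internal induction; the function \<open>g\<close> glues them together.\<close>

theorem prim_rec:
  assumes st: "pterm (\<lambda>\<rho>. st (\<rho> 0) (\<rho> 1))" and a: "a \<epsilon> B"
    and B: "\<And>n y. n \<epsilon> omega \<Longrightarrow> y \<epsilon> B \<Longrightarrow> st n y \<epsilon> B"
  shows "\<exists>g. func g omega B \<and> g \<cdot> empty = a \<and> (\<forall>n. n \<epsilon> omega \<longrightarrow> g \<cdot> succ n = st n (g \<cdot> n))"
proof -
  have st2 [pdef_intros]: "pterm t \<Longrightarrow> pterm u \<Longrightarrow> pterm (\<lambda>\<rho>. st (t \<rho>) (u \<rho>))" for t u
  proof (rule pterm_subst2 [where f = st])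
    show "pdef (\<lambda>\<rho>. \<rho> 0 = st (\<rho> 1) (\<rho> 2))"
      using st unfolding pterm_def by (simp add: numeral_2_eq_2)
  qed
  define good where "good n s \<longleftrightarrow> func s (succ n) B \<and> s \<cdot> empty = a \<and> (\<forall>k. k \<epsilon> n \<longrightarrow> s \<cdot> succ k = st k (s \<cdot> k))" for n s
  have good_def' [pdef_intros]: "pterm t \<Longrightarrow> pterm u \<Longrightarrow> pdef (\<lambda>\<rho>. good (t \<rho>) (u \<rho>))" for t u
    by (rule pdef_subst2 [where P = good]) (unfold good_def, intro pdef_intros)
  have uniq: "s \<cdot> k = t \<cdot> k" if "k \<epsilon> omega" "n \<epsilon> omega" "m \<epsilon> omega" "good n s" "good m t" "k \<epsilon> succ n" "k \<epsilon> succ m" for k n m s t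
  proof -
    have "k \<epsilon> succ n \<and> k \<epsilon> succ m \<longrightarrow> s \<cdot> k = t \<cdot> k" using that(1)
    proof (induction k rule: om_induct)
      case def show ?case by (intro pdef_intros)
    next
      case 0 then show ?case using that by (simp add: good_def)
    next
      case (succ k)
      show ?case
      proof
        assume "succ k \<epsilon> succ n \<and> succ k \<epsilon> succ m"
        then have "k \<epsilon> n" "k \<epsilon> m" using om_succ_mono_iff that(2,3) succ.hyps by blast+
        then show "s \<cdot> succ k = t \<cdot> succ k" using that(4,5) succ.IH by (simp add: good_def)
      qed
    qed
    then show ?thesis using that by blast
  qed
  have ex: "\<exists>s. good n s" if "n \<epsilon> omega" for n
    using that
  proof (induction n rule: om_induct)
    case def show ?case by (intro pdef_intros)
  next
    case 0
    have p: "pterm (\<lambda>\<rho>. a)" by (intro pdef_intros)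
    have "good empty (Lam (succ empty) (\<lambda>_. a))"
      unfolding good_def using func_Lam [OF p, of "succ empty" B] ap_Lam [OF p, of empty "succ empty"] a by simp
    then show ?case ..
  next
    case (succ n)
    then obtain s where s: "good n s" by blast
    have f: "func s (succ n) B" using s by (simp add: good_def)
    have m: "st n (s \<cdot> n) \<epsilon> B" using B [OF succ.hyps] ap_mem [OF f] by simp
    note sn = func_snoc [OF f om_succ [OF succ.hyps] m] ap_snoc [OF f om_succ [OF succ.hyps] m]
      ap_snoc_last [OF f om_succ [OF succ.hyps] m]
    have "good (succ n) (snoc s (st n (s \<cdot> n)))"
      unfolding good_def
    proof (intro conjI allI impI)
      show "func (snoc s (st n (s \<cdot> n))) (succ (succ n)) B" by (rule sn(1))
      show "snoc s (st n (s \<cdot> n)) \<cdot> empty = a" using s sn(2) [OF zero_mem_succ [OF succ.hyps]] by (simp add: good_def)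
      fix k assume "k \<epsilon> succ n"
      then show "snoc s (st n (s \<cdot> n)) \<cdot> succ k = st k (snoc s (st n (s \<cdot> n)) \<cdot> k)"
        using s sn(2,3) om_succ_mono [OF succ.hyps, of k] by (auto simp: good_def)
    qed
    then show ?case ..
  qed
  \<comment> \<open>Any approximation that is long enough determines the value, so
    \<open>iota\<close> finds it without selecting an approximation.\<close>
  define g where "g = Lam omega (\<lambda>n. iota (\<lambda>y. \<exists>m s. m \<epsilon> omega \<and> good m s \<and> n \<epsilon> succ m \<and> y = s \<cdot> n))"
  have gt: "pterm (\<lambda>\<rho>. iota (\<lambda>y. \<exists>m s. m \<epsilon> omega \<and> good m s \<and> \<rho> 0 \<epsilon> succ m \<and> y = s \<cdot> \<rho> 0))"
    by (intro pdef_intros)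
  have geq: "iota (\<lambda>y. \<exists>m s. m \<epsilon> omega \<and> good m s \<and> n \<epsilon> succ m \<and> y = s \<cdot> n) = s \<cdot> n"
    if "m \<epsilon> omega" "good m s" "n \<epsilon> succ m" for n m s
  proof (rule iota_eq)
    show "\<exists>m s'. m \<epsilon> omega \<and> good m s' \<and> n \<epsilon> succ m \<and> s \<cdot> n = s' \<cdot> n" using that by blast
    fix y assume "\<exists>m s. m \<epsilon> omega \<and> good m s \<and> n \<epsilon> succ m \<and> y = s \<cdot> n"
    then show "y = s \<cdot> n" using that uniq omega_trans [OF om_succ, of m n] by blast
  qed
  have gv: "g \<cdot> n = s \<cdot> n" if "m \<epsilon> omega" "good m s" "n \<epsilon> succ m" for n m s
    unfolding g_def using ap_Lam [OF gt, of n omega] geq [OF that] omega_trans [OF om_succ [OF that(1)] that(3)] by simp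
  show ?thesis
  proof (intro exI conjI allI impI)
    show "func g omega B" unfolding g_def
    proof (rule func_Lam [OF gt])
      fix n assume n: "n \<epsilon> omega"
      then obtain s where "good n s" using ex by blast
      then show "iota (\<lambda>y. \<exists>m s. m \<epsilon> omega \<and> good m s \<and> n \<epsilon> succ m \<and> y = s \<cdot> n) \<epsilon> B"
        using geq [OF n] ap_mem [of s "succ n" B n] by (simp add: good_def)
    qed
    obtain s where "good empty s" using ex [OF om_0] by blast
    then show "g \<cdot> empty = a" using gv [OF om_0] by (simp add: good_def)
    fix n assume n: "n \<epsilon> omega"
    then obtain s where "good (succ n) s" using ex by force
    then show "g \<cdot> succ n = st n (g \<cdot> n)" using gv [of "succ n" s] n by (simp add: good_def)
  qed
qed

text \<open>Primitive recursion is applied to the initial segments: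
  \<open>\<sigma> \<cdot> n\<close> is the sequence of the values below \<open>n\<close>, which
  \<open>h\<close> turns into the value at \<open>n\<close>.\<close>

theorem cov_rec:
  assumes h: "pterm (\<lambda>\<rho>. h (\<rho> 0))" and B: "\<And>s. s \<epsilon> finite_seqs B \<Longrightarrow> h s \<epsilon> B"
  shows "\<exists>g. func g omega B \<and> (\<forall>n. n \<epsilon> omega \<longrightarrow> g \<cdot> n = h (restrict g n))"
proof -
  have h1 [pdef_intros]: "pterm t \<Longrightarrow> pterm (\<lambda>\<rho>. h (t \<rho>))" for t
    by (rule pterm_subst1 [where f = h]) (use h [unfolded pterm_def] in simp)
  have "\<exists>g. func g omega (finite_seqs B) \<and> g \<cdot> empty = empty \<and>
    (\<forall>n. n \<epsilon> omega \<longrightarrow> g \<cdot> succ n = snoc (g \<cdot> n) (h (g \<cdot> n)))"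
  proof (rule prim_rec [where st = "\<lambda>n s. snoc s (h s)"])
    show "pterm (\<lambda>\<rho>. snoc (\<rho> 1) (h (\<rho> 1)))" by (intro pdef_intros)
    show "snoc s (h s) \<epsilon> finite_seqs B" if "s \<epsilon> finite_seqs B" for s
      using snoc_fseq [OF that B [OF that]] .
  qed simp
  then obtain \<sigma> where \<sigma>: "func \<sigma> omega (finite_seqs B)" "\<sigma> \<cdot> empty = empty"
    "\<And>n. n \<epsilon> omega \<Longrightarrow> \<sigma> \<cdot> succ n = snoc (\<sigma> \<cdot> n) (h (\<sigma> \<cdot> n))" by blast
  define g where "g = Lam omega (\<lambda>n. h (\<sigma> \<cdot> n))"
  have gt: "pterm (\<lambda>\<rho>. h (\<sigma> \<cdot> \<rho> 0))" by (intro pdef_intros)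
  have gf: "func g omega B" unfolding g_def by (rule func_Lam [OF gt]) (use B ap_mem [OF \<sigma>(1)] in blast)
  have gn: "g \<cdot> n = h (\<sigma> \<cdot> n)" if "n \<epsilon> omega" for n unfolding g_def by (rule ap_Lam [OF gt that])
  have r: "restrict g n = \<sigma> \<cdot> n" if "n \<epsilon> omega" for n
    using that
  proof (induction n rule: om_induct)
    case def show ?case by (intro pdef_intros)
  next
    case 0
    have "func (restrict g empty) empty B" by (rule restrict_ap(1) [OF gf]) simp
    then have "restrict g empty = empty" by (rule func_eqI [OF _ func_empty]) simp
    then show ?case using \<sigma>(2) by simp
  next
    case (succ n)
    have "restrict g (succ n) = snoc (restrict g n) (g \<cdot> n)"
      by (rule snoc_restrict [OF gf om_succ [OF succ.hyps]]) (rule omega_trans [OF om_succ [OF succ.hyps]])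
    then show ?case by (simp only: succ.IH \<sigma>(3) [OF succ.hyps] gn [OF succ.hyps])
  qed
  show ?thesis by (intro exI [of _ g] conjI allI impI gf) (simp only: r gn)
qed

section \<open>Countability and dependent choice\<close>

lemma fs_induct [consumes 1, case_names def empty snoc]:
  assumes "s \<epsilon> finite_seqs A" and P: "pdef (\<lambda>\<rho>. P (\<rho> 0))" and "P empty"
    and "\<And>s m. s \<epsilon> finite_seqs A \<Longrightarrow> m \<epsilon> A \<Longrightarrow> P s \<Longrightarrow> P (snoc s m)"
  shows "P s"
proof -
  have P1 [pdef_intros]: "pterm t \<Longrightarrow> pdef (\<lambda>\<rho>. P (t \<rho>))" for t
    by (rule pdef_subst1 [where P = P, OF P])
  have "n \<epsilon> omega \<Longrightarrow> \<forall>s. s \<epsilon> finite_seqs A \<and> dm s = n \<longrightarrow> P s" for n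
  proof (induction n rule: om_induct)
    case def show ?case by (intro pdef_intros)
  next
    case 0
    show ?case
    proof (intro allI impI)
      fix s assume s: "s \<epsilon> finite_seqs A \<and> dm s = empty"
      from conjunct1 [OF s] show "P s"
        by (cases rule: fseq_cases) (use s assms(3) in simp_all)
    qed
  next
    case (succ n)
    show ?case
    proof (intro allI impI)
      fix s assume s: "s \<epsilon> finite_seqs A \<and> dm s = succ n"
      from conjunct1 [OF s] show "P s"
      proof (cases rule: fseq_cases)
        case 1 then show ?thesis using assms(3) by simp
      next
        case (2 t m) then show ?thesis using assms(4) succ.IH s by auto
      qed
    qed
  qed
  then show ?thesis using assms(1) fseqD(1) by blast
qed

theorem fs_rec:
  assumes st: "pterm (\<lambda>\<rho>. st (\<rho> 0) (\<rho> 1))" and b: "b \<epsilon> B"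
    and B: "\<And>y m. y \<epsilon> B \<Longrightarrow> m \<epsilon> A \<Longrightarrow> st y m \<epsilon> B"
  shows "\<exists>H. func H (finite_seqs A) B \<and> H \<cdot> empty = b \<and>
    (\<forall>s m. s \<epsilon> finite_seqs A \<longrightarrow> m \<epsilon> A \<longrightarrow> H \<cdot> snoc s m = st (H \<cdot> s) m)"
proof -
  have st2 [pdef_intros]: "pterm t \<Longrightarrow> pterm u \<Longrightarrow> pterm (\<lambda>\<rho>. st (t \<rho>) (u \<rho>))" for t u
  proof (rule pterm_subst2 [where f = st])
    show "pdef (\<lambda>\<rho>. \<rho> 0 = st (\<rho> 1) (\<rho> 2))"
      using st unfolding pterm_def by (simp add: numeral_2_eq_2)
  qed
  \<comment> \<open>An approximation for \<open>s\<close> is defined on all of \<open>omega\<close>,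
    but only its steps below the length of \<open>s\<close> are prescribed; hence it is evaluated at
    \<open>dm s\<close> and nowhere beyond.\<close>
  define good where "good s g \<longleftrightarrow> func g omega B \<and> g \<cdot> empty = b \<and>
    (\<forall>k. k \<epsilon> dm s \<longrightarrow> g \<cdot> succ k = st (g \<cdot> k) (s \<cdot> k))" for s g
  have good_pdef [pdef_intros]: "pterm t \<Longrightarrow> pterm u \<Longrightarrow> pdef (\<lambda>\<rho>. good (t \<rho>) (u \<rho>))" for t u
    by (rule pdef_subst2 [where P = good]) (unfold good_def, intro pdef_intros)
  have uniq: "g \<cdot> dm s = g' \<cdot> dm s" if s: "s \<epsilon> finite_seqs A" and g: "good s g" "good s g'" for s g g'
  proof -
    have om: "dm s \<epsilon> omega" by (rule fseqD [OF s])
    have "k \<epsilon> omega \<Longrightarrow> k \<epsilon> succ (dm s) \<longrightarrow> g \<cdot> k = g' \<cdot> k" for k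
    proof (induction k rule: om_induct)
      case def show ?case by (intro pdef_intros)
    next
      case 0 then show ?case using g by (simp add: good_def)
    next
      case (succ k)
      show ?case
      proof
        assume "succ k \<epsilon> succ (dm s)"
        then have "k \<epsilon> dm s" using om_succ_mono_iff om succ.hyps by blast
        then show "g \<cdot> succ k = g' \<cdot> succ k" using g succ.IH by (simp add: good_def)
      qed
    qed
    then show ?thesis using om by simp
  qed
  have ex: "\<exists>g. good s g" if s: "s \<epsilon> finite_seqs A" for s
  proof -
    \<comment> \<open>Past the end of \<open>s\<close> the value is kept constant, which makes the
      recursion total.\<close>
    have "\<exists>g. func g omega B \<and> g \<cdot> empty = b \<and>
      (\<forall>n. n \<epsilon> omega \<longrightarrow> g \<cdot> succ n = (if n \<epsilon> dm s then st (g \<cdot> n) (s \<cdot> n) else g \<cdot> n))"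
    proof (rule prim_rec [where st = "\<lambda>n y. if n \<epsilon> dm s then st y (s \<cdot> n) else y"])
      show "pterm (\<lambda>\<rho>. if \<rho> 0 \<epsilon> dm s then st (\<rho> 1) (s \<cdot> \<rho> 0) else \<rho> 1)" by (intro pdef_intros)
      show "(if n \<epsilon> dm s then st y (s \<cdot> n) else y) \<epsilon> B" if "n \<epsilon> omega" "y \<epsilon> B" for n y
        using B [OF that(2) ap_mem [OF fseqD(2) [OF s]]] that by simp
    qed (rule b)
    then obtain g where g: "func g omega B" "g \<cdot> empty = b"
      "\<And>n. n \<epsilon> omega \<Longrightarrow> g \<cdot> succ n = (if n \<epsilon> dm s then st (g \<cdot> n) (s \<cdot> n) else g \<cdot> n)" by blast
    have "g \<cdot> succ k = st (g \<cdot> k) (s \<cdot> k)" if "k \<epsilon> dm s" for k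
      using g(3) [OF omega_trans [OF fseqD(1) [OF s] that]] that by simp
    then show ?thesis using g unfolding good_def by blast
  qed
  define H where "H = Lam (finite_seqs A) (\<lambda>s. iota (\<lambda>y. \<exists>g. good s g \<and> y = g \<cdot> dm s))"
  have Ht: "pterm (\<lambda>\<rho>. iota (\<lambda>y. \<exists>g. good (\<rho> 0) g \<and> y = g \<cdot> dm (\<rho> 0)))" by (intro pdef_intros)
  have Hi: "iota (\<lambda>y. \<exists>g. good s g \<and> y = g \<cdot> dm s) = g \<cdot> dm s" if "s \<epsilon> finite_seqs A" "good s g" for s g
    by (rule iota_eq) (use that uniq in blast)+
  have He: "H \<cdot> s = g \<cdot> dm s" if "s \<epsilon> finite_seqs A" "good s g" for s g
    unfolding H_def ap_Lam [OF Ht that(1)] by (rule Hi [OF that])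
  show ?thesis
  proof (intro exI [of _ H] conjI allI impI)
    show "func H (finite_seqs A) B" unfolding H_def
    proof (rule func_Lam [OF Ht])
      fix s assume s: "s \<epsilon> finite_seqs A"
      then obtain g where g: "good s g" using ex by blast
      then show "iota (\<lambda>y. \<exists>g. good s g \<and> y = g \<cdot> dm s) \<epsilon> B"
        unfolding Hi [OF s g] using ap_mem [OF _ fseqD(1) [OF s]] by (simp add: good_def)
    qed
    obtain g where g: "good empty g" using ex [OF empty_fseq] by blast
    show "H \<cdot> empty = b" using He [OF empty_fseq g] g by (simp add: good_def)
    fix s m assume s: "s \<epsilon> finite_seqs A" and m: "m \<epsilon> A"
    obtain g where g: "good (snoc s m) g" using ex [OF snoc_fseq [OF s m]] by blast
    note sn = ap_snoc [OF fseqD(2) [OF s] fseqD(1) [OF s] m] ap_snoc_last [OF fseqD(2) [OF s] fseqD(1) [OF s] m]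
    have sg: "good s g" using g sn(1) dm_snoc [OF s m] by (simp add: good_def)
    have "g \<cdot> succ (dm s) = st (g \<cdot> dm s) m" using g sn(2) dm_snoc [OF s m] by (simp add: good_def)
    then show "H \<cdot> snoc s m = st (H \<cdot> s) m"
      unfolding He [OF s sg] He [OF snoc_fseq [OF s m] g] dm_snoc [OF s m] .
  qed
qed

section \<open>Doubling, parity and pairing\<close>

text \<open>\<open>SOME\<close> picks, outside the structure, one element whose existence is proved
  inside. As a fixed element it is a legitimate parameter of formulas, so no choice principle of the
  structure is involved; the same holds for the constants below that are introduced in this
  way.\<close>

definition dbl :: 'a where
  "dbl = (SOME d. func d omega omega \<and> d \<cdot> empty = empty \<and>
     (\<forall>n. n \<epsilon> omega \<longrightarrow> d \<cdot> succ n = succ (succ (d \<cdot> n))))"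

lemma dbl_rec: "func dbl omega omega \<and> dbl \<cdot> empty = empty \<and>
     (\<forall>n. n \<epsilon> omega \<longrightarrow> dbl \<cdot> succ n = succ (succ (dbl \<cdot> n)))"
  unfolding dbl_def
  by (rule someI_ex, rule prim_rec [where st = "\<lambda>n y. succ (succ y)"]) (intro pdef_intros, auto)

lemma dbl_func: "func dbl omega omega" using dbl_rec by blast
lemma dbl_mem [simp]: "n \<epsilon> omega \<Longrightarrow> dbl \<cdot> n \<epsilon> omega" by (rule ap_mem [OF dbl_func])
lemma dbl_0 [simp]: "dbl \<cdot> empty = empty" using dbl_rec by blast
lemma dbl_succ [simp]: "n \<epsilon> omega \<Longrightarrow> dbl \<cdot> succ n = succ (succ (dbl \<cdot> n))" using dbl_rec by blast

lemma om_succE: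
  assumes "n \<epsilon> omega" obtains "n = empty" | m where "m \<epsilon> omega" "n = succ m"
  using om_cases [OF assms] by blast

lemma dbl_inj:
  assumes "m \<epsilon> omega" "n \<epsilon> omega" shows "dbl \<cdot> m = dbl \<cdot> n \<longleftrightarrow> m = n"
proof -
  from assms(1) have "\<forall>n. n \<epsilon> omega \<longrightarrow> dbl \<cdot> m = dbl \<cdot> n \<longrightarrow> m = n"
  proof (induction m rule: om_induct)
    case def show ?case by (intro pdef_intros)
  next
    case 0
    show ?case
    proof (intro allI impI)
      fix n assume n: "n \<epsilon> omega" "dbl \<cdot> empty = dbl \<cdot> n"
      from n(1) show "empty = n" by (cases rule: om_succE) (use n(2) in simp_all)
    qed
  next
    case (succ m)
    show ?case
    proof (intro allI impI)
      fix n assume n: "n \<epsilon> omega" "dbl \<cdot> succ m = dbl \<cdot> n"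
      from n(1) show "succ m = n" by (cases rule: om_succE) (use n(2) succ in simp_all)
    qed
  qed
  then show ?thesis using assms(2) by blast
qed

lemma dbl_neq_succ_dbl:
  assumes "m \<epsilon> omega" "n \<epsilon> omega" shows "dbl \<cdot> m \<noteq> succ (dbl \<cdot> n)"
proof -
  from assms(1) have "\<forall>n. n \<epsilon> omega \<longrightarrow> dbl \<cdot> m \<noteq> succ (dbl \<cdot> n)"
  proof (induction m rule: om_induct)
    case def show ?case by (intro pdef_intros)
  next
    case 0 show ?case by simp
  next
    case (succ m)
    show ?case
    proof (intro allI impI notI)
      fix n assume n: "n \<epsilon> omega" "dbl \<cdot> succ m = succ (dbl \<cdot> n)"
      then have *: "succ (dbl \<cdot> m) = dbl \<cdot> n" using succ.hyps by simp
      from n(1) show False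
      proof (cases rule: om_succE)
        case 1 then show ?thesis using * by simp
      next
        case (2 k) then show ?thesis using * succ.IH by simp
      qed
    qed
  qed
  then show ?thesis using assms(2) by blast
qed

lemma dbl_cases: "n \<epsilon> omega \<Longrightarrow> \<exists>k. k \<epsilon> omega \<and> (n = dbl \<cdot> k \<or> n = succ (dbl \<cdot> k))"
proof (induction n rule: om_induct)
  case def show ?case by (intro pdef_intros)
next
  case 0 show ?case by (rule exI [of _ empty]) simp
next
  case (succ n)
  then obtain k where "k \<epsilon> omega" "n = dbl \<cdot> k \<or> n = succ (dbl \<cdot> k)" by blast
  then show ?case using dbl_succ [of k] om_succ [of k] by metis
qed

text \<open>By internal induction every alternating set that contains 0 contains all doubles, hence
  no successor of a double; conversely the set of all doubles is alternating.\<close>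

lemma even_nat_iff: "even_nat n \<longleftrightarrow> (\<exists>k. k \<epsilon> omega \<and> n = dbl \<cdot> k)"
proof
  assume "even_nat n"
  then obtain e where n: "n \<epsilon> omega" "n \<epsilon> e" and e: "empty \<epsilon> e"
    "\<And>k. k \<epsilon> omega \<Longrightarrow> succ k \<epsilon> e \<longleftrightarrow> \<not> k \<epsilon> e" unfolding even_nat_def by blast
  have *: "k \<epsilon> omega \<Longrightarrow> dbl \<cdot> k \<epsilon> e" for k
  proof (induction k rule: om_induct)
    case def show ?case by (intro pdef_intros)
  qed (simp_all add: e)
  obtain k where k: "k \<epsilon> omega" "n = dbl \<cdot> k \<or> n = succ (dbl \<cdot> k)" using dbl_cases [OF n(1)] by blast
  moreover have "n \<noteq> succ (dbl \<cdot> k)" using e(2) [OF dbl_mem [OF k(1)]] * [OF k(1)] n(2) by auto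
  ultimately show "\<exists>k. k \<epsilon> omega \<and> n = dbl \<cdot> k" by blast
next
  assume "\<exists>k. k \<epsilon> omega \<and> n = dbl \<cdot> k"
  then obtain k where k: "k \<epsilon> omega" "n = dbl \<cdot> k" by blast
  have "pdef (\<lambda>\<rho>. \<exists>k. k \<epsilon> omega \<and> \<rho> 0 = dbl \<cdot> k)" by (intro pdef_intros)
  then obtain e where e: "\<And>n. n \<epsilon> e \<longleftrightarrow> n \<epsilon> omega \<and> (\<exists>k. k \<epsilon> omega \<and> n = dbl \<cdot> k)"
    using sep_ex [of "\<lambda>n. \<exists>k. k \<epsilon> omega \<and> n = dbl \<cdot> k" omega] by blast
  have 1: "succ m \<epsilon> e \<longleftrightarrow> \<not> m \<epsilon> e" if m: "m \<epsilon> omega" for m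
  proof -
    obtain j where j: "j \<epsilon> omega" "m = dbl \<cdot> j \<or> m = succ (dbl \<cdot> j)" using dbl_cases [OF m] by blast
    from j(2) show ?thesis
    proof
      assume "m = dbl \<cdot> j"
      then show ?thesis unfolding e using m j(1) dbl_neq_succ_dbl [OF _ j(1)] by metis
    next
      assume a: "m = succ (dbl \<cdot> j)"
      have b: "succ m = dbl \<cdot> succ j" using a j(1) by simp
      have "\<not> m \<epsilon> e" unfolding e a using dbl_neq_succ_dbl [OF _ j(1)] by metis
      moreover have "succ m \<epsilon> e" unfolding e using b om_succ [OF m] om_succ [OF j(1)] by blast
      ultimately show ?thesis by simp
    qed
  qed
  have 2: "empty \<epsilon> e" unfolding e using dbl_0 om_0 by metis
  have 3: "n \<epsilon> omega" "n \<epsilon> e" unfolding e using k by auto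
  show "even_nat n" unfolding even_nat_def using 1 2 3 by blast
qed

lemma pdef_even_nat [pdef_intros]: "pterm t \<Longrightarrow> pdef (\<lambda>\<rho>. even_nat (t \<rho>))"
  unfolding even_nat_iff by (rule pdef_subst1) (intro pdef_intros)

lemma even_nat_dbl [simp]: "k \<epsilon> omega \<Longrightarrow> even_nat (dbl \<cdot> k)" using even_nat_iff by blast

lemma even_nat_succ_dbl [simp]: "k \<epsilon> omega \<Longrightarrow> \<not> even_nat (succ (dbl \<cdot> k))"
  using even_nat_iff dbl_neq_succ_dbl by metis

lemma even_nat_0 [simp]: "even_nat empty" using even_nat_iff dbl_0 om_0 by metis

lemma even_nat_succ: "n \<epsilon> omega \<Longrightarrow> even_nat (succ n) \<longleftrightarrow> \<not> even_nat n"
  using dbl_cases [of n] even_nat_dbl even_nat_succ_dbl dbl_succ om_succ by metis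

text \<open>The pair of \<open>c\<close> and \<open>m\<close> is coded by \<open>2\<^sup>m (2 c + 1)\<close>.\<close>

definition pairing_seq :: 'a where
  "pairing_seq = (SOME G. func G omega (fun_space omega omega) \<and>
     G \<cdot> empty = Lam omega (\<lambda>c. succ (dbl \<cdot> c)) \<and>
     (\<forall>m. m \<epsilon> omega \<longrightarrow> G \<cdot> succ m = Lam omega (\<lambda>c. dbl \<cdot> (G \<cdot> m \<cdot> c))))"

definition cpair :: "'a \<Rightarrow> 'a \<Rightarrow> 'a" where
  "cpair c m = pairing_seq \<cdot> m \<cdot> c"

lemma pterm_cpair [pdef_intros]: "pterm t \<Longrightarrow> pterm u \<Longrightarrow> pterm (\<lambda>\<rho>. cpair (t \<rho>) (u \<rho>))"
  unfolding cpair_def by (intro pdef_intros)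

lemma pairing_seq_rec: "func pairing_seq omega (fun_space omega omega) \<and>
     pairing_seq \<cdot> empty = Lam omega (\<lambda>c. succ (dbl \<cdot> c)) \<and>
     (\<forall>m. m \<epsilon> omega \<longrightarrow> pairing_seq \<cdot> succ m = Lam omega (\<lambda>c. dbl \<cdot> (pairing_seq \<cdot> m \<cdot> c)))"
  unfolding pairing_seq_def
proof (rule someI_ex, rule prim_rec [where st = "\<lambda>n y. Lam omega (\<lambda>c. dbl \<cdot> (y \<cdot> c))"])
  show "pterm (\<lambda>\<rho>. Lam omega (\<lambda>c. dbl \<cdot> (\<rho> 1 \<cdot> c)))" by (intro pdef_intros)
  have 1: "pterm (\<lambda>\<rho>. succ (dbl \<cdot> \<rho> 0))" by (intro pdef_intros)
  show "Lam omega (\<lambda>c. succ (dbl \<cdot> c)) \<epsilon> fun_space omega omega"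
    unfolding mem_fun_space by (rule func_Lam [OF 1]) simp
  fix n y assume "y \<epsilon> fun_space omega omega"
  then have y: "func y omega omega" by (simp add: mem_fun_space)
  have 2: "pterm (\<lambda>\<rho>. dbl \<cdot> (y \<cdot> \<rho> 0))" by (intro pdef_intros)
  show "Lam omega (\<lambda>c. dbl \<cdot> (y \<cdot> c)) \<epsilon> fun_space omega omega"
    unfolding mem_fun_space by (rule func_Lam [OF 2]) (use ap_mem [OF y] in simp)
qed

lemma cpair_mem: "c \<epsilon> omega \<Longrightarrow> m \<epsilon> omega \<Longrightarrow> cpair c m \<epsilon> omega"
  unfolding cpair_def using pairing_seq_rec mem_fun_space ap_mem by metis

lemma cpair_0: "c \<epsilon> omega \<Longrightarrow> cpair c empty = succ (dbl \<cdot> c)"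
  unfolding cpair_def using pairing_seq_rec ap_Lam [of "\<lambda>c. succ (dbl \<cdot> c)" c omega]
  by (simp add: pdef_intros)

lemma cpair_succ: "c \<epsilon> omega \<Longrightarrow> m \<epsilon> omega \<Longrightarrow> cpair c (succ m) = dbl \<cdot> cpair c m"
  unfolding cpair_def using pairing_seq_rec ap_Lam [of "\<lambda>c. dbl \<cdot> (pairing_seq \<cdot> m \<cdot> c)" c omega]
  by (simp add: pdef_intros)

text \<open>Induction on the exponent: a code is odd iff its exponent is 0, and two even codes can
  be halved by injectivity of doubling.\<close>

lemma cpair_inj:
  assumes "c \<epsilon> omega" "m \<epsilon> omega" "c' \<epsilon> omega" "m' \<epsilon> omega" "cpair c m = cpair c' m'"
  shows "c = c' \<and> m = m'"
proof -
  have "m \<epsilon> omega \<Longrightarrow> \<forall>m'. m' \<epsilon> omega \<longrightarrow> cpair c m = cpair c' m' \<longrightarrow> c = c' \<and> m = m'" for m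
  proof (induction m rule: om_induct)
    case def show ?case by (intro pdef_intros)
  next
    case 0
    show ?case
    proof (intro allI impI)
      fix m' assume m': "m' \<epsilon> omega" "cpair c empty = cpair c' m'"
      from om_cases [OF m'(1)] show "c = c' \<and> empty = m'"
      proof
        assume "m' = empty" then show ?thesis using m' cpair_0 assms dbl_inj by simp
      next
        assume "\<exists>k. k \<epsilon> omega \<and> m' = succ k"
        then obtain k where k: "k \<epsilon> omega" "m' = succ k" by blast
        then show ?thesis using m'(2) cpair_0 [OF assms(1)] cpair_succ [OF assms(3) k(1)]
          dbl_neq_succ_dbl [OF cpair_mem [OF assms(3) k(1)] assms(1)] by simp
      qed
    qed
  next
    case (succ m)
    show ?case
    proof (intro allI impI)
      fix m' assume m': "m' \<epsilon> omega" "cpair c (succ m) = cpair c' m'"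
      from om_cases [OF m'(1)] show "c = c' \<and> succ m = m'"
      proof
        assume "m' = empty"
        then show ?thesis using m'(2) cpair_0 [OF assms(3)] cpair_succ [OF assms(1) succ.hyps]
          dbl_neq_succ_dbl [OF cpair_mem [OF assms(1) succ.hyps] assms(3)] by simp
      next
        assume "\<exists>k. k \<epsilon> omega \<and> m' = succ k"
        then obtain k where k: "k \<epsilon> omega" "m' = succ k" by blast
        then have "cpair c m = cpair c' k" using m'(2) cpair_succ [OF assms(1) succ.hyps] cpair_succ [OF assms(3) k(1)]
          dbl_inj [OF cpair_mem [OF assms(1) succ.hyps] cpair_mem [OF assms(3) k(1)]] by simp
        then show ?thesis using succ.IH k by blast
      qed
    qed
  qed
  then show ?thesis using assms by blast
qed

section \<open>Countable sets\<close>

definition countable :: "'a \<Rightarrow> bool" where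
  "countable S \<longleftrightarrow> (\<exists>c. func c S omega \<and> (\<forall>x y. x \<epsilon> S \<longrightarrow> y \<epsilon> S \<longrightarrow> c \<cdot> x = c \<cdot> y \<longrightarrow> x = y))"

lemma countableI:
  assumes "pterm (\<lambda>\<rho>. c (\<rho> 0))" "\<And>x. x \<epsilon> S \<Longrightarrow> c x \<epsilon> omega"
    "\<And>x y. x \<epsilon> S \<Longrightarrow> y \<epsilon> S \<Longrightarrow> c x = c y \<Longrightarrow> x = y"
  shows "countable S"
  unfolding countable_def
  by (rule exI [of _ "Lam S c"]) (use func_Lam [OF assms(1,2)] ap_Lam [OF assms(1)] assms(3) in auto)

lemma countable_subset: "countable S \<Longrightarrow> (\<And>x. x \<epsilon> T \<Longrightarrow> x \<epsilon> S) \<Longrightarrow> countable T"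
proof -
  assume "countable S" and T: "\<And>x. x \<epsilon> T \<Longrightarrow> x \<epsilon> S"
  then obtain c where c: "func c S omega" "\<And>x y. x \<epsilon> S \<Longrightarrow> y \<epsilon> S \<Longrightarrow> c \<cdot> x = c \<cdot> y \<Longrightarrow> x = y"
    unfolding countable_def by blast
  show "countable T"
  proof (rule countableI [where c = "\<lambda>x. c \<cdot> x"])
    show "pterm (\<lambda>\<rho>. c \<cdot> \<rho> 0)" by (intro pdef_intros)
    show "c \<cdot> x \<epsilon> omega" if "x \<epsilon> T" for x using ap_mem [OF c(1) T [OF that]] .
    show "x = y" if "x \<epsilon> T" "y \<epsilon> T" "c \<cdot> x = c \<cdot> y" for x y
      using c(2) [OF T [OF that(1)] T [OF that(2)] that(3)] .
  qed
qed

lemma countable_omega: "countable omega"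
  by (rule countableI [where c = "\<lambda>x. x"]) (intro pdef_intros)

lemma countable_prod:
  assumes "countable S" "countable T" shows "countable (prod S T)"
proof -
  obtain c where c: "func c S omega" "\<And>x y. x \<epsilon> S \<Longrightarrow> y \<epsilon> S \<Longrightarrow> c \<cdot> x = c \<cdot> y \<Longrightarrow> x = y"
    using assms(1) unfolding countable_def by blast
  obtain d where d: "func d T omega" "\<And>x y. x \<epsilon> T \<Longrightarrow> y \<epsilon> T \<Longrightarrow> d \<cdot> x = d \<cdot> y \<Longrightarrow> x = y"
    using assms(2) unfolding countable_def by blast
  show ?thesis
  proof (rule countableI [where c = "\<lambda>p. cpair (c \<cdot> pfst p) (d \<cdot> psnd p)"])
    show "pterm (\<lambda>\<rho>. cpair (c \<cdot> pfst (\<rho> 0)) (d \<cdot> psnd (\<rho> 0)))" by (intro pdef_intros)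
    show "cpair (c \<cdot> pfst p) (d \<cdot> psnd p) \<epsilon> omega" if "p \<epsilon> prod S T" for p
      using that ap_mem [OF c(1)] ap_mem [OF d(1)] cpair_mem by (auto simp: mem_prod)
    show "p = q" if p: "p \<epsilon> prod S T" and q: "q \<epsilon> prod S T"
      and e: "cpair (c \<cdot> pfst p) (d \<cdot> psnd p) = cpair (c \<cdot> pfst q) (d \<cdot> psnd q)" for p q
    proof -
      obtain x y where x: "x \<epsilon> S" "y \<epsilon> T" "p = opair x y" using p by (rule prodE)
      obtain x' y' where x': "x' \<epsilon> S" "y' \<epsilon> T" "q = opair x' y'" using q by (rule prodE)
      have "c \<cdot> x = c \<cdot> x' \<and> d \<cdot> y = d \<cdot> y'"
        by (rule cpair_inj) (use e x x' ap_mem [OF c(1)] ap_mem [OF d(1)] in simp_all)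
      then show ?thesis using c(2) d(2) x x' by auto
    qed
  qed
qed

text \<open>The code is built up along the sequence: 0 for the empty one, and for
  \<open>snoc s m\<close> the successor of the code of the pair of the code of \<open>s\<close> and
  \<open>m\<close>. The successor keeps it apart from the code of the empty sequence.\<close>

lemma countable_fseq_omega: "countable (finite_seqs omega)"
proof -
  have "\<exists>E. func E (finite_seqs omega) omega \<and> E \<cdot> empty = empty \<and>
    (\<forall>s m. s \<epsilon> finite_seqs omega \<longrightarrow> m \<epsilon> omega \<longrightarrow> E \<cdot> snoc s m = succ (cpair (E \<cdot> s) m))"
    by (rule fs_rec [where st = "\<lambda>y m. succ (cpair y m)"]) (intro pdef_intros, simp_all add: cpair_mem)
  then obtain E where E: "func E (finite_seqs omega) omega" "E \<cdot> empty = empty"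
    "\<And>s m. s \<epsilon> finite_seqs omega \<Longrightarrow> m \<epsilon> omega \<Longrightarrow> E \<cdot> snoc s m = succ (cpair (E \<cdot> s) m)" by blast
  have inj: "s \<epsilon> finite_seqs omega \<Longrightarrow> \<forall>t. t \<epsilon> finite_seqs omega \<longrightarrow> E \<cdot> s = E \<cdot> t \<longrightarrow> s = t" for s
  proof (induction s rule: fs_induct)
    case def show ?case by (intro pdef_intros)
  next
    case empty
    show ?case
    proof (intro allI impI)
      fix t assume t: "t \<epsilon> finite_seqs omega" "E \<cdot> empty = E \<cdot> t"
      from t(1) show "empty = t"
        by (cases rule: fseq_cases) (use t(2) E(2,3) in auto)
    qed
  next
    case (snoc s m)
    show ?case
    proof (intro allI impI)
      fix t assume t: "t \<epsilon> finite_seqs omega" "E \<cdot> snoc s m = E \<cdot> t"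
      from t(1) show "snoc s m = t"
      proof (cases rule: fseq_cases)
        case 1 then show ?thesis using t(2) E(2) E(3) [OF snoc.hyps] by simp
      next
        case (2 t' m')
        have "cpair (E \<cdot> s) m = cpair (E \<cdot> t') m'"
          using t(2) E(3) [OF snoc.hyps] E(3) [OF 2(1,2)] 2(3) by simp
        then have "E \<cdot> s = E \<cdot> t' \<and> m = m'"
          by (rule cpair_inj [OF ap_mem [OF E(1) snoc.hyps(1)] snoc.hyps(2) ap_mem [OF E(1) 2(1)] 2(2)])
        then show ?thesis using snoc.IH 2 by blast
      qed
    qed
  qed
  show ?thesis unfolding countable_def using E(1) inj by blast
qed

lemma fseq_mono: "s \<epsilon> finite_seqs A \<Longrightarrow> (\<And>x. x \<epsilon> A \<Longrightarrow> x \<epsilon> B) \<Longrightarrow> s \<epsilon> finite_seqs B"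
proof -
  assume s: "s \<epsilon> finite_seqs A" and AB: "\<And>x. x \<epsilon> A \<Longrightarrow> x \<epsilon> B"
  have "func s (dm s) B" by (rule func_cod [OF fseqD(2) [OF s]]) (rule AB [OF ap_mem [OF fseqD(2) [OF s]]])
  then show "s \<epsilon> finite_seqs B" by (rule fseqI) (rule fseqD [OF s])
qed

lemma countable_surj:
  assumes "countable S" "x0 \<epsilon> S"
  shows "\<exists>e. func e omega S \<and> (\<forall>x. x \<epsilon> S \<longrightarrow> (\<exists>n. n \<epsilon> omega \<and> e \<cdot> n = x))"
proof -
  obtain c where c: "func c S omega" "\<And>x y. x \<epsilon> S \<Longrightarrow> y \<epsilon> S \<Longrightarrow> c \<cdot> x = c \<cdot> y \<Longrightarrow> x = y"
    using assms(1) unfolding countable_def by blast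
  define t where "t n = (if \<exists>x. x \<epsilon> S \<and> c \<cdot> x = n then iota (\<lambda>x. x \<epsilon> S \<and> c \<cdot> x = n) else x0)" for n
  have pt: "pterm (\<lambda>\<rho>. t (\<rho> 0))" unfolding t_def by (intro pdef_intros)
  have tc: "t (c \<cdot> x) = x" if "x \<epsilon> S" for x
  proof -
    have "iota (\<lambda>y. y \<epsilon> S \<and> c \<cdot> y = c \<cdot> x) = x"
      by (rule iota_eq) (use that c(2) in auto)
    then show ?thesis unfolding t_def using that by auto
  qed
  have tS: "t n \<epsilon> S" for n
  proof (cases "\<exists>x. x \<epsilon> S \<and> c \<cdot> x = n")
    case True then show ?thesis using tc by auto
  next
    case False then have "t n = x0" unfolding t_def by (rule if_not_P)
    then show ?thesis using assms(2) by simp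
  qed
  show ?thesis
  proof (rule exI [of _ "Lam omega t"], intro conjI allI impI)
    show "func (Lam omega t) omega S" by (rule func_Lam [OF pt tS])
    fix x assume x: "x \<epsilon> S"
    show "\<exists>n. n \<epsilon> omega \<and> Lam omega t \<cdot> n = x"
      by (rule exI [of _ "c \<cdot> x"]) (simp add: ap_Lam [OF pt] ap_mem [OF c(1) x] tc [OF x])
  qed
qed

theorem dependent_choice:
  assumes S: "countable S" and R: "pdef (\<lambda>\<rho>. R (\<rho> 0) (\<rho> 1) (\<rho> 2))" and a: "a \<epsilon> S"
    and ex: "\<And>n s. n \<epsilon> omega \<Longrightarrow> s \<epsilon> S \<Longrightarrow> \<exists>s'. s' \<epsilon> S \<and> R n s s'"
  shows "\<exists>g. func g omega S \<and> g \<cdot> empty = a \<and> (\<forall>n. n \<epsilon> omega \<longrightarrow> R n (g \<cdot> n) (g \<cdot> succ n))"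
proof -
  have R3 [pdef_intros]: "pterm t \<Longrightarrow> pterm u \<Longrightarrow> pterm v \<Longrightarrow> pdef (\<lambda>\<rho>. R (t \<rho>) (u \<rho>) (v \<rho>))" for t u v
    by (rule pdef_subst3 [where P = R, OF R])
  obtain c where c: "func c S omega" "\<And>x y. x \<epsilon> S \<Longrightarrow> y \<epsilon> S \<Longrightarrow> c \<cdot> x = c \<cdot> y \<Longrightarrow> x = y"
    using S unfolding countable_def by blast
  define Q where "Q n s s' \<longleftrightarrow> s' \<epsilon> S \<and> R n s s' \<and> (\<forall>t. t \<epsilon> S \<longrightarrow> R n s t \<longrightarrow> \<not> c \<cdot> t \<epsilon> c \<cdot> s')" for n s s'
  have Q_pdef [pdef_intros]: "pterm t \<Longrightarrow> pterm u \<Longrightarrow> pterm v \<Longrightarrow> pdef (\<lambda>\<rho>. Q (t \<rho>) (u \<rho>) (v \<rho>))" for t u v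
    by (rule pdef_subst3 [where P = Q]) (unfold Q_def, intro pdef_intros)
  have Q: "Q n s (iota (Q n s))" if n: "n \<epsilon> omega" "s \<epsilon> S" for n s
  proof (rule iotaI)
    obtain s1 where s1: "s1 \<epsilon> S" "R n s s1" using ex n by blast
    have pd: "pdef (\<lambda>\<rho>. \<exists>t. t \<epsilon> S \<and> R n s t \<and> c \<cdot> t = \<rho> 0)" by (intro pdef_intros)
    obtain k where k: "k \<epsilon> omega" "\<exists>t. t \<epsilon> S \<and> R n s t \<and> c \<cdot> t = k"
      "\<And>j. j \<epsilon> k \<Longrightarrow> \<not> (\<exists>t. t \<epsilon> S \<and> R n s t \<and> c \<cdot> t = j)"
      using om_least [OF pd ap_mem [OF c(1) s1(1)]] s1 by blast
    from k(2) obtain t where t: "t \<epsilon> S" "R n s t" "c \<cdot> t = k" by blast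
    show "\<exists>!s'. Q n s s'"
    proof (rule ex1I [of _ t])
      show "Q n s t" unfolding Q_def using t k(3) by blast
      fix s' assume s': "Q n s s'"
      have "\<not> c \<cdot> s' \<epsilon> c \<cdot> t" "\<not> c \<cdot> t \<epsilon> c \<cdot> s'" using s' t k(3) unfolding Q_def by blast+
      then show "s' = t" using om_linear c s' t ap_mem [OF c(1)] unfolding Q_def by metis
    qed
  qed
  have "\<exists>g. func g omega S \<and> g \<cdot> empty = a \<and> (\<forall>n. n \<epsilon> omega \<longrightarrow> g \<cdot> succ n = iota (Q n (g \<cdot> n)))"
  proof (rule prim_rec [where st = "\<lambda>n s. iota (Q n s)"])
    show "pterm (\<lambda>\<rho>. iota (Q (\<rho> 0) (\<rho> 1)))"
      by (rule pterm_iota [where P = "\<lambda>s' \<rho>. Q (\<rho> 0) (\<rho> 1) s'"]) (intro pdef_intros)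
    show "iota (Q n s) \<epsilon> S" if "n \<epsilon> omega" "s \<epsilon> S" for n s
      using Q [OF that] unfolding Q_def by blast
  qed (rule a)
  then obtain g where g: "func g omega S" "g \<cdot> empty = a"
    "\<And>n. n \<epsilon> omega \<Longrightarrow> g \<cdot> succ n = iota (Q n (g \<cdot> n))" by blast
  have "R n (g \<cdot> n) (g \<cdot> succ n)" if n: "n \<epsilon> omega" for n
    using Q [OF n ap_mem [OF g(1) n]] unfolding g(3) [OF n] Q_def by blast
  then show ?thesis using g by blast
qed

section \<open>Strings and plays of the game\<close>

text \<open>The default 0 makes the value a natural number for every \<open>Q\<close>, so that it
  can serve as a total rule for moves.\<close>

definition mu :: "('a \<Rightarrow> bool) \<Rightarrow> 'a" where
  "mu Q = iota (\<lambda>m. m \<epsilon> omega \<and> Q m \<and> (\<forall>k. k \<epsilon> m \<longrightarrow> \<not> Q k))"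

lemma mu_mem [simp]: "mu Q \<epsilon> omega"
proof (cases "\<exists>!m. m \<epsilon> omega \<and> Q m \<and> (\<forall>k. k \<epsilon> m \<longrightarrow> \<not> Q k)")
  case True from iotaI [OF True] show ?thesis unfolding mu_def by (elim conjE)
next
  case False then show ?thesis unfolding mu_def iota_def if_not_P [OF False] by simp
qed

lemma muI:
  assumes "pdef (\<lambda>\<rho>. Q (\<rho> 0))" "n \<epsilon> omega" "Q n" shows "Q (mu Q)"
proof -
  obtain m where m: "m \<epsilon> omega" "Q m" "\<forall>k. k \<epsilon> m \<longrightarrow> \<not> Q k"
    using om_least [where P = Q, OF assms] by blast
  have 1: "\<exists>!m. m \<epsilon> omega \<and> Q m \<and> (\<forall>k. k \<epsilon> m \<longrightarrow> \<not> Q k)"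
  proof (rule ex1I [of _ m])
    show "m \<epsilon> omega \<and> Q m \<and> (\<forall>k. k \<epsilon> m \<longrightarrow> \<not> Q k)" using m by blast
    fix n assume "n \<epsilon> omega \<and> Q n \<and> (\<forall>k. k \<epsilon> n \<longrightarrow> \<not> Q k)"
    then show "n = m" using om_linear [of m n] m by blast
  qed
  from iotaI [OF 1] show ?thesis unfolding mu_def by (elim conjE)
qed

section \<open>Binary strings and limits of chains\<close>

lemma num2: "num 2 = succ (succ empty)" by (simp add: numeral_2_eq_2)

lemma mem_two: "x \<epsilon> num 2 \<longleftrightarrow> x = empty \<or> x = succ empty"
  by (auto simp: num2)

lemma two_omega: "x \<epsilon> num 2 \<Longrightarrow> x \<epsilon> omega"
  by (auto simp: mem_two)

abbreviation bin :: 'a where "bin \<equiv> finite_seqs (num 2)"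

lemma zero_two [simp]: "empty \<epsilon> num 2" and one_two [simp]: "succ empty \<epsilon> num 2"
  by (simp_all add: mem_two)

definition psub :: "'a \<Rightarrow> 'a \<Rightarrow> bool" where
  "psub s t \<longleftrightarrow> subset s t \<and> dm s \<epsilon> dm t"

lemma pdef_psub [pdef_intros]: "pterm t \<Longrightarrow> pterm u \<Longrightarrow> pdef (\<lambda>\<rho>. psub (t \<rho>) (u \<rho>))"
  unfolding psub_def by (intro pdef_intros)

lemma subset_fseq_dm:
  assumes "s \<epsilon> finite_seqs A" "func t B D" "subset s t" shows "k \<epsilon> dm s \<Longrightarrow> k \<epsilon> B"
  by (rule subset_dom [OF fseqD(2) [OF assms(1)] assms(2,3)])

lemma psub_snoc: "s \<epsilon> finite_seqs A \<Longrightarrow> m \<epsilon> A \<Longrightarrow> psub s (snoc s m)"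
  unfolding psub_def using dm_snoc by simp

lemma subset_dm_le:
  assumes "s \<epsilon> finite_seqs A" "t \<epsilon> finite_seqs B" "subset s t" shows "dm s \<epsilon> succ (dm t)"
proof -
  have "\<not> dm t \<epsilon> dm s" using subset_fseq_dm [OF assms(1) fseqD(2) [OF assms(2)] assms(3), of "dm t"] by auto
  then show ?thesis using om_not_mem [OF fseqD(1) [OF assms(2)] fseqD(1) [OF assms(1)]] by blast
qed

lemma le_lt_trans: "i \<epsilon> succ j \<Longrightarrow> j \<epsilon> k \<Longrightarrow> k \<epsilon> omega \<Longrightarrow> i \<epsilon> k"
  using om_trans by auto

lemma lt_le_trans: "i \<epsilon> j \<Longrightarrow> j \<epsilon> succ k \<Longrightarrow> k \<epsilon> omega \<Longrightarrow> i \<epsilon> k"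
  using om_trans by auto

lemma psub_trans:
  assumes "s \<epsilon> finite_seqs A" "t \<epsilon> finite_seqs B" "u \<epsilon> finite_seqs D" "subset s t" "psub t u"
  shows "psub s u"
  using assms subset_trans le_lt_trans [OF subset_dm_le [OF assms(1,2,4)] _ fseqD(1) [OF assms(3)]]
  unfolding psub_def by blast

lemma psub_trans':
  assumes "s \<epsilon> finite_seqs A" "t \<epsilon> finite_seqs B" "u \<epsilon> finite_seqs D" "psub s t" "subset t u"
  shows "psub s u"
  using assms subset_trans lt_le_trans [OF _ subset_dm_le [OF assms(2,3,5)] fseqD(1) [OF assms(3)]]
  unfolding psub_def by blast

definition lim :: "'a \<Rightarrow> 'a" where
  "lim g = Set (\<lambda>w. \<exists>n. n \<epsilon> omega \<and> w \<epsilon> g \<cdot> n)"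

lemma pterm_lim [pdef_intros]: "pterm t \<Longrightarrow> pterm (\<lambda>\<rho>. lim (t \<rho>))"
  by (rule pterm_subst1 [where f = lim]) (unfold lim_def, intro pdef_intros)

lemma chain_mono:
  assumes g: "\<And>n. n \<epsilon> omega \<Longrightarrow> subset (g \<cdot> n) (g \<cdot> succ n)" and "n \<epsilon> omega" "m \<epsilon> succ n"
  shows "subset (g \<cdot> m) (g \<cdot> n)"
proof -
  from assms(2) have "\<forall>m. m \<epsilon> succ n \<longrightarrow> subset (g \<cdot> m) (g \<cdot> n)"
  proof (induction n rule: om_induct)
    case def show ?case by (intro pdef_intros)
  next
    case 0 show ?case by simp
  next
    case (succ n)
    show ?case
    proof (intro allI impI)
      fix m assume "m \<epsilon> succ (succ n)"
      then consider "m \<epsilon> succ n" | "m = succ n" by auto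
      then show "subset (g \<cdot> m) (g \<cdot> succ n)"
        by cases (use succ.IH subset_trans g [OF succ.hyps] in \<open>blast, simp\<close>)
    qed
  qed
  then show ?thesis using assms(3) by blast
qed

lemma chain_lim:
  assumes f: "func g omega (finite_seqs B)" and g: "\<And>n. n \<epsilon> omega \<Longrightarrow> psub (g \<cdot> n) (g \<cdot> succ n)"
  shows chain_dm: "n \<epsilon> omega \<Longrightarrow> n \<epsilon> succ (dm (g \<cdot> n))"
    and func_lim: "func (lim g) omega B"
    and subset_lim: "n \<epsilon> omega \<Longrightarrow> subset (g \<cdot> n) (lim g)"
proof -
  have gm: "m \<epsilon> omega \<Longrightarrow> g \<cdot> m \<epsilon> finite_seqs B" for m by (rule ap_mem [OF f])
  have mono: "n \<epsilon> omega \<Longrightarrow> m \<epsilon> succ n \<Longrightarrow> subset (g \<cdot> m) (g \<cdot> n)" for m n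
    by (rule chain_mono) (use g in \<open>auto simp: psub_def\<close>)
  show dm: "n \<epsilon> omega \<Longrightarrow> n \<epsilon> succ (dm (g \<cdot> n))" for n
  proof (induction n rule: om_induct)
    case def show ?case by (intro pdef_intros)
  next
    case 0 show ?case using om_zero_cases [OF fseqD(1) [OF gm [OF om_0]]] by auto
  next
    case (succ n)
    have "n \<epsilon> dm (g \<cdot> succ n)"
      using le_lt_trans [OF succ.IH _ fseqD(1) [OF gm]] g [OF succ.hyps] om_succ [OF succ.hyps] by (simp add: psub_def)
    then show ?case by (rule om_succ_mono [OF fseqD(1) [OF gm [OF om_succ [OF succ.hyps]]]])
  qed
  have dm': "n \<epsilon> dm (g \<cdot> succ n)" if "n \<epsilon> omega" for n
    using dm [OF om_succ [OF that]] om_succ_mono_iff fseqD(1) [OF gm [OF om_succ [OF that]]] that by blast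
  have val: "g \<cdot> m \<cdot> k = g \<cdot> succ k \<cdot> k" if m: "m \<epsilon> omega" and k: "k \<epsilon> dm (g \<cdot> m)" for m k
  proof -
    have ko: "k \<epsilon> omega" using omega_trans [OF fseqD(1) [OF gm [OF m]] k] .
    obtain l where l: "l \<epsilon> omega" "m \<epsilon> l" "succ k \<epsilon> l" using om_upper2 [OF m om_succ [OF ko]] by blast
    have 1: "subset (g \<cdot> m) (g \<cdot> l)" "subset (g \<cdot> succ k) (g \<cdot> l)" using mono l by simp_all
    show ?thesis
      using subset_ap(2) [OF fseqD(2) [OF gm [OF m]] fseqD(2) [OF gm [OF l(1)]] 1(1) k]
        subset_ap(2) [OF fseqD(2) [OF gm [OF om_succ [OF ko]]] fseqD(2) [OF gm [OF l(1)]] 1(2) dm' [OF ko]] by simp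
  qed
  have mem: "w \<epsilon> lim g \<longleftrightarrow> (\<exists>n. n \<epsilon> omega \<and> w \<epsilon> g \<cdot> n)" for w
    unfolding lim_def
  proof (rule mem_Set_sep [where A = "prod omega B"])
    show "pdef (\<lambda>\<rho>. \<exists>n. n \<epsilon> omega \<and> \<rho> 0 \<epsilon> g \<cdot> n)" by (intro pdef_intros)
    fix w assume "\<exists>n. n \<epsilon> omega \<and> w \<epsilon> g \<cdot> n"
    then obtain n where n: "n \<epsilon> omega" "w \<epsilon> g \<cdot> n" by blast
    then obtain k where "k \<epsilon> dm (g \<cdot> n)" "w = opair k (g \<cdot> n \<cdot> k)"
      using func_mem_iff [OF fseqD(2) [OF gm [OF n(1)]]] by blast
    then show "w \<epsilon> prod omega B"
      using omega_trans [OF fseqD(1) [OF gm [OF n(1)]]] ap_mem [OF fseqD(2) [OF gm [OF n(1)]]] by simp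
  qed
  \<comment> \<open>Digit \<open>k\<close> is read off the string number \<open>k + 1\<close>, which
    is certain to be longer than \<open>k\<close>.\<close>
  have mem': "w \<epsilon> lim g \<longleftrightarrow> (\<exists>k. k \<epsilon> omega \<and> w = opair k (g \<cdot> succ k \<cdot> k))" for w
  proof
    assume "w \<epsilon> lim g"
    then obtain n where n: "n \<epsilon> omega" "w \<epsilon> g \<cdot> n" using mem by blast
    then obtain k where k: "k \<epsilon> dm (g \<cdot> n)" "w = opair k (g \<cdot> n \<cdot> k)"
      using func_mem_iff [OF fseqD(2) [OF gm [OF n(1)]]] by blast
    then show "\<exists>k. k \<epsilon> omega \<and> w = opair k (g \<cdot> succ k \<cdot> k)"
      using val [OF n(1)] omega_trans [OF fseqD(1) [OF gm [OF n(1)]]] by auto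
  next
    assume "\<exists>k. k \<epsilon> omega \<and> w = opair k (g \<cdot> succ k \<cdot> k)"
    then obtain k where k: "k \<epsilon> omega" "w = opair k (g \<cdot> succ k \<cdot> k)" by blast
    then have "w \<epsilon> g \<cdot> succ k"
      using func_mem_iff [OF fseqD(2) [OF gm [OF om_succ [OF k(1)]]]] dm' by blast
    then show "w \<epsilon> lim g" using mem om_succ k(1) by blast
  qed
  show "func (lim g) omega B"
    by (rule funcI [OF mem']) (use ap_mem [OF fseqD(2) [OF gm [OF om_succ]] dm'] in blast)
  show "n \<epsilon> omega \<Longrightarrow> subset (g \<cdot> n) (lim g)" for n
    unfolding subset_def using mem by blast
qed

lemma initial_segments_subset:
  assumes "a \<epsilon> finite_seqs A" "b \<epsilon> finite_seqs B" "func u D E" "subset a u" "subset b u"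
    and "dm a \<epsilon> succ (dm b)"
  shows "subset a b"
proof (rule func_subset [OF fseqD(2) [OF assms(1)] fseqD(2) [OF assms(2)]])
  fix k assume k: "k \<epsilon> dm a"
  show k': "k \<epsilon> dm b" by (rule lt_le_trans [OF k assms(6) fseqD(1) [OF assms(2)]])
  show "a \<cdot> k = b \<cdot> k"
    using subset_ap(2) [OF fseqD(2) [OF assms(1)] assms(3,4) k]
      subset_ap(2) [OF fseqD(2) [OF assms(2)] assms(3,5) k'] by simp
qed

section \<open>Moves, positions and plays\<close>

text \<open>A surjection of \<open>omega\<close> onto the pairs of a binary string and a digit, by
  which a game on \<open>omega\<close> becomes one whose moves are such pairs.\<close>

definition move_code :: 'a where
  "move_code = (SOME e. func e omega (prod bin (num 2)) \<and>
     (\<forall>x. x \<epsilon> prod bin (num 2) \<longrightarrow> (\<exists>n. n \<epsilon> omega \<and> e \<cdot> n = x)))"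

definition move_str :: "'a \<Rightarrow> 'a" where "move_str m = pfst (move_code \<cdot> m)"

definition move_digit :: "'a \<Rightarrow> 'a" where "move_digit m = psnd (move_code \<cdot> m)"

lemma countable_two: "countable (num 2)"
  by (rule countable_subset [OF countable_omega two_omega])

lemma countable_bin: "countable bin"
  by (rule countable_subset [OF countable_fseq_omega]) (rule fseq_mono [OF _ two_omega])

lemma move_code: "func move_code omega (prod bin (num 2)) \<and>
     (\<forall>x. x \<epsilon> prod bin (num 2) \<longrightarrow> (\<exists>n. n \<epsilon> omega \<and> move_code \<cdot> n = x))"
  unfolding move_code_def
  by (rule someI_ex, rule countable_surj [OF countable_prod [OF countable_bin countable_two], of "opair empty empty"]) simp

lemma pterm_move_str [pdef_intros]: "pterm t \<Longrightarrow> pterm (\<lambda>\<rho>. move_str (t \<rho>))"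
  unfolding move_str_def by (intro pdef_intros)

lemma pterm_move_digit [pdef_intros]: "pterm t \<Longrightarrow> pterm (\<lambda>\<rho>. move_digit (t \<rho>))"
  unfolding move_digit_def by (intro pdef_intros)

lemma move_mem: "m \<epsilon> omega \<Longrightarrow> move_str m \<epsilon> bin" "m \<epsilon> omega \<Longrightarrow> move_digit m \<epsilon> num 2"
  using ap_mem [OF conjunct1 [OF move_code], of m] by (auto simp: move_str_def move_digit_def mem_prod)

lemma move_ex:
  assumes "s \<epsilon> bin" "i \<epsilon> num 2" obtains m where "m \<epsilon> omega" "move_str m = s" "move_digit m = i"
proof -
  have "opair s i \<epsilon> prod bin (num 2)" using assms by simp
  then obtain n where "n \<epsilon> omega" "move_code \<cdot> n = opair s i" using move_code by blast
  then show thesis using that by (simp add: move_str_def move_digit_def)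
qed

text \<open>A move that does not properly extend the current string counts as appending 0, so every move is legal.\<close>

definition next_str :: "'a \<Rightarrow> 'a \<Rightarrow> 'a" where
  "next_str s m = (if psub s (move_str m) then move_str m else snoc s empty)"

definition pos_str :: 'a where
  "pos_str = (SOME H. func H (finite_seqs omega) bin \<and> H \<cdot> empty = empty \<and>
    (\<forall>s m. s \<epsilon> finite_seqs omega \<longrightarrow> m \<epsilon> omega \<longrightarrow> H \<cdot> snoc s m = next_str (H \<cdot> s) m))"

lemma pos_str: "func pos_str (finite_seqs omega) bin \<and> pos_str \<cdot> empty = empty \<and>
    (\<forall>s m. s \<epsilon> finite_seqs omega \<longrightarrow> m \<epsilon> omega \<longrightarrow> pos_str \<cdot> snoc s m = next_str (pos_str \<cdot> s) m)"
  unfolding pos_str_def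
proof (rule someI_ex, rule fs_rec)
  show "pterm (\<lambda>\<rho>. next_str (\<rho> 0) (\<rho> 1))" unfolding next_str_def by (intro pdef_intros)
  show "next_str y m \<epsilon> bin" if "y \<epsilon> bin" "m \<epsilon> omega" for y m
    using that move_mem(1) snoc_fseq [OF that(1) zero_two] by (simp add: next_str_def)
qed simp

lemma pos_str_mem: "p \<epsilon> finite_seqs omega \<Longrightarrow> pos_str \<cdot> p \<epsilon> bin"
  using ap_mem pos_str by blast

lemma pos_str_empty [simp]: "pos_str \<cdot> empty = empty" using pos_str by blast

lemma pos_str_snoc:
  assumes "p \<epsilon> finite_seqs omega" "m \<epsilon> omega" shows "psub (pos_str \<cdot> p) (pos_str \<cdot> snoc p m)"
proof -
  have "pos_str \<cdot> snoc p m = next_str (pos_str \<cdot> p) m" using pos_str assms by blast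
  then show ?thesis using psub_snoc [OF pos_str_mem [OF assms(1)] zero_two] by (simp add: next_str_def)
qed

lemma pos_str_choose:
  assumes "p \<epsilon> finite_seqs omega" "psub (pos_str \<cdot> p) a" "a \<epsilon> bin" "i \<epsilon> num 2"
  obtains m where "m \<epsilon> omega" "pos_str \<cdot> snoc p m = a" "move_digit m = i"
proof -
  obtain m where m: "m \<epsilon> omega" "move_str m = a" "move_digit m = i" using move_ex [OF assms(3,4)] .
  have "pos_str \<cdot> snoc p m = next_str (pos_str \<cdot> p) m" using pos_str assms(1) m(1) by blast
  then show thesis using that m assms(2) by (simp add: next_str_def)
qed

text \<open>
  Both players extend a common string, which in the limit gives \<open>play_real\<close>. The odd moves,
  those of player II, carry in addition the digits of \<open>play_digits\<close>.
\<close>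

definition play_real :: "'a \<Rightarrow> 'a" where
  "play_real x = lim (Lam omega (\<lambda>n. pos_str \<cdot> restrict x n))"

definition play_digits :: "'a \<Rightarrow> 'a" where
  "play_digits x = Lam omega (\<lambda>k. move_digit (x \<cdot> succ (dbl \<cdot> k)))"

lemma pterm_play_real [pdef_intros]: "pterm t \<Longrightarrow> pterm (\<lambda>\<rho>. play_real (t \<rho>))"
  by (rule pterm_subst1 [where f = play_real]) (unfold play_real_def, intro pdef_intros)

lemma pterm_play_digits [pdef_intros]: "pterm t \<Longrightarrow> pterm (\<lambda>\<rho>. play_digits (t \<rho>))"
  by (rule pterm_subst1 [where f = play_digits]) (unfold play_digits_def, intro pdef_intros)

lemma restrict_fseq:
  assumes "func x omega A" "n \<epsilon> omega" shows "restrict x n \<epsilon> finite_seqs A" "dm (restrict x n) = n"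
proof -
  have "func (restrict x n) n A" by (rule restrict_ap(1) [OF assms(1) omega_trans [OF assms(2)]])
  then show "restrict x n \<epsilon> finite_seqs A" "dm (restrict x n) = n" using fseqI assms(2) dm_func by blast+
qed

lemma restrict_succ:
  assumes "func x omega A" "n \<epsilon> omega" shows "restrict x (succ n) = snoc (restrict x n) (x \<cdot> n)"
  by (rule snoc_restrict [OF assms(1) om_succ [OF assms(2)] omega_trans [OF om_succ [OF assms(2)]]])

lemma play_chain:
  assumes x: "func x omega omega"
  defines "c \<equiv> Lam omega (\<lambda>n. pos_str \<cdot> restrict x n)"
  shows "func c omega bin" "n \<epsilon> omega \<Longrightarrow> c \<cdot> n = pos_str \<cdot> restrict x n"
    "n \<epsilon> omega \<Longrightarrow> psub (c \<cdot> n) (c \<cdot> succ n)"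
proof -
  have pt: "pterm (\<lambda>\<rho>. pos_str \<cdot> restrict x (\<rho> 0))" by (intro pdef_intros)
  show "func c omega bin" unfolding c_def by (rule func_Lam [OF pt]) (rule pos_str_mem [OF restrict_fseq(1) [OF x]])
  show 1: "n \<epsilon> omega \<Longrightarrow> c \<cdot> n = pos_str \<cdot> restrict x n" for n unfolding c_def by (rule ap_Lam [OF pt])
  show "n \<epsilon> omega \<Longrightarrow> psub (c \<cdot> n) (c \<cdot> succ n)"
    unfolding 1 [OF om_succ] 1 restrict_succ [OF x]
    using pos_str_snoc [OF restrict_fseq(1) [OF x] ap_mem [OF x]] by (simp add: 1 restrict_succ [OF x])
qed

lemma play_real:
  assumes x: "func x omega omega"
  shows "func (play_real x) omega (num 2)"
    and "n \<epsilon> omega \<Longrightarrow> subset (pos_str \<cdot> restrict x n) (play_real x)"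
    and "n \<epsilon> omega \<Longrightarrow> n \<epsilon> succ (dm (pos_str \<cdot> restrict x n))"
  unfolding play_real_def
    apply (rule func_lim [OF play_chain(1,3) [OF x]], assumption)
  using subset_lim [OF play_chain(1,3) [OF x]] chain_dm [OF play_chain(1,3) [OF x]] play_chain(2) [OF x]
  by auto

lemma play_digits:
  assumes x: "func x omega omega"
  shows "func (play_digits x) omega (num 2)"
    and "k \<epsilon> omega \<Longrightarrow> play_digits x \<cdot> k = move_digit (x \<cdot> succ (dbl \<cdot> k))"
proof -
  have pt: "pterm (\<lambda>\<rho>. move_digit (x \<cdot> succ (dbl \<cdot> \<rho> 0)))" by (intro pdef_intros)
  show "func (play_digits x) omega (num 2)" unfolding play_digits_def
    by (rule func_Lam [OF pt]) (rule move_mem(2) [OF ap_mem [OF x om_succ [OF dbl_mem]]])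
  show "k \<epsilon> omega \<Longrightarrow> play_digits x \<cdot> k = move_digit (x \<cdot> succ (dbl \<cdot> k))"
    unfolding play_digits_def by (rule ap_Lam [OF pt])
qed

section \<open>Determinacy\<close>

lemma le_dbl: "k \<epsilon> omega \<Longrightarrow> k \<epsilon> succ (dbl \<cdot> k)"
proof (induction k rule: om_induct)
  case def show ?case by (intro pdef_intros)
next
  case 0 show ?case by simp
next
  case (succ k)
  have "succ k \<epsilon> succ (succ (dbl \<cdot> k))" by (rule om_succ_mono [OF om_succ [OF dbl_mem [OF succ.hyps]] succ.IH])
  then show ?case by (simp add: succ.hyps)
qed

text \<open>A generic \<open>u\<close> defeats \<open>\<sigma>\<close>. For every position with
  player II to move whose string is an initial segment of \<open>u\<close>, and for either digit,
  some move with that digit leads, after the answer of \<open>\<sigma>\<close>, to a string still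
  inside \<open>u\<close>. Both digits have to be provided for, because \<open>u\<close> is built
  before a partner \<open>v\<close> is known. Player II then plays along \<open>u\<close> while
  spelling out \<open>v\<close>.\<close>

lemma player_I_loses:
  assumes \<sigma>: "func \<sigma> (finite_seqs omega) omega"
    and total: "\<And>u. func u omega (num 2) \<Longrightarrow> \<exists>v. func v omega (num 2) \<and> opair u v \<epsilon> R"
    and win: "\<And>x. func x omega omega \<Longrightarrow> (\<And>n. n \<epsilon> omega \<Longrightarrow> even_nat n \<Longrightarrow> x \<cdot> n = \<sigma> \<cdot> restrict x n) \<Longrightarrow>
      \<not> opair (play_real x) (play_digits x) \<epsilon> R"
  shows False
proof -
  \<comment> \<open>Positions of odd length are those in which player II is to move.\<close>
  define isP where "isP p \<longleftrightarrow> p \<epsilon> finite_seqs omega \<and> (\<exists>k. k \<epsilon> omega \<and> dm p = succ (dbl \<cdot> k))" for p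
  have isP_pdef [pdef_intros]: "pterm t \<Longrightarrow> pdef (\<lambda>\<rho>. isP (t \<rho>))" for t
    unfolding isP_def by (rule pdef_subst1) (intro pdef_intros)
  obtain Pos where Pos: "\<And>p. p \<epsilon> Pos \<longleftrightarrow> p \<epsilon> finite_seqs omega \<and> isP p"
    using sep_ex [where P = isP] isP_pdef [OF pterm_var] by blast
  define reply where "reply p m = snoc (snoc p m) (\<sigma> \<cdot> snoc p m)" for p m
  have reply_pterm [pdef_intros]: "pterm t \<Longrightarrow> pterm u \<Longrightarrow> pterm (\<lambda>\<rho>. reply (t \<rho>) (u \<rho>))" for t u
    unfolding reply_def by (intro pdef_intros)
  have sm: "\<sigma> \<cdot> p \<epsilon> omega" if "p \<epsilon> finite_seqs omega" for p by (rule ap_mem [OF \<sigma> that])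
  have reply_mem: "reply p m \<epsilon> finite_seqs omega" if "p \<epsilon> finite_seqs omega" "m \<epsilon> omega" for p m
    unfolding reply_def by (rule snoc_fseq [OF snoc_fseq [OF that] sm [OF snoc_fseq [OF that]]])
  have reply_psub: "psub (pos_str \<cdot> snoc p m) (pos_str \<cdot> reply p m)" if "p \<epsilon> finite_seqs omega" "m \<epsilon> omega" for p m
    unfolding reply_def by (rule pos_str_snoc [OF snoc_fseq [OF that] sm [OF snoc_fseq [OF that]]])
  define p0 where "p0 = snoc empty (\<sigma> \<cdot> empty)"
  have p0: "p0 \<epsilon> finite_seqs omega" unfolding p0_def by (rule snoc_fseq [OF empty_fseq sm [OF empty_fseq]])
  have "dm p0 = succ (dbl \<cdot> empty)" unfolding p0_def using dm_snoc [OF empty_fseq sm [OF empty_fseq]] by simp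
  then have p0': "p0 \<epsilon> Pos" unfolding Pos isP_def using p0 om_0 by blast
  have "countable (prod Pos (num 2))"
    by (rule countable_prod [OF countable_subset [OF countable_fseq_omega] countable_two]) (simp add: Pos)
  then obtain e where e: "func e omega (prod Pos (num 2))"
      "\<And>x. x \<epsilon> prod Pos (num 2) \<Longrightarrow> \<exists>n. n \<epsilon> omega \<and> e \<cdot> n = x"
    using countable_surj [of "prod Pos (num 2)" "opair p0 empty"] p0' by auto
  \<comment> \<open>The requirement number \<open>k\<close> consists of a position and a digit. It
    is met either by swallowing the outcome of a move with this digit or by making the string
    incompatible with that of the position.\<close>
  define Rel where "Rel k t t' \<longleftrightarrow> psub t t' \<and>
    ((\<exists>m. m \<epsilon> omega \<and> move_digit m = psnd (e \<cdot> k) \<and> subset (pos_str \<cdot> reply (pfst (e \<cdot> k)) m) t') \<or>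
     \<not> (\<exists>t''. t'' \<epsilon> bin \<and> subset t' t'' \<and> subset (pos_str \<cdot> pfst (e \<cdot> k)) t''))" for k t t'
  have "\<exists>g. func g omega bin \<and> g \<cdot> empty = pos_str \<cdot> p0 \<and> (\<forall>n. n \<epsilon> omega \<longrightarrow> Rel n (g \<cdot> n) (g \<cdot> succ n))"
  proof (rule dependent_choice [OF countable_bin])
    show "pdef (\<lambda>\<rho>. Rel (\<rho> 0) (\<rho> 1) (\<rho> 2))" unfolding Rel_def by (intro pdef_intros)
    show "pos_str \<cdot> p0 \<epsilon> bin" by (rule pos_str_mem [OF p0])
    fix k t assume k: "k \<epsilon> omega" and t: "t \<epsilon> bin"
    obtain p i where pi: "p \<epsilon> Pos" "i \<epsilon> num 2" "e \<cdot> k = opair p i" using ap_mem [OF e(1) k] by (rule prodE)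
    have p: "p \<epsilon> finite_seqs omega" using pi(1) Pos by blast
    show "\<exists>t'. t' \<epsilon> bin \<and> Rel k t t'"
    proof (cases "\<exists>t''. t'' \<epsilon> bin \<and> subset t t'' \<and> subset (pos_str \<cdot> p) t''")
      case True
      then obtain t'' where t'': "t'' \<epsilon> bin" "subset t t''" "subset (pos_str \<cdot> p) t''" by blast
      \<comment> \<open>The extra digit is needed because a legal move extends the current string
        properly.\<close>
      define a where "a = snoc t'' empty"
      have a: "a \<epsilon> bin" "psub t'' a" unfolding a_def using snoc_fseq [OF t''(1) zero_two] psub_snoc [OF t''(1) zero_two] .
      have pa: "psub (pos_str \<cdot> p) a" by (rule psub_trans [OF pos_str_mem [OF p] t''(1) a(1) t''(3) a(2)])
      obtain m where m: "m \<epsilon> omega" "pos_str \<cdot> snoc p m = a" "move_digit m = i"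
        using pos_str_choose [OF p pa a(1) pi(2)] .
      have q: "reply p m \<epsilon> finite_seqs omega" by (rule reply_mem [OF p m(1)])
      have ta: "psub t a" by (rule psub_trans [OF t t''(1) a(1) t''(2) a(2)])
      have aq: "psub a (pos_str \<cdot> reply p m)" using reply_psub [OF p m(1)] m(2) by simp
      have "psub t (pos_str \<cdot> reply p m)"
        by (rule psub_trans [OF t a(1) pos_str_mem [OF q] _ aq]) (use ta in \<open>simp add: psub_def\<close>)
      then have "Rel k t (pos_str \<cdot> reply p m)"
        unfolding Rel_def pi(3) pfst_opair psnd_opair using m(1,3) subset_refl by blast
      then show ?thesis using pos_str_mem [OF q] by blast
    next
      case False
      \<comment> \<open>Incompatibility passes to all extensions; the 0 is appended only to keep the
        chain strictly growing.\<close>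
      have b: "snoc t empty \<epsilon> bin" "psub t (snoc t empty)" using snoc_fseq [OF t zero_two] psub_snoc [OF t zero_two] .
      have "\<not> (\<exists>t''. t'' \<epsilon> bin \<and> subset (snoc t empty) t'' \<and> subset (pos_str \<cdot> p) t'')"
        using False subset_trans [OF subset_snoc] by blast
      then have "Rel k t (snoc t empty)" unfolding Rel_def pi(3) pfst_opair psnd_opair using b(2) by blast
      then show ?thesis using b(1) by blast
    qed
  qed
  then obtain g where g: "func g omega bin" "g \<cdot> empty = pos_str \<cdot> p0"
    "\<And>n. n \<epsilon> omega \<Longrightarrow> Rel n (g \<cdot> n) (g \<cdot> succ n)" by blast
  have gp: "psub (g \<cdot> n) (g \<cdot> succ n)" if "n \<epsilon> omega" for n using g(3) [OF that] unfolding Rel_def by blast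
  define u where "u = lim g"
  have u: "func u omega (num 2)" unfolding u_def by (rule func_lim [OF g(1) gp])
  have gu: "subset (g \<cdot> n) u" if "n \<epsilon> omega" for n unfolding u_def by (rule subset_lim [OF g(1) gp that])
  have gm: "g \<cdot> n \<epsilon> bin" if "n \<epsilon> omega" for n by (rule ap_mem [OF g(1) that])
  obtain v where v: "func v omega (num 2)" "opair u v \<epsilon> R" using total [OF u] by blast
  define Good where "Good s m \<longleftrightarrow> (\<exists>k. k \<epsilon> omega \<and> dm s = succ (dbl \<cdot> k) \<and> move_digit m = v \<cdot> k \<and>
    subset (pos_str \<cdot> reply s m) u)" for s m
  have Good_pdef [pdef_intros]: "pterm t \<Longrightarrow> pterm u \<Longrightarrow> pdef (\<lambda>\<rho>. Good (t \<rho>) (u \<rho>))" for t u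
    by (rule pdef_subst2 [where P = Good]) (unfold Good_def, intro pdef_intros)
  \<comment> \<open>Player I follows \<open>\<sigma>\<close>; player II answers by the least number
    that is a good move.\<close>
  define h where "h s = (if even_nat (dm s) \<and> s \<epsilon> finite_seqs omega then \<sigma> \<cdot> s else mu (Good s))" for s
  have h1: "pterm (\<lambda>\<rho>. h (\<rho> 0))" unfolding h_def mu_def by (intro pdef_intros)
  have h2: "h s \<epsilon> omega" for s unfolding h_def using sm by simp
  obtain x where x: "func x omega omega" "\<And>n. n \<epsilon> omega \<Longrightarrow> x \<cdot> n = h (restrict x n)"
    using cov_rec [OF h1 h2] by blast
  have xe: "x \<cdot> n = \<sigma> \<cdot> restrict x n" if "n \<epsilon> omega" "even_nat n" for n
    unfolding x(2) [OF that(1)] h_def using that restrict_fseq [OF x(1) that(1)] by simp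
  have xo: "x \<cdot> succ (dbl \<cdot> k) = mu (Good (restrict x (succ (dbl \<cdot> k))))" if "k \<epsilon> omega" for k
    unfolding x(2) [OF om_succ [OF dbl_mem [OF that]]] h_def
    using restrict_fseq(2) [OF x(1) om_succ [OF dbl_mem [OF that]]] that by simp
  have step: "Good (restrict x (succ (dbl \<cdot> k))) (x \<cdot> succ (dbl \<cdot> k))"
    if k: "k \<epsilon> omega" and sub: "subset (pos_str \<cdot> restrict x (succ (dbl \<cdot> k))) u" for k
  proof -
    define p where "p = restrict x (succ (dbl \<cdot> k))"
    have p: "p \<epsilon> finite_seqs omega" "dm p = succ (dbl \<cdot> k)"
      unfolding p_def using restrict_fseq [OF x(1) om_succ [OF dbl_mem [OF k]]] .
    have pP: "p \<epsilon> Pos" unfolding Pos isP_def using p k by blast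
    have vk: "v \<cdot> k \<epsilon> num 2" by (rule ap_mem [OF v(1) k])
    obtain j where j: "j \<epsilon> omega" "e \<cdot> j = opair p (v \<cdot> k)" using e(2) [of "opair p (v \<cdot> k)"] pP vk by auto
    have pm: "pos_str \<cdot> p \<epsilon> bin" by (rule pos_str_mem [OF p(1)])
    obtain n where n: "n \<epsilon> omega" "succ j \<epsilon> n" "dm (pos_str \<cdot> p) \<epsilon> n"
      using om_upper2 [OF om_succ [OF j(1)] fseqD(1) [OF pm]] by blast
    have n1: "subset (g \<cdot> succ j) (g \<cdot> n)"
      by (rule chain_mono [OF _ n(1)]) (use gp n in \<open>auto simp: psub_def\<close>)
    have n2: "subset (pos_str \<cdot> p) (g \<cdot> n)"
    proof (rule initial_segments_subset [OF pm gm [OF n(1)] u _ gu [OF n(1)]])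
      show "subset (pos_str \<cdot> p) u" using sub unfolding p_def .
      have "dm (pos_str \<cdot> p) \<epsilon> dm (g \<cdot> n)"
        by (rule lt_le_trans [OF n(3) chain_dm [OF g(1) gp n(1)] fseqD(1) [OF gm [OF n(1)]]])
      then show "dm (pos_str \<cdot> p) \<epsilon> succ (dm (g \<cdot> n))" by simp
    qed
    \<comment> \<open>The string \<open>g \<cdot> n\<close> extends both
      \<open>g \<cdot> succ j\<close> and the string of \<open>p\<close>. This rules out that
      requirement \<open>j\<close> was met by incompatibility.\<close>
    have "\<exists>m. m \<epsilon> omega \<and> move_digit m = v \<cdot> k \<and> subset (pos_str \<cdot> reply p m) (g \<cdot> succ j)"
      using g(3) [OF j(1)] n1 n2 gm [OF n(1)] unfolding Rel_def j(2) pfst_opair psnd_opair by blast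
    then obtain m where m: "m \<epsilon> omega" "move_digit m = v \<cdot> k" "subset (pos_str \<cdot> reply p m) (g \<cdot> succ j)" by blast
    have "Good p m" unfolding Good_def using k p(2) m(2) subset_trans [OF m(3) gu [OF om_succ [OF j(1)]]] by blast
    moreover have "pdef (\<lambda>\<rho>. Good p (\<rho> 0))" by (intro pdef_intros)
    ultimately have "Good p (mu (Good p))" by (rule muI [where Q = "Good p", rotated 2]) (rule m(1))
    then show ?thesis unfolding p_def xo [OF k] .
  qed
  have next_eq: "restrict x (succ (dbl \<cdot> succ k)) = reply (restrict x (succ (dbl \<cdot> k))) (x \<cdot> succ (dbl \<cdot> k))"
    if k: "k \<epsilon> omega" for k
  proof -
    have d: "succ (dbl \<cdot> k) \<epsilon> omega" "dbl \<cdot> succ k \<epsilon> omega" using k by simp_all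
    have a: "restrict x (dbl \<cdot> succ k) = snoc (restrict x (succ (dbl \<cdot> k))) (x \<cdot> succ (dbl \<cdot> k))"
      using restrict_succ [OF x(1) d(1)] k by simp
    have b: "x \<cdot> (dbl \<cdot> succ k) = \<sigma> \<cdot> restrict x (dbl \<cdot> succ k)"
      by (rule xe [OF d(2) even_nat_dbl [OF om_succ [OF k]]])
    show ?thesis unfolding restrict_succ [OF x(1) d(2)] b reply_def a ..
  qed
  have inv: "subset (pos_str \<cdot> restrict x (succ (dbl \<cdot> k))) u" if "k \<epsilon> omega" for k
    using that
  proof (induction k rule: om_induct)
    case def show ?case by (intro pdef_intros)
  next
    case 0
    have r0: "restrict x empty = empty"
      by (rule func_eqI [OF restrict_ap(1) [OF x(1), of empty] func_empty]) simp_all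
    have "restrict x (succ (dbl \<cdot> empty)) = p0"
      unfolding p0_def using restrict_succ [OF x(1) om_0] xe [OF om_0 even_nat_0] r0 by simp
    then show ?case using gu [OF om_0] g(2) by simp
  next
    case (succ k)
    have "Good (restrict x (succ (dbl \<cdot> k))) (x \<cdot> succ (dbl \<cdot> k))" by (rule step [OF succ])
    then show ?case unfolding next_eq [OF succ.hyps] Good_def by blast
  qed
  have "play_digits x = v"
  proof (rule func_eqI [OF play_digits(1) [OF x(1)] v(1)])
    fix k assume k: "k \<epsilon> omega"
    obtain k' where k': "k' \<epsilon> omega" "dm (restrict x (succ (dbl \<cdot> k))) = succ (dbl \<cdot> k')"
      "move_digit (x \<cdot> succ (dbl \<cdot> k)) = v \<cdot> k'"
      using step [OF k inv [OF k]] unfolding Good_def by blast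
    have "k' = k" using k' restrict_fseq(2) [OF x(1) om_succ [OF dbl_mem [OF k]]] dbl_inj [OF k'(1) k] by simp
    then show "play_digits x \<cdot> k = v \<cdot> k" using play_digits(2) [OF x(1) k] k'(3) by simp
  qed
  moreover have "play_real x = u"
  proof (rule func_eqI [OF play_real(1) [OF x(1)] u])
    fix k assume k: "k \<epsilon> omega"
    define p where "p = restrict x (succ (dbl \<cdot> k))"
    have d: "succ (dbl \<cdot> k) \<epsilon> omega" using k by simp
    have pm: "pos_str \<cdot> p \<epsilon> bin" unfolding p_def by (rule pos_str_mem [OF restrict_fseq(1) [OF x(1) d]])
    have kd: "k \<epsilon> dm (pos_str \<cdot> p)" unfolding p_def
      by (rule lt_le_trans [OF le_dbl [OF k] play_real(3) [OF x(1) d] fseqD(1) [OF pm [unfolded p_def]]])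
    show "play_real x \<cdot> k = u \<cdot> k"
      using subset_ap(2) [OF fseqD(2) [OF pm] play_real(1) [OF x(1)] play_real(2) [OF x(1) d, folded p_def] kd]
        subset_ap(2) [OF fseqD(2) [OF pm] u inv [OF k, folded p_def] kd] by simp
  qed
  ultimately show False using win [OF x(1) xe] v(2) by simp
qed

text \<open>
  The positions of a winning strategy of player II, together with a pending extension of the string
  built so far. \<open>S\<close> is the pending string, \<open>W\<close> the string of digits played by
  player II, and \<open>L\<close> the extension relation.
\<close>

definition condition_system :: "'a \<Rightarrow> 'a \<Rightarrow> 'a \<Rightarrow> 'a \<Rightarrow> 'a \<Rightarrow> bool" where
  "condition_system R C S W L \<longleftrightarrow> countable C \<and> (\<exists>\<pi>. \<pi> \<epsilon> C) \<and> func S C bin \<and> func W C bin \<and>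
    (\<forall>\<pi>. \<pi> \<epsilon> C \<longrightarrow> opair \<pi> \<pi> \<epsilon> L) \<and>
    (\<forall>\<pi> \<theta> \<chi>. opair \<pi> \<theta> \<epsilon> L \<longrightarrow> opair \<theta> \<chi> \<epsilon> L \<longrightarrow> opair \<pi> \<chi> \<epsilon> L) \<and>
    (\<forall>\<pi> \<theta>. opair \<pi> \<theta> \<epsilon> L \<longrightarrow> \<pi> \<epsilon> C \<and> \<theta> \<epsilon> C \<and> subset (S \<cdot> \<pi>) (S \<cdot> \<theta>) \<and> subset (W \<cdot> \<pi>) (W \<cdot> \<theta>)) \<and>
    (\<forall>\<pi> a. \<pi> \<epsilon> C \<longrightarrow> a \<epsilon> bin \<longrightarrow> subset (S \<cdot> \<pi>) a \<longrightarrow> (\<exists>\<theta>. opair \<pi> \<theta> \<epsilon> L \<and> S \<cdot> \<theta> = a)) \<and>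
    (\<forall>\<pi>. \<pi> \<epsilon> C \<longrightarrow> (\<exists>\<theta>. opair \<pi> \<theta> \<epsilon> L \<and> dm (W \<cdot> \<pi>) \<epsilon> dm (W \<cdot> \<theta>))) \<and>
    (\<forall>g. func g omega C \<longrightarrow>
      (\<forall>n. n \<epsilon> omega \<longrightarrow> opair (g \<cdot> n) (g \<cdot> succ n) \<epsilon> L \<and> dm (W \<cdot> (g \<cdot> n)) \<epsilon> dm (W \<cdot> (g \<cdot> succ n))) \<longrightarrow>
      (\<exists>u v. func u omega (num 2) \<and> func v omega (num 2) \<and> opair u v \<epsilon> R \<and>
        (\<forall>n. n \<epsilon> omega \<longrightarrow> subset (S \<cdot> (g \<cdot> n)) u \<and> subset (W \<cdot> (g \<cdot> n)) v)))"

section \<open>Conditions from a winning strategy of player II\<close>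

lemma dbl_less: "i \<epsilon> k \<Longrightarrow> k \<epsilon> omega \<Longrightarrow> succ (dbl \<cdot> i) \<epsilon> dbl \<cdot> k"
proof -
  have "k \<epsilon> omega \<Longrightarrow> \<forall>i. i \<epsilon> k \<longrightarrow> succ (dbl \<cdot> i) \<epsilon> dbl \<cdot> k"
  proof (induction k rule: om_induct)
    case def show ?case by (intro pdef_intros)
  qed auto
  then show "i \<epsilon> k \<Longrightarrow> k \<epsilon> omega \<Longrightarrow> succ (dbl \<cdot> i) \<epsilon> dbl \<cdot> k" by blast
qed

lemma restrict_eq_of_subset:
  assumes "p \<epsilon> finite_seqs A" "func x B D" "subset p x" "n \<epsilon> succ (dm p)"
  shows "restrict x n = restrict p n"
proof (rule func_eqI)
  have n: "k \<epsilon> dm p" if "k \<epsilon> n" for k by (rule lt_le_trans [OF that assms(4) fseqD(1) [OF assms(1)]])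
  have n': "k \<epsilon> B" if "k \<epsilon> n" for k by (rule subset_dom [OF fseqD(2) [OF assms(1)] assms(2,3) n [OF that]])
  show "func (restrict x n) n D" by (rule restrict_ap(1) [OF assms(2) n'])
  show "func (restrict p n) n A" by (rule restrict_ap(1) [OF fseqD(2) [OF assms(1)] n])
  fix k assume k: "k \<epsilon> n"
  show "restrict x n \<cdot> k = restrict p n \<cdot> k"
    using restrict_ap(2) [OF assms(2) n' k] restrict_ap(2) [OF fseqD(2) [OF assms(1)] n k]
      subset_ap(2) [OF fseqD(2) [OF assms(1)] assms(2,3) n [OF k]] by simp
qed

lemma restrict_self: "p \<epsilon> finite_seqs A \<Longrightarrow> restrict p (dm p) = p"
  by (rule func_eqI [OF restrict_ap(1) [OF fseqD(2)] fseqD(2)])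
    (simp_all add: restrict_ap(2) [OF fseqD(2)])

text \<open>The \<open>iota\<close> recovers half the length of \<open>p\<close>, which is the
  number of moves of player II in a position of even length.\<close>

definition pos_digits :: "'a \<Rightarrow> 'a" where
  "pos_digits p = Lam (iota (\<lambda>k. k \<epsilon> omega \<and> dm p = dbl \<cdot> k)) (\<lambda>i. move_digit (p \<cdot> succ (dbl \<cdot> i)))"

lemma pterm_pos_digits [pdef_intros]: "pterm t \<Longrightarrow> pterm (\<lambda>\<rho>. pos_digits (t \<rho>))"
  by (rule pterm_subst1 [where f = pos_digits]) (unfold pos_digits_def, intro pdef_intros)

lemma pos_digits:
  assumes p: "p \<epsilon> finite_seqs omega" and k: "k \<epsilon> omega" "dm p = dbl \<cdot> k"
  shows "func (pos_digits p) k (num 2)" and "i \<epsilon> k \<Longrightarrow> pos_digits p \<cdot> i = move_digit (p \<cdot> succ (dbl \<cdot> i))"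
proof -
  have io: "iota (\<lambda>k. k \<epsilon> omega \<and> dm p = dbl \<cdot> k) = k"
    by (rule iota_eq) (use k dbl_inj in auto)
  have pt: "pterm (\<lambda>\<rho>. move_digit (p \<cdot> succ (dbl \<cdot> \<rho> 0)))" by (intro pdef_intros)
  have "p \<cdot> succ (dbl \<cdot> i) \<epsilon> omega" if "i \<epsilon> k" for i
    using ap_mem [OF fseqD(2) [OF p]] dbl_less [OF that k(1)] k(2) by simp
  then show "func (pos_digits p) k (num 2)" unfolding pos_digits_def io
    by (intro func_Lam [OF pt] move_mem(2))
  show "i \<epsilon> k \<Longrightarrow> pos_digits p \<cdot> i = move_digit (p \<cdot> succ (dbl \<cdot> i))"
    unfolding pos_digits_def io by (rule ap_Lam [OF pt])
qed

text \<open>The pending string can be lengthened at will without any move being made. To gain a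
  digit, player I plays the pending string, lengthened by a 0, and \<open>\<tau>\<close>
  answers.\<close>

lemma player_II_conditions:
  assumes \<tau>: "func \<tau> (finite_seqs omega) omega"
    and win: "\<And>x. func x omega omega \<Longrightarrow> (\<And>n. n \<epsilon> omega \<Longrightarrow> \<not> even_nat n \<Longrightarrow> x \<cdot> n = \<tau> \<cdot> restrict x n) \<Longrightarrow>
      opair (play_real x) (play_digits x) \<epsilon> R"
  shows "\<exists>C S W L. condition_system R C S W L"
proof -
  define isP where "isP p \<longleftrightarrow> p \<epsilon> finite_seqs omega \<and> (\<exists>k. k \<epsilon> omega \<and> dm p = dbl \<cdot> k) \<and>
    (\<forall>n. n \<epsilon> dm p \<longrightarrow> \<not> even_nat n \<longrightarrow> p \<cdot> n = \<tau> \<cdot> restrict p n)" for p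
  have isP_pdef [pdef_intros]: "pterm t \<Longrightarrow> pdef (\<lambda>\<rho>. isP (t \<rho>))" for t
    by (rule pdef_subst1 [where P = isP]) (unfold isP_def, intro pdef_intros)
  define isC where "isC \<pi> \<longleftrightarrow> isP (pfst \<pi>) \<and> subset (pos_str \<cdot> pfst \<pi>) (psnd \<pi>)" for \<pi>
  have "pdef (\<lambda>\<rho>. isC (\<rho> 0))" unfolding isC_def by (intro pdef_intros)
  then obtain C where C: "\<And>\<pi>. \<pi> \<epsilon> C \<longleftrightarrow> \<pi> \<epsilon> prod (finite_seqs omega) bin \<and> isC \<pi>"
    using sep_ex [where P = isC] by blast
  \<comment> \<open>When the position changes, the old pending string must have been absorbed by the
    string of the new position. This is what places pending strings inside the limit real.\<close>
  define le where "le \<pi> \<theta> \<longleftrightarrow> subset (pfst \<pi>) (pfst \<theta>) \<and> subset (psnd \<pi>) (psnd \<theta>) \<and>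
    (pfst \<pi> = pfst \<theta> \<or> subset (psnd \<pi>) (pos_str \<cdot> pfst \<theta>))" for \<pi> \<theta>
  have "pdef (\<lambda>\<rho>. le (pfst (\<rho> 0)) (psnd (\<rho> 0)))" unfolding le_def by (intro pdef_intros)
  then obtain L where "\<And>w. w \<epsilon> L \<longleftrightarrow> w \<epsilon> prod C C \<and> le (pfst w) (psnd w)"
    using sep_ex [where P = "\<lambda>w. le (pfst w) (psnd w)"] by blast
  then have L: "opair \<pi> \<theta> \<epsilon> L \<longleftrightarrow> \<pi> \<epsilon> C \<and> \<theta> \<epsilon> C \<and> le \<pi> \<theta>" for \<pi> \<theta> by simp
  define S where "S = Lam C psnd"
  define W where "W = Lam C (\<lambda>\<pi>. pos_digits (pfst \<pi>))"
  have St: "pterm (\<lambda>\<rho>. psnd (\<rho> 0))" and Wt: "pterm (\<lambda>\<rho>. pos_digits (pfst (\<rho> 0)))" by (intro pdef_intros)+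
  have Sv: "S \<cdot> \<pi> = psnd \<pi>" if "\<pi> \<epsilon> C" for \<pi> unfolding S_def by (rule ap_Lam [OF St that])
  have Wv: "W \<cdot> \<pi> = pos_digits (pfst \<pi>)" if "\<pi> \<epsilon> C" for \<pi> unfolding W_def by (rule ap_Lam [OF Wt that])
  have CI: "opair p a \<epsilon> C" if "isP p" "a \<epsilon> bin" "subset (pos_str \<cdot> p) a" for p a
    unfolding C isC_def using that by (simp add: isP_def)
  have CE: "isP (pfst \<pi>) \<and> psnd \<pi> \<epsilon> bin \<and> subset (pos_str \<cdot> pfst \<pi>) (psnd \<pi>) \<and> opair (pfst \<pi>) (psnd \<pi>) = \<pi>" if "\<pi> \<epsilon> C" for \<pi>
    using that unfolding C isC_def by (auto simp: mem_prod)
  have dig: "pos_digits p \<epsilon> bin" if "isP p" for p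
    using that pos_digits(1) [of p] fseqI unfolding isP_def by blast
  have digmono: "subset (pos_digits p) (pos_digits q)" if p: "isP p" and q: "isP q" and pq: "subset p q" for p q
  proof -
    obtain k where k: "k \<epsilon> omega" "dm p = dbl \<cdot> k" using p unfolding isP_def by blast
    obtain l where l: "l \<epsilon> omega" "dm q = dbl \<cdot> l" using q unfolding isP_def by blast
    have pf: "p \<epsilon> finite_seqs omega" and qf: "q \<epsilon> finite_seqs omega" using p q unfolding isP_def by blast+
    note P = pos_digits [OF pf k] and Q = pos_digits [OF qf l]
    have kl: "i \<epsilon> l" if "i \<epsilon> k" for i
    proof -
      have io: "i \<epsilon> omega" using omega_trans [OF k(1) that] .
      have "\<not> l \<epsilon> k"
      proof
        assume "l \<epsilon> k"
        then have "succ (dbl \<cdot> l) \<epsilon> dbl \<cdot> k" by (rule dbl_less [OF _ k(1)])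
        then have "dbl \<cdot> l \<epsilon> dbl \<cdot> k" using om_trans [of "dbl \<cdot> l" "succ (dbl \<cdot> l)"] k(1) by simp
        then show False using subset_fseq_dm [OF pf fseqD(2) [OF qf] pq, of "dbl \<cdot> l"] k(2) l(2) by simp
      qed
      then have "k \<epsilon> succ l" using om_not_mem [OF l(1) k(1)] by blast
      then show ?thesis by (rule lt_le_trans [OF that _ l(1)])
    qed
    show ?thesis
    proof (rule func_subset [OF P(1) Q(1) kl])
      fix i assume i: "i \<epsilon> k"
      have "q \<cdot> succ (dbl \<cdot> i) = p \<cdot> succ (dbl \<cdot> i)"
        by (rule subset_ap(2) [OF fseqD(2) [OF pf] fseqD(2) [OF qf] pq]) (use dbl_less [OF i k(1)] k(2) in simp)
      then show "pos_digits p \<cdot> i = pos_digits q \<cdot> i" using P(2) [OF i] Q(2) [OF kl [OF i]] by simp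
    qed
  qed
  have P0: "isP empty" unfolding isP_def using dbl_0 om_0 dm_empty empty_fseq mem_empty by metis
  have grow: "\<exists>q. isP q \<and> subset p q \<and> psub a (pos_str \<cdot> q) \<and> dm (pos_digits p) \<epsilon> dm (pos_digits q)"
    if p: "isP p" and a: "a \<epsilon> bin" "subset (pos_str \<cdot> p) a" for p a
  proof -
    have pf: "p \<epsilon> finite_seqs omega" using p unfolding isP_def by blast
    obtain k where k: "k \<epsilon> omega" "dm p = dbl \<cdot> k" using p unfolding isP_def by blast
    \<comment> \<open>The pending string may coincide with the string of \<open>p\<close>, while a
      legal move has to extend that string properly.\<close>
    define b where "b = snoc a empty"
    have b: "b \<epsilon> bin" "psub a b" unfolding b_def using snoc_fseq [OF a(1) zero_two] psub_snoc [OF a(1) zero_two] .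
    have pb: "psub (pos_str \<cdot> p) b" by (rule psub_trans [OF pos_str_mem [OF pf] a(1) b(1) a(2) b(2)])
    obtain m where m: "m \<epsilon> omega" "pos_str \<cdot> snoc p m = b"
      using pos_str_choose [OF pf pb b(1) zero_two] by blast
    define q1 where "q1 = snoc p m"
    have q1: "q1 \<epsilon> finite_seqs omega" "dm q1 = succ (dbl \<cdot> k)"
      unfolding q1_def using snoc_fseq [OF pf m(1)] dm_snoc [OF pf m(1)] k(2) by simp_all
    have t: "\<tau> \<cdot> q1 \<epsilon> omega" by (rule ap_mem [OF \<tau> q1(1)])
    define q where "q = snoc q1 (\<tau> \<cdot> q1)"
    have q: "q \<epsilon> finite_seqs omega" "dm q = dbl \<cdot> succ k"
      unfolding q_def using snoc_fseq [OF q1(1) t] dm_snoc [OF q1(1) t] q1(2) k(1) by simp_all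
    have pq: "subset p q" unfolding q_def q1_def by (rule subset_trans [OF subset_snoc subset_snoc])
    have "isP q" unfolding isP_def
    proof (intro conjI allI impI)
      show "q \<epsilon> finite_seqs omega" by (rule q)
      show "\<exists>k. k \<epsilon> omega \<and> dm q = dbl \<cdot> k" using q(2) om_succ [OF k(1)] by blast
      fix n assume n: "n \<epsilon> dm q" "\<not> even_nat n"
      then consider "n \<epsilon> dm p" | "n = dbl \<cdot> k" | "n = dm q1" using q(2) q1(2) k by auto
      then show "q \<cdot> n = \<tau> \<cdot> restrict q n"
      proof cases
        case 1
        have "restrict q n = restrict p n"
          by (rule restrict_eq_of_subset [OF pf fseqD(2) [OF q(1)] pq]) (use 1 in simp)
        then show ?thesis using subset_ap(2) [OF fseqD(2) [OF pf] fseqD(2) [OF q(1)] pq 1] p 1 n(2)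
          unfolding isP_def by simp
      next
        case 2 then show ?thesis using n(2) k(1) by simp
      next
        case 3
        have "restrict q n = restrict q1 n" unfolding 3
          by (rule restrict_eq_of_subset [OF q1(1) fseqD(2) [OF q(1)]]) (simp_all add: q_def)
        then have "restrict q n = q1" using restrict_self [OF q1(1)] 3 by simp
        moreover have "q \<cdot> n = \<tau> \<cdot> q1"
          unfolding q_def 3 by (rule ap_snoc_last [OF fseqD(2) [OF q1(1)] fseqD(1) [OF q1(1)] t])
        ultimately show ?thesis by simp
      qed
    qed
    moreover have "psub a (pos_str \<cdot> q)"
    proof (rule psub_trans [OF a(1) b(1) pos_str_mem [OF q(1)]])
      show "subset a b" using b(2) by (simp add: psub_def)
      show "psub b (pos_str \<cdot> q)" using pos_str_snoc [OF q1(1) t] m(2) unfolding q_def q1_def by simp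
    qed
    moreover have "dm (pos_digits p) \<epsilon> dm (pos_digits q)"
      using dm_func [OF pos_digits(1) [OF pf k]] dm_func [OF pos_digits(1) [OF q(1) om_succ [OF k(1)] q(2)]] by simp
    ultimately show ?thesis using pq by blast
  qed
  have "condition_system R C S W L"
    unfolding condition_system_def
  proof (intro conjI allI impI)
    show "countable C"
      by (rule countable_subset [OF countable_prod [OF countable_fseq_omega countable_bin]]) (simp add: C)
    show "\<exists>\<pi>. \<pi> \<epsilon> C" using CI [OF P0 empty_fseq] by auto
    show "func S C bin" unfolding S_def by (rule func_Lam [OF St]) (use CE in blast)
    show "func W C bin" unfolding W_def by (rule func_Lam [OF Wt]) (use CE dig in blast)
    show "opair \<pi> \<pi> \<epsilon> L" if "\<pi> \<epsilon> C" for \<pi> unfolding L le_def using that by simp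
    show "opair \<pi> \<chi> \<epsilon> L" if a: "opair \<pi> \<theta> \<epsilon> L" and b: "opair \<theta> \<chi> \<epsilon> L" for \<pi> \<theta> \<chi>
    proof -
      have "subset (pfst \<pi>) (pfst \<chi>)" "subset (psnd \<pi>) (psnd \<chi>)"
        using a b subset_trans unfolding L le_def by blast+
      moreover have "pfst \<pi> = pfst \<chi> \<or> subset (psnd \<pi>) (pos_str \<cdot> pfst \<chi>)"
      proof (cases "pfst \<theta> = pfst \<chi>")
        case True then show ?thesis using a unfolding L le_def by simp
      next
        case False
        then have "subset (psnd \<theta>) (pos_str \<cdot> pfst \<chi>)" using b unfolding L le_def by blast
        then show ?thesis using a subset_trans unfolding L le_def by blast
      qed
      ultimately show ?thesis using a b unfolding L le_def by blast
    qed
    show "\<pi> \<epsilon> C" "\<theta> \<epsilon> C" if "opair \<pi> \<theta> \<epsilon> L" for \<pi> \<theta> using that unfolding L by blast+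
    show "subset (S \<cdot> \<pi>) (S \<cdot> \<theta>)" if "opair \<pi> \<theta> \<epsilon> L" for \<pi> \<theta> using that Sv unfolding L le_def by simp
    show "subset (W \<cdot> \<pi>) (W \<cdot> \<theta>)" if "opair \<pi> \<theta> \<epsilon> L" for \<pi> \<theta>
    proof -
      have "subset (pfst \<pi>) (pfst \<theta>)" "\<pi> \<epsilon> C" "\<theta> \<epsilon> C" using that unfolding L le_def by blast+
      then show ?thesis using digmono CE Wv by simp
    qed
    show "\<exists>\<theta>. opair \<pi> \<theta> \<epsilon> L \<and> S \<cdot> \<theta> = a" if \<pi>: "\<pi> \<epsilon> C" and a: "a \<epsilon> bin" "subset (S \<cdot> \<pi>) a" for \<pi> a
    proof -
      have s: "subset (psnd \<pi>) a" using a(2) Sv [OF \<pi>] by simp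
      have "opair (pfst \<pi>) a \<epsilon> C" by (rule CI) (use CE [OF \<pi>] a s subset_trans in blast)+
      moreover have "le \<pi> (opair (pfst \<pi>) a)" unfolding le_def using s by simp
      ultimately show ?thesis using \<pi> Sv unfolding L by (intro exI [of _ "opair (pfst \<pi>) a"]) simp
    qed
    show "\<exists>\<theta>. opair \<pi> \<theta> \<epsilon> L \<and> dm (W \<cdot> \<pi>) \<epsilon> dm (W \<cdot> \<theta>)" if \<pi>: "\<pi> \<epsilon> C" for \<pi>
    proof -
      obtain q where q: "isP q" "subset (pfst \<pi>) q" "psub (psnd \<pi>) (pos_str \<cdot> q)"
        "dm (pos_digits (pfst \<pi>)) \<epsilon> dm (pos_digits q)"
        using grow [of "pfst \<pi>" "psnd \<pi>"] CE [OF \<pi>] by blast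
      have "pos_str \<cdot> q \<epsilon> bin" using pos_str_mem q(1) unfolding isP_def by blast
      then have "opair q (pos_str \<cdot> q) \<epsilon> C" by (rule CI [OF q(1)]) simp
      moreover have "le \<pi> (opair q (pos_str \<cdot> q))" unfolding le_def using q by (simp add: psub_def)
      ultimately show ?thesis using \<pi> q(4) Wv unfolding L by (intro exI [of _ "opair q (pos_str \<cdot> q)"]) simp
    qed
    fix g assume g: "func g omega C" and
      gs: "\<forall>n. n \<epsilon> omega \<longrightarrow> opair (g \<cdot> n) (g \<cdot> succ n) \<epsilon> L \<and> dm (W \<cdot> (g \<cdot> n)) \<epsilon> dm (W \<cdot> (g \<cdot> succ n))"
    have gC: "g \<cdot> n \<epsilon> C" if "n \<epsilon> omega" for n by (rule ap_mem [OF g that])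
    define p where "p = Lam omega (\<lambda>n. pfst (g \<cdot> n))"
    have ptp: "pterm (\<lambda>\<rho>. pfst (g \<cdot> \<rho> 0))" by (intro pdef_intros)
    have pv: "p \<cdot> n = pfst (g \<cdot> n)" if "n \<epsilon> omega" for n unfolding p_def by (rule ap_Lam [OF ptp that])
    have pP: "isP (p \<cdot> n)" if "n \<epsilon> omega" for n using CE [OF gC [OF that]] pv [OF that] by simp
    have pf: "func p omega (finite_seqs omega)" unfolding p_def
      by (rule func_Lam [OF ptp]) (use CE [OF gC] in \<open>auto simp: isP_def\<close>)
    have pm: "p \<cdot> n \<epsilon> finite_seqs omega" if "n \<epsilon> omega" for n by (rule ap_mem [OF pf that])
    have Wp: "W \<cdot> (g \<cdot> n) = pos_digits (p \<cdot> n)" if "n \<epsilon> omega" for n using Wv [OF gC [OF that]] pv [OF that] by simp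
    have ps: "psub (p \<cdot> n) (p \<cdot> succ n)" if n: "n \<epsilon> omega" for n
    proof -
      have n': "succ n \<epsilon> omega" using n by simp
      obtain k where k: "k \<epsilon> omega" "dm (p \<cdot> n) = dbl \<cdot> k" using pP [OF n] unfolding isP_def by blast
      obtain l where l: "l \<epsilon> omega" "dm (p \<cdot> succ n) = dbl \<cdot> l" using pP [OF n'] unfolding isP_def by blast
      have "dm (W \<cdot> (g \<cdot> n)) \<epsilon> dm (W \<cdot> (g \<cdot> succ n))" using gs n by blast
      then have "k \<epsilon> l" unfolding Wp [OF n] Wp [OF n'] dm_func [OF pos_digits(1) [OF pm [OF n] k]]
          dm_func [OF pos_digits(1) [OF pm [OF n'] l]] .
      then have "succ (dbl \<cdot> k) \<epsilon> dbl \<cdot> l" by (rule dbl_less [OF _ l(1)])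
      then have "dbl \<cdot> k \<epsilon> dbl \<cdot> l" using om_trans [of "dbl \<cdot> k" "succ (dbl \<cdot> k)"] l(1) by simp
      moreover have "subset (p \<cdot> n) (p \<cdot> succ n)" using gs n pv [OF n] pv [OF n'] unfolding L le_def by simp
      ultimately show ?thesis unfolding psub_def using k(2) l(2) by simp
    qed
    define x where "x = lim p"
    have x: "func x omega omega" unfolding x_def by (rule func_lim [OF pf ps])
    have px: "subset (p \<cdot> n) x" if "n \<epsilon> omega" for n unfolding x_def by (rule subset_lim [OF pf ps that])
    have pr: "restrict x (dm (p \<cdot> n)) = p \<cdot> n" if "n \<epsilon> omega" for n
      using restrict_eq_of_subset [OF pm [OF that] x px [OF that], of "dm (p \<cdot> n)"] restrict_self [OF pm [OF that]] by simp
    have "x \<cdot> n = \<tau> \<cdot> restrict x n" if n: "n \<epsilon> omega" "\<not> even_nat n" for n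
    proof -
      have n': "succ n \<epsilon> omega" using n by simp
      have nd: "n \<epsilon> dm (p \<cdot> succ n)"
        using chain_dm [OF pf ps n'] om_succ_mono_iff [OF fseqD(1) [OF pm [OF n']] n(1)] by blast
      have "restrict x n = restrict (p \<cdot> succ n) n"
        by (rule restrict_eq_of_subset [OF pm [OF n'] x px [OF n']]) (use nd in simp)
      then show ?thesis
        using subset_ap(2) [OF fseqD(2) [OF pm [OF n']] x px [OF n'] nd] pP [OF n'] nd n(2) unfolding isP_def by simp
    qed
    then have R: "opair (play_real x) (play_digits x) \<epsilon> R" by (rule win [OF x])
    have "subset (S \<cdot> (g \<cdot> n)) (play_real x)" if n: "n \<epsilon> omega" for n
    proof -
      have n': "succ n \<epsilon> omega" using n by simp
      \<comment> \<open>Growth of the digit string forces growth of the position, so the second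
        alternative of \<open>le\<close> applies: the pending string is absorbed at the next
        step.\<close>
      have "p \<cdot> n \<noteq> p \<cdot> succ n" using ps [OF n] unfolding psub_def by auto
      then have 1: "subset (psnd (g \<cdot> n)) (pos_str \<cdot> (p \<cdot> succ n))"
        using gs n pv [OF n] pv [OF n'] unfolding L le_def by auto
      have 2: "subset (pos_str \<cdot> (p \<cdot> succ n)) (play_real x)"
        using play_real(2) [OF x fseqD(1) [OF pm [OF n']]] unfolding pr [OF n'] .
      show ?thesis unfolding Sv [OF gC [OF n]] by (rule subset_trans [OF 1 2])
    qed
    moreover have "subset (W \<cdot> (g \<cdot> n)) (play_digits x)" if n: "n \<epsilon> omega" for n
      unfolding Wp [OF n]
    proof -
      obtain k where k: "k \<epsilon> omega" "dm (p \<cdot> n) = dbl \<cdot> k" using pP [OF n] unfolding isP_def by blast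
      show "subset (pos_digits (p \<cdot> n)) (play_digits x)"
      proof (rule func_subset [OF pos_digits(1) [OF pm [OF n] k] play_digits(1) [OF x]])
        show "i \<epsilon> omega" if "i \<epsilon> k" for i by (rule omega_trans [OF k(1) that])
        fix i assume i: "i \<epsilon> k"
        have "succ (dbl \<cdot> i) \<epsilon> dm (p \<cdot> n)" using dbl_less [OF i k(1)] k(2) by simp
        then show "pos_digits (p \<cdot> n) \<cdot> i = play_digits x \<cdot> i"
          using pos_digits(2) [OF pm [OF n] k i] play_digits(2) [OF x omega_trans [OF k(1) i]]
            subset_ap(2) [OF fseqD(2) [OF pm [OF n]] x px [OF n]] by simp
      qed
    qed
    ultimately show "\<exists>u v. func u omega (num 2) \<and> func v omega (num 2) \<and> opair u v \<epsilon> R \<and>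
        (\<forall>n. n \<epsilon> omega \<longrightarrow> subset (S \<cdot> (g \<cdot> n)) u \<and> subset (W \<cdot> (g \<cdot> n)) v)"
      using R play_real(1) [OF x] play_digits(1) [OF x] by blast
  qed
  then show ?thesis by blast
qed

text \<open>The payoff set of player I consists of the plays whose pair lies outside
  \<open>R\<close>. Totality excludes a winning strategy of player I, so determinacy provides one
  for player II.\<close>

theorem AD_conditions:
  assumes AD: AD and total: "\<And>u. func u omega (num 2) \<Longrightarrow> \<exists>v. func v omega (num 2) \<and> opair u v \<epsilon> R"
  shows "\<exists>C S W L. condition_system R C S W L"
proof -
  have "pdef (\<lambda>\<rho>. \<not> opair (play_real (\<rho> 0)) (play_digits (\<rho> 0)) \<epsilon> R)" by (intro pdef_intros)
  then obtain A where A: "\<And>x. x \<epsilon> A \<longleftrightarrow> x \<epsilon> fun_space omega omega \<and> \<not> opair (play_real x) (play_digits x) \<epsilon> R"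
    using sep_ex [where P = "\<lambda>x. \<not> opair (play_real x) (play_digits x) \<epsilon> R"] by blast
  have res: "app \<sigma> (restrict x n) = \<sigma> \<cdot> restrict x n" if "func \<sigma> (finite_seqs omega) omega" "func x omega omega" "n \<epsilon> omega" for \<sigma> x n
    by (rule app_ap [OF that(1) restrict_fseq(1) [OF that(2,3)]])
  have "determined A" using AD A unfolding AD_def subset_def by blast
  then consider (I) \<sigma> where "strategy \<sigma>" "\<And>x. x \<epsilon> fun_space omega omega \<Longrightarrow> follows_I \<sigma> x \<Longrightarrow> x \<epsilon> A"
    | (II) \<sigma> where "strategy \<sigma>" "\<And>x. x \<epsilon> fun_space omega omega \<Longrightarrow> follows_II \<sigma> x \<Longrightarrow> \<not> x \<epsilon> A"
    unfolding determined_def by blast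
  then show ?thesis
  proof cases
    case I
    have \<sigma>: "func \<sigma> (finite_seqs omega) omega" using I(1) unfolding strategy_def .
    have False
    proof (rule player_I_loses [OF \<sigma> total])
      fix x assume x: "func x omega omega" and f: "\<And>n. n \<epsilon> omega \<Longrightarrow> even_nat n \<Longrightarrow> x \<cdot> n = \<sigma> \<cdot> restrict x n"
      have "follows_I \<sigma> x" unfolding follows_I_def using app_ap [OF x] res [OF \<sigma> x] f by simp
      then show "\<not> opair (play_real x) (play_digits x) \<epsilon> R" using I(2) x A by (simp add: mem_fun_space)
    qed assumption
    then show ?thesis ..
  next
    case II
    have \<sigma>: "func \<sigma> (finite_seqs omega) omega" using II(1) unfolding strategy_def .
    show ?thesis
    proof (rule player_II_conditions [OF \<sigma>])
      fix x assume x: "func x omega omega" and f: "\<And>n. n \<epsilon> omega \<Longrightarrow> \<not> even_nat n \<Longrightarrow> x \<cdot> n = \<sigma> \<cdot> restrict x n"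
      have "follows_II \<sigma> x" unfolding follows_II_def using app_ap [OF x] res [OF \<sigma> x] f by simp
      then show "opair (play_real x) (play_digits x) \<epsilon> R" using II(2) x A by (simp add: mem_fun_space)
    qed
  qed
qed

section \<open>Synchronised runs\<close>

lemma increasing_ge:
  assumes d: "pterm (\<lambda>\<rho>. d (\<rho> 0))" and o: "\<And>n. n \<epsilon> omega \<Longrightarrow> d n \<epsilon> omega"
    and s: "\<And>n. n \<epsilon> omega \<Longrightarrow> d n \<epsilon> d (succ n)" and n: "n \<epsilon> omega"
  shows "n \<epsilon> d (succ n)"
proof -
  have d1 [pdef_intros]: "pterm t \<Longrightarrow> pterm (\<lambda>\<rho>. d (t \<rho>))" for t
    by (rule pterm_subst1 [where f = d]) (use d [unfolded pterm_def] in simp)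
  from n show ?thesis
  proof (induction n rule: om_induct)
    case def show ?case by (intro pdef_intros)
  next
    case 0
    then show ?case using om_zero_cases [OF o [OF om_succ [OF om_0]]] s [OF om_0] by auto
  next
    case (succ n)
    have "succ n \<epsilon> succ (d (succ n))" by (rule om_succ_mono [OF o [OF om_succ [OF succ.hyps]] succ.IH])
    then show ?case by (rule le_lt_trans [OF _ s [OF om_succ [OF succ.hyps]] o [OF om_succ [OF om_succ [OF succ.hyps]]]])
  qed
qed

lemma E0_ap:
  assumes "func x omega A" "func y omega B"
  shows "E0 x y \<longleftrightarrow> (\<exists>n. n \<epsilon> omega \<and> (\<forall>k. k \<epsilon> omega \<and> n \<epsilon> k \<longrightarrow> x \<cdot> k = y \<cdot> k))"
  unfolding E0_def using app_ap [OF assms(1)] app_ap [OF assms(2)] by simp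

end

text \<open>\<open>R_E0\<close> is what the argument uses of the bijection. One direction forces
  digits to agree, the other forces them to differ.\<close>

locale conditions = ZF_model +
  fixes R C S W L
  assumes sys: "condition_system R C S W L"
    and R_E0: "\<And>u v u' v'. opair u v \<epsilon> R \<Longrightarrow> opair u' v' \<epsilon> R \<Longrightarrow> E0 u u' \<longleftrightarrow> E0 v v'"
begin

abbreviation le (infix "\<preceq>" 50) where "\<pi> \<preceq> \<theta> \<equiv> opair \<pi> \<theta> \<epsilon> L"

lemma C_countable: "countable C"
  and C_ex: "\<exists>\<pi>. \<pi> \<epsilon> C"
  and S_func: "func S C bin"
  and W_func: "func W C bin"
  and le_refl: "\<pi> \<epsilon> C \<Longrightarrow> \<pi> \<preceq> \<pi>"
  and le_trans: "\<pi> \<preceq> \<theta> \<Longrightarrow> \<theta> \<preceq> \<chi> \<Longrightarrow> \<pi> \<preceq> \<chi>"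
  and le_C: "\<pi> \<preceq> \<theta> \<Longrightarrow> \<pi> \<epsilon> C" "\<pi> \<preceq> \<theta> \<Longrightarrow> \<theta> \<epsilon> C"
  and le_S: "\<pi> \<preceq> \<theta> \<Longrightarrow> subset (S \<cdot> \<pi>) (S \<cdot> \<theta>)"
  and le_W: "\<pi> \<preceq> \<theta> \<Longrightarrow> subset (W \<cdot> \<pi>) (W \<cdot> \<theta>)"
  and extend: "\<pi> \<epsilon> C \<Longrightarrow> a \<epsilon> bin \<Longrightarrow> subset (S \<cdot> \<pi>) a \<Longrightarrow> \<exists>\<theta>. \<pi> \<preceq> \<theta> \<and> S \<cdot> \<theta> = a"
  and grow: "\<pi> \<epsilon> C \<Longrightarrow> \<exists>\<theta>. \<pi> \<preceq> \<theta> \<and> dm (W \<cdot> \<pi>) \<epsilon> dm (W \<cdot> \<theta>)"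
  and limit: "func g omega C \<Longrightarrow>
      (\<And>n. n \<epsilon> omega \<Longrightarrow> g \<cdot> n \<preceq> g \<cdot> succ n \<and> dm (W \<cdot> (g \<cdot> n)) \<epsilon> dm (W \<cdot> (g \<cdot> succ n))) \<Longrightarrow>
      \<exists>u v. func u omega (num 2) \<and> func v omega (num 2) \<and> opair u v \<epsilon> R \<and>
        (\<forall>n. n \<epsilon> omega \<longrightarrow> subset (S \<cdot> (g \<cdot> n)) u \<and> subset (W \<cdot> (g \<cdot> n)) v)"
  using sys unfolding condition_system_def by blast+

lemma Sb: "\<pi> \<epsilon> C \<Longrightarrow> S \<cdot> \<pi> \<epsilon> bin" by (rule ap_mem [OF S_func])
lemma Wb: "\<pi> \<epsilon> C \<Longrightarrow> W \<cdot> \<pi> \<epsilon> bin" by (rule ap_mem [OF W_func])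

lemma le_S_ap:
  assumes "\<pi> \<preceq> \<theta>" "k \<epsilon> dm (S \<cdot> \<pi>)"
  shows le_S_dm: "k \<epsilon> dm (S \<cdot> \<theta>)" and "S \<cdot> \<theta> \<cdot> k = S \<cdot> \<pi> \<cdot> k"
  using subset_ap [OF fseqD(2) [OF Sb [OF le_C(1) [OF assms(1)]]] fseqD(2) [OF Sb [OF le_C(2) [OF assms(1)]]]
      le_S [OF assms(1)] assms(2)] by blast+

lemma le_W_ap:
  assumes "\<pi> \<preceq> \<theta>" "k \<epsilon> dm (W \<cdot> \<pi>)"
  shows le_W_dm: "k \<epsilon> dm (W \<cdot> \<theta>)" and "W \<cdot> \<theta> \<cdot> k = W \<cdot> \<pi> \<cdot> k"
  using subset_ap [OF fseqD(2) [OF Wb [OF le_C(1) [OF assms(1)]]] fseqD(2) [OF Wb [OF le_C(2) [OF assms(1)]]]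
      le_W [OF assms(1)] assms(2)] by blast+

lemma S_dm_om: "\<pi> \<epsilon> C \<Longrightarrow> dm (S \<cdot> \<pi>) \<epsilon> omega" by (rule fseqD(1) [OF Sb])
lemma W_dm_om: "\<pi> \<epsilon> C \<Longrightarrow> dm (W \<cdot> \<pi>) \<epsilon> omega" by (rule fseqD(1) [OF Wb])

lemma le_W_dm_le: "\<pi> \<preceq> \<theta> \<Longrightarrow> dm (W \<cdot> \<pi>) \<epsilon> succ (dm (W \<cdot> \<theta>))"
  by (rule subset_dm_le [OF Wb [OF le_C(1)] Wb [OF le_C(2)] le_W])

lemma le_S_dm_le: "\<pi> \<preceq> \<theta> \<Longrightarrow> dm (S \<cdot> \<pi>) \<epsilon> succ (dm (S \<cdot> \<theta>))"
  by (rule subset_dm_le [OF Sb [OF le_C(1)] Sb [OF le_C(2)] le_S])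

lemma grow_to:
  assumes "\<pi> \<epsilon> C" "N \<epsilon> omega" shows "\<exists>\<theta>. \<pi> \<preceq> \<theta> \<and> N \<epsilon> dm (W \<cdot> \<theta>)"
  using assms(2)
proof (induction N rule: om_induct)
  case def show ?case by (intro pdef_intros)
next
  case 0
  obtain \<theta> where t: "\<pi> \<preceq> \<theta>" "dm (W \<cdot> \<pi>) \<epsilon> dm (W \<cdot> \<theta>)" using grow [OF assms(1)] by blast
  have "dm (W \<cdot> \<theta>) = empty \<or> empty \<epsilon> dm (W \<cdot> \<theta>)" by (rule om_zero_cases [OF W_dm_om [OF le_C(2) [OF t(1)]]])
  then show ?case using t by auto
next
  case (succ N)
  then obtain \<theta> where t: "\<pi> \<preceq> \<theta>" "N \<epsilon> dm (W \<cdot> \<theta>)" by blast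
  obtain \<chi> where c: "\<theta> \<preceq> \<chi>" "dm (W \<cdot> \<theta>) \<epsilon> dm (W \<cdot> \<chi>)" using grow [OF le_C(2) [OF t(1)]] by blast
  have "succ N \<epsilon> succ (dm (W \<cdot> \<theta>))" by (rule om_succ_mono [OF W_dm_om [OF le_C(2) [OF t(1)]] t(2)])
  then have "succ N \<epsilon> dm (W \<cdot> \<chi>)" by (rule le_lt_trans [OF _ c(2) W_dm_om [OF le_C(2) [OF c(1)]]])
  then show ?case using le_trans [OF t(1) c(1)] by blast
qed

section \<open>Synchronous extensions\<close>

text \<open>Intended for \<open>\<pi>\<close> and \<open>\<theta>\<close> with strings of the same
  length. Only the newly added digits of the strings are compared, so the runs may differ
  arbitrarily below that length; the digits of player II are not compared at all.\<close>

definition sync :: "'a \<Rightarrow> 'a \<Rightarrow> 'a \<Rightarrow> 'a \<Rightarrow> bool" where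
  "sync \<pi> \<theta> \<pi>' \<theta>' \<longleftrightarrow> \<pi> \<preceq> \<pi>' \<and> \<theta> \<preceq> \<theta>' \<and> dm (S \<cdot> \<pi>') = dm (S \<cdot> \<theta>') \<and>
    (\<forall>k. k \<epsilon> dm (S \<cdot> \<pi>') \<longrightarrow> \<not> k \<epsilon> dm (S \<cdot> \<pi>) \<longrightarrow> S \<cdot> \<pi>' \<cdot> k = S \<cdot> \<theta>' \<cdot> k)"

lemma pdef_sync [pdef_intros]:
  "pterm t \<Longrightarrow> pterm u \<Longrightarrow> pterm v \<Longrightarrow> pterm w \<Longrightarrow> pdef (\<lambda>\<rho>. sync (t \<rho>) (u \<rho>) (v \<rho>) (w \<rho>))"
  by (rule pdef_subst4 [where P = sync]) (unfold sync_def, intro pdef_intros)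

lemma sync_refl: "\<pi> \<epsilon> C \<Longrightarrow> \<theta> \<epsilon> C \<Longrightarrow> dm (S \<cdot> \<pi>) = dm (S \<cdot> \<theta>) \<Longrightarrow> sync \<pi> \<theta> \<pi> \<theta>"
  unfolding sync_def using le_refl by blast

lemma sync_le: "sync \<pi> \<theta> \<pi>' \<theta>' \<Longrightarrow> \<pi> \<preceq> \<pi>'" "sync \<pi> \<theta> \<pi>' \<theta>' \<Longrightarrow> \<theta> \<preceq> \<theta>'"
  and sync_dm: "sync \<pi> \<theta> \<pi>' \<theta>' \<Longrightarrow> dm (S \<cdot> \<pi>') = dm (S \<cdot> \<theta>')"
  and sync_ap: "sync \<pi> \<theta> \<pi>' \<theta>' \<Longrightarrow> k \<epsilon> dm (S \<cdot> \<pi>') \<Longrightarrow> \<not> k \<epsilon> dm (S \<cdot> \<pi>) \<Longrightarrow> S \<cdot> \<pi>' \<cdot> k = S \<cdot> \<theta>' \<cdot> k"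
  unfolding sync_def by blast+

lemma sync_sym: "dm (S \<cdot> \<pi>) = dm (S \<cdot> \<theta>) \<Longrightarrow> sync \<pi> \<theta> \<pi>' \<theta>' \<Longrightarrow> sync \<theta> \<pi> \<theta>' \<pi>'"
  unfolding sync_def by auto

lemma sync_trans:
  assumes a: "sync \<pi> \<theta> \<pi>' \<theta>'" and b: "sync \<pi>' \<theta>' \<pi>'' \<theta>''" shows "sync \<pi> \<theta> \<pi>'' \<theta>''"
  unfolding sync_def
proof (intro conjI allI impI)
  show "\<pi> \<preceq> \<pi>''" by (rule le_trans [OF sync_le(1) [OF a] sync_le(1) [OF b]])
  show "\<theta> \<preceq> \<theta>''" by (rule le_trans [OF sync_le(2) [OF a] sync_le(2) [OF b]])
  show "dm (S \<cdot> \<pi>'') = dm (S \<cdot> \<theta>'')" by (rule sync_dm [OF b])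
  fix k assume k: "k \<epsilon> dm (S \<cdot> \<pi>'')" "\<not> k \<epsilon> dm (S \<cdot> \<pi>)"
  show "S \<cdot> \<pi>'' \<cdot> k = S \<cdot> \<theta>'' \<cdot> k"
  proof (cases "k \<epsilon> dm (S \<cdot> \<pi>')")
    case True
    then have "k \<epsilon> dm (S \<cdot> \<theta>')" using sync_dm [OF a] by simp
    then show ?thesis
      using le_S_ap(2) [OF sync_le(1) [OF b] True] le_S_ap(2) [OF sync_le(2) [OF b]] sync_ap [OF a True k(2)] by simp
  next
    case False then show ?thesis by (rule sync_ap [OF b k(1)])
  qed
qed

text \<open>The new digits of \<open>S \<cdot> \<pi>'\<close> are attached to
  \<open>S \<cdot> \<theta>\<close> as a pending string, which \<open>extend\<close> always permits.
  Nothing is claimed about the digits of player II in \<open>\<theta>'\<close>.\<close>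

lemma copy:
  assumes "dm (S \<cdot> \<pi>) = dm (S \<cdot> \<theta>)" "\<pi> \<preceq> \<pi>'" "\<theta> \<epsilon> C" shows "\<exists>\<theta>'. sync \<pi> \<theta> \<pi>' \<theta>'"
proof -
  define t where "t k = (if k \<epsilon> dm (S \<cdot> \<theta>) then S \<cdot> \<theta> \<cdot> k else S \<cdot> \<pi>' \<cdot> k)" for k
  have pt: "pterm (\<lambda>\<rho>. t (\<rho> 0))" unfolding t_def by (intro pdef_intros)
  define a where "a = Lam (dm (S \<cdot> \<pi>')) t"
  have p': "S \<cdot> \<pi>' \<epsilon> bin" by (rule Sb [OF le_C(2) [OF assms(2)]])
  have f: "func a (dm (S \<cdot> \<pi>')) (num 2)" unfolding a_def
  proof (rule func_Lam [OF pt])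
    fix k assume k: "k \<epsilon> dm (S \<cdot> \<pi>')"
    show "t k \<epsilon> num 2"
      using ap_mem [OF fseqD(2) [OF p'] k] ap_mem [OF fseqD(2) [OF Sb [OF assms(3)]], of k] by (simp add: t_def)
  qed
  have v: "a \<cdot> k = t k" if "k \<epsilon> dm (S \<cdot> \<pi>')" for k unfolding a_def by (rule ap_Lam [OF pt that])
  have a: "a \<epsilon> bin" by (rule fseqI [OF f fseqD(1) [OF p']])
  have i: "k \<epsilon> dm (S \<cdot> \<pi>')" if "k \<epsilon> dm (S \<cdot> \<theta>)" for k
    using le_S_dm [OF assms(2)] that assms(1) by simp
  have "subset (S \<cdot> \<theta>) a"
    by (rule func_subset [OF fseqD(2) [OF Sb [OF assms(3)]] f i]) (use v i in \<open>simp_all add: t_def\<close>)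
  then obtain \<theta>' where t': "\<theta> \<preceq> \<theta>'" "S \<cdot> \<theta>' = a" using extend [OF assms(3) a] by blast
  have "sync \<pi> \<theta> \<pi>' \<theta>'"
    unfolding sync_def t'(2) dm_func [OF f] using assms v t'(1) by (simp add: t_def)
  then show ?thesis by blast
qed

lemma copy_cross:
  assumes "sync x y x' y'" "sync x z x' z'" "dm (S \<cdot> x) = dm (S \<cdot> y)"
  shows "sync y z y' z'"
  unfolding sync_def
proof (intro conjI allI impI)
  show "y \<preceq> y'" "z \<preceq> z'" using assms sync_le by blast+
  show "dm (S \<cdot> y') = dm (S \<cdot> z')" using sync_dm [OF assms(1)] sync_dm [OF assms(2)] by simp
  fix k assume "k \<epsilon> dm (S \<cdot> y')" "\<not> k \<epsilon> dm (S \<cdot> y)"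
  then show "S \<cdot> y' \<cdot> k = S \<cdot> z' \<cdot> k"
    using sync_ap [OF assms(1)] sync_ap [OF assms(2)] sync_dm [OF assms(1)] assms(3) by simp
qed

section \<open>Forced agreement and forced difference of digits\<close>

text \<open>Agreement is demanded only where both digit strings are defined, since synchronised runs
  may have digit strings of different lengths.\<close>

definition Good :: "'a \<Rightarrow> 'a \<Rightarrow> 'a \<Rightarrow> bool" where
  "Good \<pi> \<theta> N \<longleftrightarrow> (\<forall>\<pi>' \<theta>'. sync \<pi> \<theta> \<pi>' \<theta>' \<longrightarrow>
    (\<forall>m. \<not> m \<epsilon> N \<longrightarrow> m \<epsilon> dm (W \<cdot> \<pi>') \<longrightarrow> m \<epsilon> dm (W \<cdot> \<theta>') \<longrightarrow> W \<cdot> \<pi>' \<cdot> m = W \<cdot> \<theta>' \<cdot> m))"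

lemma pdef_Good [pdef_intros]:
  "pterm t \<Longrightarrow> pterm u \<Longrightarrow> pterm v \<Longrightarrow> pdef (\<lambda>\<rho>. Good (t \<rho>) (u \<rho>) (v \<rho>))"
  by (rule pdef_subst3 [where P = Good]) (unfold Good_def, intro pdef_intros)

lemma Good_sx: "Good \<pi> \<theta> N \<Longrightarrow> sync \<pi> \<theta> \<pi>' \<theta>' \<Longrightarrow> Good \<pi>' \<theta>' N"
  unfolding Good_def using sync_trans by blast

lemma Good_mono: "Good \<pi> \<theta> N \<Longrightarrow> N \<epsilon> N' \<Longrightarrow> N' \<epsilon> omega \<Longrightarrow> Good \<pi> \<theta> N'"
  unfolding Good_def using om_trans by blast

lemma Good_sym: "dm (S \<cdot> \<pi>) = dm (S \<cdot> \<theta>) \<Longrightarrow> Good \<pi> \<theta> N \<Longrightarrow> Good \<theta> \<pi> N"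
  unfolding Good_def using sync_sym by metis

text \<open>The runs gain digits one after the other, and each time the partner copies the new part
  of the string. The 0 appended at the start makes the strings themselves grow.\<close>

lemma grow2:
  assumes "\<pi> \<epsilon> C" "\<theta> \<epsilon> C" "dm (S \<cdot> \<pi>) = dm (S \<cdot> \<theta>)"
  shows "\<exists>\<pi>' \<theta>'. sync \<pi> \<theta> \<pi>' \<theta>' \<and> dm (W \<cdot> \<pi>) \<epsilon> dm (W \<cdot> \<pi>') \<and> dm (W \<cdot> \<theta>) \<epsilon> dm (W \<cdot> \<theta>') \<and>
    dm (S \<cdot> \<pi>) \<epsilon> dm (S \<cdot> \<pi>')"
proof -
  obtain \<pi>1 where p1: "\<pi> \<preceq> \<pi>1" "S \<cdot> \<pi>1 = snoc (S \<cdot> \<pi>) empty"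
    using extend [OF assms(1) snoc_fseq [OF Sb [OF assms(1)] zero_two] subset_snoc] by blast
  have d1: "dm (S \<cdot> \<pi>) \<epsilon> dm (S \<cdot> \<pi>1)" using dm_snoc [OF Sb [OF assms(1)] zero_two] p1(2) by simp
  obtain \<theta>1 where t1: "sync \<pi> \<theta> \<pi>1 \<theta>1" using copy [OF assms(3) p1(1) assms(2)] by blast
  obtain \<pi>2 where p2: "\<pi>1 \<preceq> \<pi>2" "dm (W \<cdot> \<pi>1) \<epsilon> dm (W \<cdot> \<pi>2)" using grow [OF le_C(2) [OF p1(1)]] by blast
  obtain \<theta>2 where t2: "sync \<pi>1 \<theta>1 \<pi>2 \<theta>2" using copy [OF sync_dm [OF t1] p2(1) le_C(2) [OF sync_le(2) [OF t1]]] by blast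
  obtain \<theta>3 where t3: "\<theta>2 \<preceq> \<theta>3" "dm (W \<cdot> \<theta>2) \<epsilon> dm (W \<cdot> \<theta>3)" using grow [OF le_C(2) [OF sync_le(2) [OF t2]]] by blast
  obtain \<pi>3 where "sync \<theta>2 \<pi>2 \<theta>3 \<pi>3" using copy [OF sync_dm [OF t2, symmetric] t3(1) le_C(2) [OF p2(1)]] by blast
  then have p3: "sync \<pi>2 \<theta>2 \<pi>3 \<theta>3" by (rule sync_sym [OF sync_dm [OF t2, symmetric]])
  have "sync \<pi> \<theta> \<pi>3 \<theta>3" by (rule sync_trans [OF sync_trans [OF t1 t2] p3])
  moreover have "dm (S \<cdot> \<pi>) \<epsilon> dm (S \<cdot> \<pi>3)"
    using le_S_dm [OF sync_le(1) [OF p3] le_S_dm [OF p2(1) d1]] .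
  moreover have "dm (W \<cdot> \<pi>) \<epsilon> dm (W \<cdot> \<pi>3)"
    by (rule le_W_dm [OF sync_le(1) [OF p3]]) (rule le_lt_trans [OF le_W_dm_le [OF p1(1)] p2(2) W_dm_om [OF le_C(2) [OF p2(1)]]])
  moreover have "dm (W \<cdot> \<theta>) \<epsilon> dm (W \<cdot> \<theta>3)"
    by (rule le_lt_trans [OF le_W_dm_le [OF le_trans [OF sync_le(2) [OF t1] sync_le(2) [OF t2]]] t3(2) W_dm_om [OF le_C(2) [OF t3(1)]]])
  ultimately show ?thesis by blast
qed

lemma limit_term:
  assumes c: "pterm (\<lambda>\<rho>. c (\<rho> 0))" and cC: "\<And>n. n \<epsilon> omega \<Longrightarrow> c n \<epsilon> C"
    and st: "\<And>n. n \<epsilon> omega \<Longrightarrow> c n \<preceq> c (succ n) \<and> dm (W \<cdot> c n) \<epsilon> dm (W \<cdot> c (succ n))"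
  shows "\<exists>u v. func u omega (num 2) \<and> func v omega (num 2) \<and> opair u v \<epsilon> R \<and>
    (\<forall>n k. n \<epsilon> omega \<longrightarrow> k \<epsilon> dm (S \<cdot> c n) \<longrightarrow> u \<cdot> k = S \<cdot> c n \<cdot> k) \<and>
    (\<forall>n k. n \<epsilon> omega \<longrightarrow> k \<epsilon> dm (W \<cdot> c n) \<longrightarrow> v \<cdot> k = W \<cdot> c n \<cdot> k) \<and>
    (\<forall>k. k \<epsilon> omega \<longrightarrow> k \<epsilon> dm (W \<cdot> c (succ k)))"
proof -
  define g where "g = Lam omega c"
  have g: "func g omega C" unfolding g_def by (rule func_Lam [OF c cC])
  have gv: "g \<cdot> n = c n" if "n \<epsilon> omega" for n unfolding g_def by (rule ap_Lam [OF c that])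
  obtain u v where uv: "func u omega (num 2)" "func v omega (num 2)" "opair u v \<epsilon> R"
    "\<And>n. n \<epsilon> omega \<Longrightarrow> subset (S \<cdot> (g \<cdot> n)) u \<and> subset (W \<cdot> (g \<cdot> n)) v"
    using limit [OF g] st gv om_succ by metis
  have "u \<cdot> k = S \<cdot> c n \<cdot> k" if "n \<epsilon> omega" "k \<epsilon> dm (S \<cdot> c n)" for n k
    by (rule subset_ap(2) [OF fseqD(2) [OF Sb [OF cC [OF that(1)]]] uv(1) _ that(2)])
      (use uv(4) [OF that(1)] gv [OF that(1)] in simp)
  moreover have "v \<cdot> k = W \<cdot> c n \<cdot> k" if "n \<epsilon> omega" "k \<epsilon> dm (W \<cdot> c n)" for n k
    by (rule subset_ap(2) [OF fseqD(2) [OF Wb [OF cC [OF that(1)]]] uv(2) _ that(2)])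
      (use uv(4) [OF that(1)] gv [OF that(1)] in simp)
  moreover have "k \<epsilon> dm (W \<cdot> c (succ k))" if "k \<epsilon> omega" for k
  proof (rule increasing_ge [where d = "\<lambda>n. dm (W \<cdot> c n)", OF _ W_dm_om [OF cC] _ that])
    have c1 [pdef_intros]: "pterm t \<Longrightarrow> pterm (\<lambda>\<rho>. c (t \<rho>))" for t
      by (rule pterm_subst1 [where f = c]) (use c [unfolded pterm_def] in simp)
    show "pterm (\<lambda>\<rho>. dm (W \<cdot> c (\<rho> 0)))" by (intro pdef_intros)
    show "dm (W \<cdot> c n) \<epsilon> dm (W \<cdot> c (succ n))" if "n \<epsilon> omega" for n using st [OF that] by blast
  qed
  ultimately show ?thesis using uv(1,2,3) by blast
qed

text \<open>Otherwise disagreements of digits could be produced forever by synchronous extensions.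
  In the limit the strings would agree beyond their starting length, hence be E0-equivalent, while
  the digits would differ at arbitrarily large positions, contrary to \<open>R_E0\<close>.\<close>

lemma Good_ex:
  assumes \<pi>: "\<pi> \<epsilon> C" and \<theta>: "\<theta> \<epsilon> C" and dm: "dm (S \<cdot> \<pi>) = dm (S \<cdot> \<theta>)"
  shows "\<exists>\<pi>' \<theta>' N. sync \<pi> \<theta> \<pi>' \<theta>' \<and> N \<epsilon> omega \<and> Good \<pi>' \<theta>' N"
proof (rule ccontr)
  assume no: "\<not> (\<exists>\<pi>' \<theta>' N. sync \<pi> \<theta> \<pi>' \<theta>' \<and> N \<epsilon> omega \<and> Good \<pi>' \<theta>' N)"
  have "pdef (\<lambda>\<rho>. sync \<pi> \<theta> (pfst (\<rho> 0)) (psnd (\<rho> 0)))" by (intro pdef_intros)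
  then obtain T where T: "\<And>q. q \<epsilon> T \<longleftrightarrow> q \<epsilon> prod C C \<and> sync \<pi> \<theta> (pfst q) (psnd q)"
    using sep_ex [where P = "\<lambda>q. sync \<pi> \<theta> (pfst q) (psnd q)"] by blast
  have Tsx: "sync \<pi> \<theta> (pfst q) (psnd q)" "pfst q \<epsilon> C" "psnd q \<epsilon> C" if "q \<epsilon> T" for q
    using that T by (auto simp: mem_prod)
  define Rel where "Rel n q q' \<longleftrightarrow> sync (pfst q) (psnd q) (pfst q') (psnd q') \<and>
    dm (W \<cdot> pfst q) \<epsilon> dm (W \<cdot> pfst q') \<and> dm (W \<cdot> psnd q) \<epsilon> dm (W \<cdot> psnd q') \<and> dm (S \<cdot> pfst q) \<epsilon> dm (S \<cdot> pfst q') \<and>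
    (\<exists>m. \<not> m \<epsilon> n \<and> m \<epsilon> dm (W \<cdot> pfst q') \<and> m \<epsilon> dm (W \<cdot> psnd q') \<and> W \<cdot> pfst q' \<cdot> m \<noteq> W \<cdot> psnd q' \<cdot> m)" for n q q'
  have "\<exists>g. func g omega T \<and> g \<cdot> empty = opair \<pi> \<theta> \<and> (\<forall>n. n \<epsilon> omega \<longrightarrow> Rel n (g \<cdot> n) (g \<cdot> succ n))"
  proof (rule dependent_choice)
    show "countable T" by (rule countable_subset [OF countable_prod [OF C_countable C_countable]]) (simp add: T)
    show "pdef (\<lambda>\<rho>. Rel (\<rho> 0) (\<rho> 1) (\<rho> 2))" unfolding Rel_def by (intro pdef_intros)
    show "opair \<pi> \<theta> \<epsilon> T" unfolding T using sync_refl [OF \<pi> \<theta> dm] \<pi> \<theta> by simp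
    fix n q assume n: "n \<epsilon> omega" and q: "q \<epsilon> T"
    have "\<not> Good (pfst q) (psnd q) n" using no Tsx [OF q] n by blast
    then obtain \<pi>1 \<theta>1 m where 1: "sync (pfst q) (psnd q) \<pi>1 \<theta>1" "\<not> m \<epsilon> n" "m \<epsilon> dm (W \<cdot> \<pi>1)" "m \<epsilon> dm (W \<cdot> \<theta>1)"
      "W \<cdot> \<pi>1 \<cdot> m \<noteq> W \<cdot> \<theta>1 \<cdot> m" unfolding Good_def by blast
    note l1 = sync_le [OF 1(1)]
    obtain \<pi>2 \<theta>2 where 2: "sync \<pi>1 \<theta>1 \<pi>2 \<theta>2" "dm (W \<cdot> \<pi>1) \<epsilon> dm (W \<cdot> \<pi>2)" "dm (W \<cdot> \<theta>1) \<epsilon> dm (W \<cdot> \<theta>2)"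
      "dm (S \<cdot> \<pi>1) \<epsilon> dm (S \<cdot> \<pi>2)"
      using grow2 [OF le_C(2) [OF l1(1)] le_C(2) [OF l1(2)] sync_dm [OF 1(1)]] by blast
    note l2 = sync_le [OF 2(1)]
    have "Rel n q (opair \<pi>2 \<theta>2)"
      unfolding Rel_def pfst_opair psnd_opair
    proof (intro conjI exI [of _ m])
      show "sync (pfst q) (psnd q) \<pi>2 \<theta>2" by (rule sync_trans [OF 1(1) 2(1)])
      show "dm (W \<cdot> pfst q) \<epsilon> dm (W \<cdot> \<pi>2)"
        by (rule le_lt_trans [OF le_W_dm_le [OF l1(1)] 2(2) W_dm_om [OF le_C(2) [OF l2(1)]]])
      show "dm (W \<cdot> psnd q) \<epsilon> dm (W \<cdot> \<theta>2)"
        by (rule le_lt_trans [OF le_W_dm_le [OF l1(2)] 2(3) W_dm_om [OF le_C(2) [OF l2(2)]]])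
      show "dm (S \<cdot> pfst q) \<epsilon> dm (S \<cdot> \<pi>2)"
        by (rule le_lt_trans [OF le_S_dm_le [OF l1(1)] 2(4) S_dm_om [OF le_C(2) [OF l2(1)]]])
      show "\<not> m \<epsilon> n" by (rule 1)
      show "m \<epsilon> dm (W \<cdot> \<pi>2)" "m \<epsilon> dm (W \<cdot> \<theta>2)" using le_W_dm [OF l2(1) 1(3)] le_W_dm [OF l2(2) 1(4)] .
      show "W \<cdot> \<pi>2 \<cdot> m \<noteq> W \<cdot> \<theta>2 \<cdot> m" using le_W_ap(2) [OF l2(1) 1(3)] le_W_ap(2) [OF l2(2) 1(4)] 1(5) by simp
    qed
    moreover have "opair \<pi>2 \<theta>2 \<epsilon> T" unfolding T
      using sync_trans [OF Tsx(1) [OF q] sync_trans [OF 1(1) 2(1)]] le_C(2) [OF l2(1)] le_C(2) [OF l2(2)] by simp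
    ultimately show "\<exists>q'. q' \<epsilon> T \<and> Rel n q q'" by blast
  qed
  then obtain g where g: "func g omega T" "\<And>n. n \<epsilon> omega \<Longrightarrow> Rel n (g \<cdot> n) (g \<cdot> succ n)" by blast
  have gT: "g \<cdot> n \<epsilon> T" if "n \<epsilon> omega" for n by (rule ap_mem [OF g(1) that])
  have c1: "pterm (\<lambda>\<rho>. pfst (g \<cdot> \<rho> 0))" and c2: "pterm (\<lambda>\<rho>. psnd (g \<cdot> \<rho> 0))" by (intro pdef_intros)+
  obtain u v where uv: "func u omega (num 2)" "func v omega (num 2)" "opair u v \<epsilon> R"
    "\<And>n k. n \<epsilon> omega \<Longrightarrow> k \<epsilon> dm (S \<cdot> pfst (g \<cdot> n)) \<Longrightarrow> u \<cdot> k = S \<cdot> pfst (g \<cdot> n) \<cdot> k"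
    "\<And>n k. n \<epsilon> omega \<Longrightarrow> k \<epsilon> dm (W \<cdot> pfst (g \<cdot> n)) \<Longrightarrow> v \<cdot> k = W \<cdot> pfst (g \<cdot> n) \<cdot> k"
    using limit_term [OF c1 Tsx(2) [OF gT]] g(2) sync_le(1) unfolding Rel_def by blast
  obtain u' v' where uv': "func u' omega (num 2)" "func v' omega (num 2)" "opair u' v' \<epsilon> R"
    "\<And>n k. n \<epsilon> omega \<Longrightarrow> k \<epsilon> dm (S \<cdot> psnd (g \<cdot> n)) \<Longrightarrow> u' \<cdot> k = S \<cdot> psnd (g \<cdot> n) \<cdot> k"
    "\<And>n k. n \<epsilon> omega \<Longrightarrow> k \<epsilon> dm (W \<cdot> psnd (g \<cdot> n)) \<Longrightarrow> v' \<cdot> k = W \<cdot> psnd (g \<cdot> n) \<cdot> k"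
    using limit_term [OF c2 Tsx(3) [OF gT]] g(2) sync_le(2) unfolding Rel_def by blast
  have Sg: "k \<epsilon> dm (S \<cdot> pfst (g \<cdot> succ k))" if "k \<epsilon> omega" for k
  proof (rule increasing_ge [where d = "\<lambda>n. dm (S \<cdot> pfst (g \<cdot> n))", OF _ S_dm_om [OF Tsx(2) [OF gT]] _ that])
    show "pterm (\<lambda>\<rho>. dm (S \<cdot> pfst (g \<cdot> \<rho> 0)))" by (intro pdef_intros)
    show "dm (S \<cdot> pfst (g \<cdot> n)) \<epsilon> dm (S \<cdot> pfst (g \<cdot> succ n))" if "n \<epsilon> omega" for n
      using g(2) [OF that] unfolding Rel_def by blast
  qed
  have "E0 u u'"
    unfolding E0_ap [OF uv(1) uv'(1)]
  proof (intro exI [of _ "dm (S \<cdot> \<pi>)"] conjI allI impI)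
    show "dm (S \<cdot> \<pi>) \<epsilon> omega" by (rule S_dm_om [OF \<pi>])
    fix k assume k: "k \<epsilon> omega \<and> dm (S \<cdot> \<pi>) \<epsilon> k"
    have n: "succ k \<epsilon> omega" using k by simp
    note s = Tsx(1) [OF gT [OF n]]
    have kd: "k \<epsilon> dm (S \<cdot> pfst (g \<cdot> succ k))" using Sg k by blast
    have "S \<cdot> pfst (g \<cdot> succ k) \<cdot> k = S \<cdot> psnd (g \<cdot> succ k) \<cdot> k"
      by (rule sync_ap [OF s kd]) (use k mem_asym in blast)
    then show "u \<cdot> k = u' \<cdot> k" using uv(4) [OF n kd] uv'(4) [OF n] kd sync_dm [OF s] by simp
  qed
  then have "E0 v v'" using R_E0 [OF uv(3) uv'(3)] by blast
  then obtain n where n: "n \<epsilon> omega" "\<And>k. k \<epsilon> omega \<Longrightarrow> n \<epsilon> k \<Longrightarrow> v \<cdot> k = v' \<cdot> k"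
    unfolding E0_ap [OF uv(2) uv'(2)] by blast
  have n1: "succ n \<epsilon> omega" and n2: "succ (succ n) \<epsilon> omega" using n(1) by simp_all
  \<comment> \<open>The disagreement produced at stage \<open>n + 1\<close> lies at some
    \<open>m\<close> with \<open>m \<ge> n + 1\<close>, past the bound \<open>n\<close> from which
    on the digits should agree.\<close>
  obtain m where m: "\<not> m \<epsilon> succ n" "m \<epsilon> dm (W \<cdot> pfst (g \<cdot> succ (succ n)))" "m \<epsilon> dm (W \<cdot> psnd (g \<cdot> succ (succ n)))"
    "W \<cdot> pfst (g \<cdot> succ (succ n)) \<cdot> m \<noteq> W \<cdot> psnd (g \<cdot> succ (succ n)) \<cdot> m"
    using g(2) [OF n1] unfolding Rel_def by blast
  have mo: "m \<epsilon> omega" by (rule omega_trans [OF W_dm_om [OF Tsx(2) [OF gT [OF n2]]] m(2)])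
  have "n \<epsilon> m" using om_linear [OF mo n(1)] m(1) by auto
  then show False using n(2) [OF mo] uv(5) [OF n2 m(2)] uv'(5) [OF n2 m(3)] m(4) by simp
qed

text \<open>At every stage 0 is appended in one run and 1 in the other. The limit strings differ
  infinitely often, so by \<open>R_E0\<close> the limit digits differ somewhere beyond
  \<open>N\<close>, and a finite stage already contains such a position.\<close>

lemma differ_ex:
  assumes \<pi>: "\<pi> \<epsilon> C" and \<theta>: "\<theta> \<epsilon> C" and dm: "dm (S \<cdot> \<pi>) = dm (S \<cdot> \<theta>)" and N: "N \<epsilon> omega"
  shows "\<exists>\<pi>' \<theta>' m. \<pi> \<preceq> \<pi>' \<and> \<theta> \<preceq> \<theta>' \<and> dm (S \<cdot> \<pi>') = dm (S \<cdot> \<theta>') \<and> \<not> m \<epsilon> N \<and>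
    m \<epsilon> dm (W \<cdot> \<pi>') \<and> m \<epsilon> dm (W \<cdot> \<theta>') \<and> W \<cdot> \<pi>' \<cdot> m \<noteq> W \<cdot> \<theta>' \<cdot> m"
proof -
  define inT where "inT q \<longleftrightarrow> \<pi> \<preceq> pfst q \<and> \<theta> \<preceq> psnd q \<and> dm (S \<cdot> pfst q) = dm (S \<cdot> psnd q)" for q
  have "pdef (\<lambda>\<rho>. inT (\<rho> 0))" unfolding inT_def by (intro pdef_intros)
  then obtain T where T: "\<And>q. q \<epsilon> T \<longleftrightarrow> q \<epsilon> prod C C \<and> inT q"
    using sep_ex [where P = inT] by blast
  have TC: "pfst q \<epsilon> C" "psnd q \<epsilon> C" if "q \<epsilon> T" for q
    using that T by (auto simp: mem_prod)
  have Tin: "inT q" if "q \<epsilon> T" for q using that T by blast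
  define Rel where "Rel q q' \<longleftrightarrow> pfst q \<preceq> pfst q' \<and> psnd q \<preceq> psnd q' \<and>
    dm (W \<cdot> pfst q) \<epsilon> dm (W \<cdot> pfst q') \<and> dm (W \<cdot> psnd q) \<epsilon> dm (W \<cdot> psnd q') \<and> dm (S \<cdot> pfst q) \<epsilon> dm (S \<cdot> pfst q') \<and>
    S \<cdot> pfst q' \<cdot> dm (S \<cdot> pfst q) \<noteq> S \<cdot> psnd q' \<cdot> dm (S \<cdot> pfst q)" for q q'
  have "\<exists>g. func g omega T \<and> g \<cdot> empty = opair \<pi> \<theta> \<and> (\<forall>n. n \<epsilon> omega \<longrightarrow> Rel (g \<cdot> n) (g \<cdot> succ n))"
  proof (rule dependent_choice [where R = "\<lambda>_. Rel"])
    show "countable T" by (rule countable_subset [OF countable_prod [OF C_countable C_countable]]) (simp add: T)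
    show "pdef (\<lambda>\<rho>. Rel (\<rho> 1) (\<rho> 2))" unfolding Rel_def by (intro pdef_intros)
    show "opair \<pi> \<theta> \<epsilon> T" unfolding T inT_def using le_refl \<pi> \<theta> dm by simp
    fix q assume q: "q \<epsilon> T"
    note qC = TC [OF q]
    have qd: "dm (S \<cdot> pfst q) = dm (S \<cdot> psnd q)" using Tin [OF q] unfolding inT_def by blast
    obtain \<pi>1 where p1: "pfst q \<preceq> \<pi>1" "S \<cdot> \<pi>1 = snoc (S \<cdot> pfst q) empty"
      using extend [OF qC(1) snoc_fseq [OF Sb [OF qC(1)] zero_two] subset_snoc] by blast
    obtain \<theta>1 where t1: "psnd q \<preceq> \<theta>1" "S \<cdot> \<theta>1 = snoc (S \<cdot> psnd q) (succ empty)"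
      using extend [OF qC(2) snoc_fseq [OF Sb [OF qC(2)] one_two] subset_snoc] by blast
    have d1: "dm (S \<cdot> \<pi>1) = succ (dm (S \<cdot> pfst q))" using dm_snoc [OF Sb [OF qC(1)] zero_two] p1(2) by simp
    have d2: "dm (S \<cdot> \<theta>1) = succ (dm (S \<cdot> pfst q))" using dm_snoc [OF Sb [OF qC(2)] one_two] t1(2) qd by simp
    have e1: "S \<cdot> \<pi>1 \<cdot> dm (S \<cdot> pfst q) = empty"
      using ap_snoc_last [OF fseqD(2) [OF Sb [OF qC(1)]] fseqD(1) [OF Sb [OF qC(1)]] zero_two] p1(2) by simp
    have e2: "S \<cdot> \<theta>1 \<cdot> dm (S \<cdot> pfst q) = succ empty"
      using ap_snoc_last [OF fseqD(2) [OF Sb [OF qC(2)]] fseqD(1) [OF Sb [OF qC(2)]] one_two] t1(2) qd by simp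
    obtain \<pi>2 \<theta>2 where 2: "sync \<pi>1 \<theta>1 \<pi>2 \<theta>2" "dm (W \<cdot> \<pi>1) \<epsilon> dm (W \<cdot> \<pi>2)" "dm (W \<cdot> \<theta>1) \<epsilon> dm (W \<cdot> \<theta>2)"
      using grow2 [OF le_C(2) [OF p1(1)] le_C(2) [OF t1(1)]] d1 d2 by auto
    note l2 = sync_le [OF 2(1)]
    have k1: "dm (S \<cdot> pfst q) \<epsilon> dm (S \<cdot> \<pi>1)" and k2: "dm (S \<cdot> pfst q) \<epsilon> dm (S \<cdot> \<theta>1)" using d1 d2 by simp_all
    have "Rel q (opair \<pi>2 \<theta>2)"
      unfolding Rel_def pfst_opair psnd_opair
    proof (intro conjI)
      show "pfst q \<preceq> \<pi>2" by (rule le_trans [OF p1(1) l2(1)])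
      show "psnd q \<preceq> \<theta>2" by (rule le_trans [OF t1(1) l2(2)])
      show "dm (W \<cdot> pfst q) \<epsilon> dm (W \<cdot> \<pi>2)"
        by (rule le_lt_trans [OF le_W_dm_le [OF p1(1)] 2(2) W_dm_om [OF le_C(2) [OF l2(1)]]])
      show "dm (W \<cdot> psnd q) \<epsilon> dm (W \<cdot> \<theta>2)"
        by (rule le_lt_trans [OF le_W_dm_le [OF t1(1)] 2(3) W_dm_om [OF le_C(2) [OF l2(2)]]])
      show "dm (S \<cdot> pfst q) \<epsilon> dm (S \<cdot> \<pi>2)" by (rule le_S_dm [OF l2(1) k1])
      show "S \<cdot> \<pi>2 \<cdot> dm (S \<cdot> pfst q) \<noteq> S \<cdot> \<theta>2 \<cdot> dm (S \<cdot> pfst q)"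
        using le_S_ap(2) [OF l2(1) k1] le_S_ap(2) [OF l2(2) k2] e1 e2 by simp
    qed
    moreover have "opair \<pi>2 \<theta>2 \<epsilon> T"
      using Tin [OF q] le_trans [OF _ le_trans [OF p1(1) l2(1)]] le_trans [OF _ le_trans [OF t1(1) l2(2)]]
        sync_dm [OF 2(1)] le_C(2) [OF l2(1)] le_C(2) [OF l2(2)] unfolding T inT_def by simp
    ultimately show "\<exists>q'. q' \<epsilon> T \<and> Rel q q'" by blast
  qed
  then obtain g where g: "func g omega T" "\<And>n. n \<epsilon> omega \<Longrightarrow> Rel (g \<cdot> n) (g \<cdot> succ n)" by blast
  have gT: "g \<cdot> n \<epsilon> T" if "n \<epsilon> omega" for n by (rule ap_mem [OF g(1) that])
  have c1: "pterm (\<lambda>\<rho>. pfst (g \<cdot> \<rho> 0))" and c2: "pterm (\<lambda>\<rho>. psnd (g \<cdot> \<rho> 0))" by (intro pdef_intros)+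
  obtain u v where uv: "func u omega (num 2)" "func v omega (num 2)" "opair u v \<epsilon> R"
    "\<And>n k. n \<epsilon> omega \<Longrightarrow> k \<epsilon> dm (S \<cdot> pfst (g \<cdot> n)) \<Longrightarrow> u \<cdot> k = S \<cdot> pfst (g \<cdot> n) \<cdot> k"
    "\<And>n k. n \<epsilon> omega \<Longrightarrow> k \<epsilon> dm (W \<cdot> pfst (g \<cdot> n)) \<Longrightarrow> v \<cdot> k = W \<cdot> pfst (g \<cdot> n) \<cdot> k"
    "\<And>k. k \<epsilon> omega \<Longrightarrow> k \<epsilon> dm (W \<cdot> pfst (g \<cdot> succ k))"
    using limit_term [OF c1 TC(1) [OF gT]] g(2) unfolding Rel_def by blast
  obtain u' v' where uv': "func u' omega (num 2)" "func v' omega (num 2)" "opair u' v' \<epsilon> R"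
    "\<And>n k. n \<epsilon> omega \<Longrightarrow> k \<epsilon> dm (S \<cdot> psnd (g \<cdot> n)) \<Longrightarrow> u' \<cdot> k = S \<cdot> psnd (g \<cdot> n) \<cdot> k"
    "\<And>n k. n \<epsilon> omega \<Longrightarrow> k \<epsilon> dm (W \<cdot> psnd (g \<cdot> n)) \<Longrightarrow> v' \<cdot> k = W \<cdot> psnd (g \<cdot> n) \<cdot> k"
    "\<And>k. k \<epsilon> omega \<Longrightarrow> k \<epsilon> dm (W \<cdot> psnd (g \<cdot> succ k))"
    using limit_term [OF c2 TC(2) [OF gT]] g(2) unfolding Rel_def by blast
  have Sg: "k \<epsilon> dm (S \<cdot> pfst (g \<cdot> succ k))" if "k \<epsilon> omega" for k
  proof (rule increasing_ge [where d = "\<lambda>n. dm (S \<cdot> pfst (g \<cdot> n))", OF _ S_dm_om [OF TC(1) [OF gT]] _ that])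
    show "pterm (\<lambda>\<rho>. dm (S \<cdot> pfst (g \<cdot> \<rho> 0)))" by (intro pdef_intros)
    show "dm (S \<cdot> pfst (g \<cdot> n)) \<epsilon> dm (S \<cdot> pfst (g \<cdot> succ n))" if "n \<epsilon> omega" for n
      using g(2) [OF that] unfolding Rel_def by blast
  qed
  have "\<not> E0 u u'"
    unfolding E0_ap [OF uv(1) uv'(1)]
  proof
    assume "\<exists>n. n \<epsilon> omega \<and> (\<forall>k. k \<epsilon> omega \<and> n \<epsilon> k \<longrightarrow> u \<cdot> k = u' \<cdot> k)"
    then obtain n where n: "n \<epsilon> omega" "\<And>k. k \<epsilon> omega \<Longrightarrow> n \<epsilon> k \<Longrightarrow> u \<cdot> k = u' \<cdot> k" by blast
    have n1: "succ n \<epsilon> omega" and n2: "succ (succ n) \<epsilon> omega" using n(1) by simp_all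
    let ?k = "dm (S \<cdot> pfst (g \<cdot> succ n))"
    have k: "?k \<epsilon> omega" by (rule S_dm_om [OF TC(1) [OF gT [OF n1]]])
    note r = g(2) [OF n1, unfolded Rel_def]
    have k1: "?k \<epsilon> dm (S \<cdot> pfst (g \<cdot> succ (succ n)))" using r by blast
    have k2: "?k \<epsilon> dm (S \<cdot> psnd (g \<cdot> succ (succ n)))" using k1 Tin [OF gT [OF n2]] unfolding inT_def by simp
    have "u \<cdot> ?k \<noteq> u' \<cdot> ?k" using r uv(4) [OF n2 k1] uv'(4) [OF n2 k2] by simp
    then show False using n(2) [OF k Sg [OF n(1)]] by simp
  qed
  then have "\<not> E0 v v'" using R_E0 [OF uv(3) uv'(3)] by blast
  then obtain m where m: "m \<epsilon> omega" "N \<epsilon> m" "v \<cdot> m \<noteq> v' \<cdot> m"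
    unfolding E0_ap [OF uv(2) uv'(2)] using N by blast
  have n: "succ m \<epsilon> omega" using m(1) by simp
  have m1: "m \<epsilon> dm (W \<cdot> pfst (g \<cdot> succ m))" and m2: "m \<epsilon> dm (W \<cdot> psnd (g \<cdot> succ m))"
    using uv(6) uv'(6) m(1) by blast+
  have "W \<cdot> pfst (g \<cdot> succ m) \<cdot> m \<noteq> W \<cdot> psnd (g \<cdot> succ m) \<cdot> m" using uv(5) [OF n m1] uv'(5) [OF n m2] m(3) by simp
  then show ?thesis using Tin [OF gT [OF n]] m1 m2 mem_asym [OF m(2)] unfolding inT_def by blast
qed

section \<open>Three runs\<close>

definition same_len3 :: "'a \<Rightarrow> 'a \<Rightarrow> 'a \<Rightarrow> bool" where
  "same_len3 x y z \<longleftrightarrow> x \<epsilon> C \<and> y \<epsilon> C \<and> z \<epsilon> C \<and> dm (S \<cdot> x) = dm (S \<cdot> y) \<and> dm (S \<cdot> x) = dm (S \<cdot> z)"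

definition sync3 :: "'a \<Rightarrow> 'a \<Rightarrow> 'a \<Rightarrow> 'a \<Rightarrow> 'a \<Rightarrow> 'a \<Rightarrow> bool" where
  "sync3 x y z x' y' z' \<longleftrightarrow> sync x y x' y' \<and> sync x z x' z' \<and> sync y z y' z'"

text \<open>The bound \<open>N\<close> plays two parts: the digits below it are decided in all three
  runs, and those from it on agree for any two runs that are extended synchronously.\<close>

definition Good3 :: "'a \<Rightarrow> 'a \<Rightarrow> 'a \<Rightarrow> 'a \<Rightarrow> bool" where
  "Good3 x y z N \<longleftrightarrow> same_len3 x y z \<and> N \<epsilon> omega \<and> Good x y N \<and> Good x z N \<and> Good y z N \<and>
    (\<forall>k. k \<epsilon> N \<longrightarrow> k \<epsilon> dm (W \<cdot> x) \<and> k \<epsilon> dm (W \<cdot> y) \<and> k \<epsilon> dm (W \<cdot> z))"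

lemma pdef_Good3 [pdef_intros]:
  "pterm t \<Longrightarrow> pterm u \<Longrightarrow> pterm v \<Longrightarrow> pterm w \<Longrightarrow> pdef (\<lambda>\<rho>. Good3 (t \<rho>) (u \<rho>) (v \<rho>) (w \<rho>))"
  by (rule pdef_subst4 [where P = Good3]) (unfold Good3_def same_len3_def, intro pdef_intros)

lemma Good3_perm: "Good3 x y z N \<Longrightarrow> Good3 y x z N" "Good3 x y z N \<Longrightarrow> Good3 x z y N"
  unfolding Good3_def same_len3_def using Good_sym by auto

lemma same_len3_perm: "same_len3 x y z \<Longrightarrow> same_len3 y x z" "same_len3 x y z \<Longrightarrow> same_len3 x z y"
  unfolding same_len3_def by auto

lemma sync3_perm:
  assumes "same_len3 x y z" "sync3 x y z x' y' z'" shows "sync3 y x z y' x' z'" "sync3 x z y x' z' y'"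
  using assms sync_sym unfolding same_len3_def sync3_def by auto

lemma sync3_eq3: "sync3 x y z x' y' z' \<Longrightarrow> same_len3 x' y' z'"
  unfolding same_len3_def sync3_def using sync_dm sync_le le_C by blast

lemma sync3_le: "sync3 x y z x' y' z' \<Longrightarrow> x \<preceq> x' \<and> y \<preceq> y' \<and> z \<preceq> z'"
  unfolding sync3_def using sync_le by blast

lemma sync3_trans: "sync3 x y z x' y' z' \<Longrightarrow> sync3 x' y' z' x'' y'' z'' \<Longrightarrow> sync3 x y z x'' y'' z''"
  unfolding sync3_def using sync_trans by blast

lemma sync3_copy:
  assumes "same_len3 x y z" "sync x y x' y'" shows "\<exists>z'. sync3 x y z x' y' z'"
proof -
  obtain z' where "sync x z x' z'" using copy [OF _ sync_le(1) [OF assms(2)]] assms(1) unfolding same_len3_def by blast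
  then show ?thesis unfolding sync3_def using copy_cross [OF assms(2)] assms unfolding same_len3_def by blast
qed

lemma sync3_grow:
  assumes "same_len3 x y z" "N \<epsilon> omega"
  shows "\<exists>x' y' z'. sync3 x y z x' y' z' \<and> N \<epsilon> dm (W \<cdot> x')"
proof -
  obtain x' where x': "x \<preceq> x'" "N \<epsilon> dm (W \<cdot> x')" using grow_to [OF _ assms(2)] assms(1) unfolding same_len3_def by blast
  obtain y' where "sync x y x' y'" using copy [OF _ x'(1)] assms(1) unfolding same_len3_def by blast
  then show ?thesis using sync3_copy [OF assms(1)] x'(2) by blast
qed

lemma sync3_Good:
  assumes "same_len3 x y z"
  shows "\<exists>x' y' z' N. sync3 x y z x' y' z' \<and> N \<epsilon> omega \<and> Good x' y' N"
proof -
  obtain x' y' N where 1: "sync x y x' y'" "N \<epsilon> omega" "Good x' y' N"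
    using Good_ex assms unfolding same_len3_def by blast
  then show ?thesis using sync3_copy [OF assms 1(1)] by blast
qed

text \<open>The three pairs are made good one by one, each time extending all three runs
  synchronously, so that pairs treated earlier stay good. With \<open>N\<close> chosen above all
  thresholds, each run is finally driven to decide its digits below \<open>N\<close>, the others
  copying.\<close>

lemma resync:
  assumes e: "same_len3 x y z" and N0: "N0 \<epsilon> omega"
  shows "\<exists>x' y' z' N. sync3 x y z x' y' z' \<and> Good3 x' y' z' N \<and> N0 \<epsilon> N"
proof -
  obtain x1 y1 z1 N1 where 1: "sync3 x y z x1 y1 z1" "N1 \<epsilon> omega" "Good x1 y1 N1" using sync3_Good [OF e] by blast
  note e1 = sync3_eq3 [OF 1(1)]
  obtain x2 z2 y2 N2 where s2: "sync3 x1 z1 y1 x2 z2 y2" and 2: "N2 \<epsilon> omega" "Good x2 z2 N2"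
    using sync3_Good [OF same_len3_perm(2) [OF e1]] by blast
  note t2 = sync3_perm(2) [OF same_len3_perm(2) [OF e1] s2]
  note e2 = sync3_eq3 [OF t2]
  obtain y3 z3 x3 N3 where s3: "sync3 y2 z2 x2 y3 z3 x3" and 3: "N3 \<epsilon> omega" "Good y3 z3 N3"
    using sync3_Good [OF same_len3_perm(2) [OF same_len3_perm(1) [OF e2]]] by blast
  have t3: "sync3 x2 y2 z2 x3 y3 z3"
    by (rule sync3_perm(1) [OF same_len3_perm(1) [OF e2] sync3_perm(2) [OF same_len3_perm(2) [OF same_len3_perm(1) [OF e2]] s3]])
  note e3 = sync3_eq3 [OF t3]
  obtain M1 where M1: "M1 \<epsilon> omega" "N1 \<epsilon> M1" "N2 \<epsilon> M1" using om_upper2 [OF 1(2) 2(1)] by blast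
  obtain M2 where M2: "M2 \<epsilon> omega" "N3 \<epsilon> M2" "N0 \<epsilon> M2" using om_upper2 [OF 3(1) N0] by blast
  obtain N where N: "N \<epsilon> omega" "M1 \<epsilon> N" "M2 \<epsilon> N" using om_upper2 [OF M1(1) M2(1)] by blast
  have lt: "N0 \<epsilon> N" "N1 \<epsilon> N" "N2 \<epsilon> N" "N3 \<epsilon> N" using om_trans M1 M2 N by blast+
  obtain x4 y4 z4 where t4: "sync3 x3 y3 z3 x4 y4 z4" and w4: "N \<epsilon> dm (W \<cdot> x4)" using sync3_grow [OF e3 N(1)] by blast
  note e4 = sync3_eq3 [OF t4]
  obtain y5 x5 z5 where t5': "sync3 y4 x4 z4 y5 x5 z5" and w5: "N \<epsilon> dm (W \<cdot> y5)" using sync3_grow [OF same_len3_perm(1) [OF e4] N(1)] by blast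
  note t5 = sync3_perm(1) [OF same_len3_perm(1) [OF e4] t5']
  note e5 = sync3_eq3 [OF t5]
  obtain z6 x6 y6 where t6': "sync3 z5 x5 y5 z6 x6 y6" and w6: "N \<epsilon> dm (W \<cdot> z6)"
    using sync3_grow [OF same_len3_perm(1) [OF same_len3_perm(2) [OF e5]] N(1)] by blast
  have t6: "sync3 x5 y5 z5 x6 y6 z6"
    by (rule sync3_perm(2) [OF same_len3_perm(2) [OF e5] sync3_perm(1) [OF same_len3_perm(1) [OF same_len3_perm(2) [OF e5]] t6']])
  have t46: "sync3 x3 y3 z3 x6 y6 z6" by (rule sync3_trans [OF sync3_trans [OF t4 t5] t6])
  have t26: "sync3 x2 y2 z2 x6 y6 z6" by (rule sync3_trans [OF t3 t46])
  have t16: "sync3 x1 y1 z1 x6 y6 z6" by (rule sync3_trans [OF t2 t26])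
  have "sync3 x y z x6 y6 z6" by (rule sync3_trans [OF 1(1) t16])
  moreover have "Good3 x6 y6 z6 N"
    unfolding Good3_def
  proof (intro conjI allI impI)
    show "same_len3 x6 y6 z6" by (rule sync3_eq3 [OF t6])
    show "N \<epsilon> omega" by (rule N)
    show "Good x6 y6 N" by (rule Good_mono [OF Good_sx [OF 1(3)] lt(2) N(1)]) (use t16 in \<open>simp add: sync3_def\<close>)
    show "Good x6 z6 N" by (rule Good_mono [OF Good_sx [OF 2(2)] lt(3) N(1)]) (use t26 in \<open>simp add: sync3_def\<close>)
    show "Good y6 z6 N" by (rule Good_mono [OF Good_sx [OF 3(2)] lt(4) N(1)]) (use t46 in \<open>simp add: sync3_def\<close>)
    fix k assume k: "k \<epsilon> N"
    have l5: "x4 \<preceq> x5" "x5 \<preceq> x6" "y5 \<preceq> y6" using sync3_le [OF t5] sync3_le [OF t6] by blast+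
    have C: "x6 \<epsilon> C" "y6 \<epsilon> C" "z6 \<epsilon> C" using sync3_eq3 [OF t6] unfolding same_len3_def by blast+
    show "k \<epsilon> dm (W \<cdot> x6)" by (rule om_trans [OF k le_W_dm [OF l5(2) le_W_dm [OF l5(1) w4]] W_dm_om [OF C(1)]])
    show "k \<epsilon> dm (W \<cdot> y6)" by (rule om_trans [OF k le_W_dm [OF l5(3) w5] W_dm_om [OF C(2)]])
    show "k \<epsilon> dm (W \<cdot> z6)" by (rule om_trans [OF k w6 W_dm_om [OF C(3)]])
  qed
  ultimately show ?thesis using lt(1) by blast
qed

text \<open>The runs \<open>x\<close> and \<open>y\<close> are extended until some digit from
  \<open>N\<close> on differs, while \<open>z\<close> copies the string of \<open>y\<close>
  throughout. By goodness of \<open>y\<close> and \<open>z\<close> their digits agree on the whole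
  segment \<open>[N, N')\<close>, so there only \<open>x\<close> can be the odd one, and it is so at
  least once.\<close>

lemma stage:
  assumes Good3: "Good3 x y z N"
  shows "\<exists>x' y' z' N'. Good3 x' y' z' N' \<and> x \<preceq> x' \<and> y \<preceq> y' \<and> z \<preceq> z' \<and> N \<epsilon> N' \<and>
    dm (W \<cdot> x) \<epsilon> dm (W \<cdot> x') \<and> dm (W \<cdot> y) \<epsilon> dm (W \<cdot> y') \<and> dm (W \<cdot> z) \<epsilon> dm (W \<cdot> z') \<and>
    (\<forall>k. k \<epsilon> N' \<longrightarrow> \<not> k \<epsilon> N \<longrightarrow> W \<cdot> y' \<cdot> k = W \<cdot> z' \<cdot> k) \<and>
    (\<exists>m. m \<epsilon> N' \<and> \<not> m \<epsilon> N \<and> W \<cdot> x' \<cdot> m \<noteq> W \<cdot> y' \<cdot> m)"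
proof -
  have e: "same_len3 x y z" and N: "N \<epsilon> omega" and G: "Good y z N" using Good3 unfolding Good3_def by blast+
  have d: "x \<epsilon> C" "y \<epsilon> C" "z \<epsilon> C" "dm (S \<cdot> x) = dm (S \<cdot> y)" "dm (S \<cdot> y) = dm (S \<cdot> z)"
    using e unfolding same_len3_def by auto
  obtain x1 y1 m where 1: "x \<preceq> x1" "y \<preceq> y1" "dm (S \<cdot> x1) = dm (S \<cdot> y1)" "\<not> m \<epsilon> N"
    "m \<epsilon> dm (W \<cdot> x1)" "m \<epsilon> dm (W \<cdot> y1)" "W \<cdot> x1 \<cdot> m \<noteq> W \<cdot> y1 \<cdot> m"
    using differ_ex [OF d(1,2,4) N] by blast
  obtain z1 where z1: "sync y z y1 z1" using copy [OF d(5) 1(2) d(3)] by blast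
  have e1: "same_len3 x1 y1 z1" unfolding same_len3_def using 1 z1 sync_dm sync_le le_C by simp blast
  have mo: "m \<epsilon> omega" by (rule omega_trans [OF W_dm_om [OF le_C(2) [OF 1(1)]] 1(5)])
  obtain M1 where M1: "M1 \<epsilon> omega" "m \<epsilon> M1" "N \<epsilon> M1" using om_upper2 [OF mo N] by blast
  \<comment> \<open>The present lengths of the digit strings are put below the new bound as well.
    All three digit strings then grow strictly, as limits of chains require.\<close>
  obtain M2 where M2: "M2 \<epsilon> omega" "dm (W \<cdot> x) \<epsilon> M2" "dm (W \<cdot> y) \<epsilon> M2"
    using om_upper2 [OF W_dm_om [OF d(1)] W_dm_om [OF d(2)]] by blast
  obtain M3 where M3: "M3 \<epsilon> omega" "M2 \<epsilon> M3" "dm (W \<cdot> z) \<epsilon> M3"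
    using om_upper2 [OF M2(1) W_dm_om [OF d(3)]] by blast
  obtain M where M: "M \<epsilon> omega" "M1 \<epsilon> M" "M3 \<epsilon> M" using om_upper2 [OF M1(1) M3(1)] by blast
  obtain x2 y2 z2 N' where 2: "sync3 x1 y1 z1 x2 y2 z2" "Good3 x2 y2 z2 N'" "M \<epsilon> N'" using resync [OF e1 M(1)] by blast
  have N': "N' \<epsilon> omega" using 2(2) unfolding Good3_def by blast
  note l = sync3_le [OF 2(1)]
  have "sync y z y2 z2" by (rule sync_trans [OF z1]) (use 2(1) in \<open>simp add: sync3_def\<close>)
  then have agree: "W \<cdot> y2 \<cdot> k = W \<cdot> z2 \<cdot> k" if "k \<epsilon> N'" "\<not> k \<epsilon> N" for k
    using G 2(2) that unfolding Good_def Good3_def by blast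
  have "W \<cdot> x2 \<cdot> m \<noteq> W \<cdot> y2 \<cdot> m"
    using le_W_ap(2) [OF _ 1(5), of x2] le_W_ap(2) [OF _ 1(6), of y2] l 1(7) by simp
  moreover have "m \<epsilon> N'" "N \<epsilon> N'" "dm (W \<cdot> x) \<epsilon> N'" "dm (W \<cdot> y) \<epsilon> N'" "dm (W \<cdot> z) \<epsilon> N'"
    using om_trans [OF _ 2(3) N'] om_trans [OF _ M(2) M(1)] om_trans [OF _ M(3) M(1)] om_trans [OF _ M3(2,1)] M1 M2 M3
    by blast+
  moreover have "x \<preceq> x2" "y \<preceq> y2" "z \<preceq> z2"
    using le_trans 1 l sync_le(2) [OF z1] by blast+
  ultimately show ?thesis using 2(2) agree 1(4) unfolding Good3_def by blast
qed

end

section \<open>The counter\<close>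

context ZF_model
begin

text \<open>The first argument is the odd one. For three binary digits that are not all equal
  exactly one of the reals is odd.\<close>

definition odd_one :: "'a \<Rightarrow> 'a \<Rightarrow> 'a \<Rightarrow> 'a \<Rightarrow> bool" where
  "odd_one x y z i \<longleftrightarrow> x \<cdot> i \<noteq> y \<cdot> i \<and> y \<cdot> i = z \<cdot> i"

text \<open>The parity test makes a block of positions with the same odd real count once: after a
  climb that real cannot move the counter again before the other one has done so or a reset has
  occurred.\<close>

definition cstep :: "'a \<Rightarrow> 'a \<Rightarrow> 'a \<Rightarrow> 'a \<Rightarrow> 'a \<Rightarrow> 'a" where
  "cstep x y z i k = (if odd_one z x y i then empty
     else if odd_one y x z i \<and> even_nat k \<or> odd_one x y z i \<and> \<not> even_nat k then succ k else k)"

text \<open>The recursion is required on the segment \<open>[N, N')\<close> only and no starting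
  value is fixed, so that statements about consecutive segments can be chained.\<close>

definition count_run :: "'a \<Rightarrow> 'a \<Rightarrow> 'a \<Rightarrow> 'a \<Rightarrow> 'a \<Rightarrow> 'a \<Rightarrow> bool" where
  "count_run x y z c N N' \<longleftrightarrow> (\<forall>i. i \<epsilon> N' \<longrightarrow> \<not> i \<epsilon> N \<longrightarrow> c \<cdot> succ i = cstep x y z i (c \<cdot> i))"

lemma pdef_odd_one [pdef_intros]:
  "pterm t \<Longrightarrow> pterm u \<Longrightarrow> pterm v \<Longrightarrow> pterm w \<Longrightarrow> pdef (\<lambda>\<rho>. odd_one (t \<rho>) (u \<rho>) (v \<rho>) (w \<rho>))"
  unfolding odd_one_def by (intro pdef_intros)

lemma pterm_cstep [pdef_intros]:
  "pterm t \<Longrightarrow> pterm u \<Longrightarrow> pterm v \<Longrightarrow> pterm w \<Longrightarrow> pterm s \<Longrightarrow>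
    pterm (\<lambda>\<rho>. cstep (t \<rho>) (u \<rho>) (v \<rho>) (w \<rho>) (s \<rho>))"
  unfolding cstep_def by (intro pdef_intros)

lemma count_run_split:
  assumes "count_run x y z c N N'" "M \<epsilon> succ N'" "N \<epsilon> succ M" "N' \<epsilon> omega" "M \<epsilon> omega"
  shows "count_run x y z c N M" "count_run x y z c M N'"
proof -
  show "count_run x y z c N M" unfolding count_run_def
  proof (intro allI impI)
    fix i assume i: "i \<epsilon> M" "\<not> i \<epsilon> N"
    have "i \<epsilon> N'" by (rule lt_le_trans [OF i(1) assms(2,4)])
    then show "c \<cdot> succ i = cstep x y z i (c \<cdot> i)" using assms(1) i(2) unfolding count_run_def by blast
  qed
  show "count_run x y z c M N'" unfolding count_run_def
  proof (intro allI impI)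
    fix i assume i: "i \<epsilon> N'" "\<not> i \<epsilon> M"
    have "\<not> i \<epsilon> N" using lt_le_trans [OF _ assms(3,5), of i] i(2) by blast
    then show "c \<cdot> succ i = cstep x y z i (c \<cdot> i)" using assms(1) i(1) unfolding count_run_def by blast
  qed
qed

text \<open>The value is \<open>j\<close> up to and including the first position with
  \<open>T\<close> and \<open>j'\<close> afterwards. This covers a climb, where \<open>j'\<close> is
  the successor of \<open>j\<close> and stable because its parity has changed, as well as a reset,
  where \<open>j'\<close> is 0.\<close>

lemma switch:
  assumes N: "N \<epsilon> omega" "N' \<epsilon> omega" and T: "pdef (\<lambda>\<rho>. T (\<rho> 0))" and start: "c \<cdot> N = j"
    and move: "\<And>i. i \<epsilon> N' \<Longrightarrow> \<not> i \<epsilon> N \<Longrightarrow> T i \<Longrightarrow> c \<cdot> i = j \<Longrightarrow> c \<cdot> succ i = j'"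
    and stay: "\<And>i. i \<epsilon> N' \<Longrightarrow> \<not> i \<epsilon> N \<Longrightarrow> \<not> T i \<Longrightarrow> c \<cdot> succ i = c \<cdot> i"
    and moved: "\<And>i. i \<epsilon> N' \<Longrightarrow> \<not> i \<epsilon> N \<Longrightarrow> c \<cdot> i = j' \<Longrightarrow> c \<cdot> succ i = j'"
    and i: "i \<epsilon> omega" "\<not> i \<epsilon> N" "i \<epsilon> succ N'"
  shows "(c \<cdot> i = j \<and> (\<forall>m. m \<epsilon> i \<longrightarrow> \<not> m \<epsilon> N \<longrightarrow> \<not> T m)) \<or> (c \<cdot> i = j' \<and> (\<exists>m. m \<epsilon> i \<and> \<not> m \<epsilon> N \<and> T m))"
proof -
  have T1 [pdef_intros]: "pterm t \<Longrightarrow> pdef (\<lambda>\<rho>. T (t \<rho>))" for t by (rule pdef_subst1 [where P = T, OF T])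
  have "\<not> i \<epsilon> N \<longrightarrow> i \<epsilon> succ N' \<longrightarrow> (c \<cdot> i = j \<and> (\<forall>m. m \<epsilon> i \<longrightarrow> \<not> m \<epsilon> N \<longrightarrow> \<not> T m)) \<or> (c \<cdot> i = j' \<and> (\<exists>m. m \<epsilon> i \<and> \<not> m \<epsilon> N \<and> T m))"
    using i(1)
  proof (induction i rule: om_induct)
    case def show ?case by (intro pdef_intros)
  next
    case 0 show ?case using om_zero_cases [OF N(1)] start by auto
  next
    case (succ i)
    show ?case
    proof (intro impI)
      assume a: "\<not> succ i \<epsilon> N" "succ i \<epsilon> succ N'"
      have iN': "i \<epsilon> N'" using om_succ_mono_iff [OF N(2) succ.hyps] a(2) by blast
      show "(c \<cdot> succ i = j \<and> (\<forall>m. m \<epsilon> succ i \<longrightarrow> \<not> m \<epsilon> N \<longrightarrow> \<not> T m)) \<or>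
        (c \<cdot> succ i = j' \<and> (\<exists>m. m \<epsilon> succ i \<and> \<not> m \<epsilon> N \<and> T m))"
      proof (cases "i \<epsilon> N")
        case True
        have "succ i \<epsilon> succ N" by (rule om_succ_mono [OF N(1) True])
        then have e: "succ i = N" using a(1) by auto
        show ?thesis unfolding e using start by simp
      next
        case False
        have "i \<epsilon> succ N'" using iN' by simp
        then have IH: "(c \<cdot> i = j \<and> (\<forall>m. m \<epsilon> i \<longrightarrow> \<not> m \<epsilon> N \<longrightarrow> \<not> T m)) \<or> (c \<cdot> i = j' \<and> (\<exists>m. m \<epsilon> i \<and> \<not> m \<epsilon> N \<and> T m))"
          using succ.IH False by blast
        then show ?thesis
        proof
          assume b: "c \<cdot> i = j \<and> (\<forall>m. m \<epsilon> i \<longrightarrow> \<not> m \<epsilon> N \<longrightarrow> \<not> T m)"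
          show ?thesis
          proof (cases "T i")
            case True
            have "c \<cdot> succ i = j'" by (rule move [OF iN' False True]) (use b in blast)
            then show ?thesis using True False mem_succ by blast
          next
            case nT: False
            have "c \<cdot> succ i = j" using stay [OF iN' False nT] b by simp
            then show ?thesis using nT b mem_succ by metis
          qed
        next
          assume b: "c \<cdot> i = j' \<and> (\<exists>m. m \<epsilon> i \<and> \<not> m \<epsilon> N \<and> T m)"
          have "c \<cdot> succ i = j'" by (rule moved [OF iN' False]) (use b in blast)
          then show ?thesis using b mem_succ by blast
        qed
      qed
    qed
  qed
  then show ?thesis using i by blast
qed

end

context conditions
begin

section \<open>The counter along stages\<close>

text \<open>What a stage achieves is stated for arbitrary functions that agree with its digits below
  \<open>N\<close>. The limit reals of the whole construction are such functions, so the statements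
  survive the passage to the limit.\<close>

definition agrees :: "'a \<Rightarrow> 'a \<Rightarrow> 'a \<Rightarrow> 'a \<Rightarrow> 'a \<Rightarrow> 'a \<Rightarrow> 'a \<Rightarrow> bool" where
  "agrees x y z N a b d \<longleftrightarrow> (\<forall>k. k \<epsilon> N \<longrightarrow> a \<cdot> k = W \<cdot> x \<cdot> k \<and> b \<cdot> k = W \<cdot> y \<cdot> k \<and> d \<cdot> k = W \<cdot> z \<cdot> k)"

lemma agrees_perm: "agrees x y z N a b d \<Longrightarrow> agrees y x z N b a d" "agrees x y z N a b d \<Longrightarrow> agrees x z y N a d b"
  unfolding agrees_def by auto

text \<open>By \<open>Good3\<close> the digits below \<open>N\<close> are decided at the earlier
  stage already and do not change later.\<close>

lemma agrees_mono:
  assumes "agrees x' y' z' N' a b d" "Good3 x y z N" "x \<preceq> x'" "y \<preceq> y'" "z \<preceq> z'" "N \<epsilon> succ N'" "N' \<epsilon> omega"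
  shows "agrees x y z N a b d"
  unfolding agrees_def
proof (intro allI impI)
  fix k assume k: "k \<epsilon> N"
  have k': "k \<epsilon> N'" by (rule lt_le_trans [OF k assms(6,7)])
  have w: "k \<epsilon> dm (W \<cdot> x)" "k \<epsilon> dm (W \<cdot> y)" "k \<epsilon> dm (W \<cdot> z)" using assms(2) k unfolding Good3_def by blast+
  show "a \<cdot> k = W \<cdot> x \<cdot> k \<and> b \<cdot> k = W \<cdot> y \<cdot> k \<and> d \<cdot> k = W \<cdot> z \<cdot> k"
    using le_W_ap(2) [OF assms(3) w(1)] le_W_ap(2) [OF assms(4) w(2)] le_W_ap(2) [OF assms(5) w(3)]
      assms(1) k' unfolding agrees_def by simp
qed

lemma stage_agrees:
  assumes "Good3 x y z N"
  shows "\<exists>x' y' z' N'. Good3 x' y' z' N' \<and> x \<preceq> x' \<and> y \<preceq> y' \<and> z \<preceq> z' \<and> N \<epsilon> N' \<and>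
    dm (W \<cdot> x) \<epsilon> dm (W \<cdot> x') \<and> dm (W \<cdot> y) \<epsilon> dm (W \<cdot> y') \<and> dm (W \<cdot> z) \<epsilon> dm (W \<cdot> z') \<and>
    (\<forall>a b d. agrees x' y' z' N' a b d \<longrightarrow> (\<forall>k. k \<epsilon> N' \<longrightarrow> \<not> k \<epsilon> N \<longrightarrow> b \<cdot> k = d \<cdot> k) \<and>
      (\<exists>m. m \<epsilon> N' \<and> \<not> m \<epsilon> N \<and> a \<cdot> m \<noteq> b \<cdot> m))"
proof -
  obtain x' y' z' N' where 1: "Good3 x' y' z' N'" "x \<preceq> x'" "y \<preceq> y'" "z \<preceq> z'" "N \<epsilon> N'"
    "dm (W \<cdot> x) \<epsilon> dm (W \<cdot> x')" "dm (W \<cdot> y) \<epsilon> dm (W \<cdot> y')" "dm (W \<cdot> z) \<epsilon> dm (W \<cdot> z')"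
    "\<And>k. k \<epsilon> N' \<Longrightarrow> \<not> k \<epsilon> N \<Longrightarrow> W \<cdot> y' \<cdot> k = W \<cdot> z' \<cdot> k"
    "\<exists>m. m \<epsilon> N' \<and> \<not> m \<epsilon> N \<and> W \<cdot> x' \<cdot> m \<noteq> W \<cdot> y' \<cdot> m"
    using stage [OF assms] by blast
  have "(\<forall>k. k \<epsilon> N' \<longrightarrow> \<not> k \<epsilon> N \<longrightarrow> b \<cdot> k = d \<cdot> k) \<and> (\<exists>m. m \<epsilon> N' \<and> \<not> m \<epsilon> N \<and> a \<cdot> m \<noteq> b \<cdot> m)"
    if "agrees x' y' z' N' a b d" for a b d
    using that 1(9,10) unfolding agrees_def by metis
  then show ?thesis using 1(1-8) by blast
qed

text \<open>One stage for each unit: the second run is made odd while the counter is even, the first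
  run while it is odd. All quantifiers range over the structure, so the induction is internal and
  reaches nonstandard \<open>j\<close> as well.\<close>

lemma count_to:
  assumes "j \<epsilon> omega"
  shows "\<forall>x y z N. Good3 x y z N \<longrightarrow> (\<exists>x' y' z' N'. Good3 x' y' z' N' \<and> x \<preceq> x' \<and> y \<preceq> y' \<and> z \<preceq> z' \<and> N \<epsilon> succ N' \<and>
    (\<forall>a b d c. agrees x' y' z' N' a b d \<longrightarrow> count_run a b d c N N' \<longrightarrow> c \<cdot> N = empty \<longrightarrow>
      c \<cdot> N' = j \<and> (\<forall>i. i \<epsilon> N' \<longrightarrow> \<not> i \<epsilon> N \<longrightarrow> \<not> odd_one d a b i)))"
  using assms
proof (induction j rule: om_induct)
  case def show ?case unfolding agrees_def count_run_def by (intro pdef_intros)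
next
  case 0
  show ?case
  proof (intro allI impI)
    fix x y z N assume Good3: "Good3 x y z N"
    have "x \<epsilon> C" "y \<epsilon> C" "z \<epsilon> C" using Good3 unfolding Good3_def same_len3_def by blast+
    then have l: "x \<preceq> x" "y \<preceq> y" "z \<preceq> z" using le_refl by blast+
    show "\<exists>x' y' z' N'. Good3 x' y' z' N' \<and> x \<preceq> x' \<and> y \<preceq> y' \<and> z \<preceq> z' \<and> N \<epsilon> succ N' \<and>
      (\<forall>a b d c. agrees x' y' z' N' a b d \<longrightarrow> count_run a b d c N N' \<longrightarrow> c \<cdot> N = empty \<longrightarrow>
        c \<cdot> N' = empty \<and> (\<forall>i. i \<epsilon> N' \<longrightarrow> \<not> i \<epsilon> N \<longrightarrow> \<not> odd_one d a b i))"
      by (intro exI [of _ x] exI [of _ y] exI [of _ z] exI [of _ N]) (use Good3 l in auto)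
  qed
next
  case (succ j)
  show ?case
  proof (intro allI impI)
    fix x y z N assume Good3: "Good3 x y z N"
    obtain x1 y1 z1 N1 where 1: "Good3 x1 y1 z1 N1" "x \<preceq> x1" "y \<preceq> y1" "z \<preceq> z1" "N \<epsilon> succ N1" and
      cnt: "\<And>a b d c. agrees x1 y1 z1 N1 a b d \<Longrightarrow> count_run a b d c N N1 \<Longrightarrow> c \<cdot> N = empty \<Longrightarrow>
      c \<cdot> N1 = j \<and> (\<forall>i. i \<epsilon> N1 \<longrightarrow> \<not> i \<epsilon> N \<longrightarrow> \<not> odd_one d a b i)"
      using succ.IH Good3 by blast
    have N1: "N1 \<epsilon> omega" using 1(1) unfolding Good3_def by blast
    have "\<exists>x2 y2 z2 N2. Good3 x2 y2 z2 N2 \<and> x1 \<preceq> x2 \<and> y1 \<preceq> y2 \<and> z1 \<preceq> z2 \<and> N1 \<epsilon> N2 \<and>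
      (\<forall>a b d. agrees x2 y2 z2 N2 a b d \<longrightarrow> (if even_nat j
        then (\<forall>k. k \<epsilon> N2 \<longrightarrow> \<not> k \<epsilon> N1 \<longrightarrow> a \<cdot> k = d \<cdot> k) \<and> (\<exists>m. m \<epsilon> N2 \<and> \<not> m \<epsilon> N1 \<and> b \<cdot> m \<noteq> a \<cdot> m)
        else (\<forall>k. k \<epsilon> N2 \<longrightarrow> \<not> k \<epsilon> N1 \<longrightarrow> b \<cdot> k = d \<cdot> k) \<and> (\<exists>m. m \<epsilon> N2 \<and> \<not> m \<epsilon> N1 \<and> a \<cdot> m \<noteq> b \<cdot> m)))"
    proof (cases "even_nat j")
      case True
      \<comment> \<open>Applying the stage to the permuted triple makes the second run the odd
        one.\<close>
      obtain y2 x2 z2 N2 where 2: "Good3 y2 x2 z2 N2" "y1 \<preceq> y2" "x1 \<preceq> x2" "z1 \<preceq> z2" "N1 \<epsilon> N2"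
        "\<And>a b d. agrees y2 x2 z2 N2 a b d \<Longrightarrow> (\<forall>k. k \<epsilon> N2 \<longrightarrow> \<not> k \<epsilon> N1 \<longrightarrow> b \<cdot> k = d \<cdot> k) \<and>
          (\<exists>m. m \<epsilon> N2 \<and> \<not> m \<epsilon> N1 \<and> a \<cdot> m \<noteq> b \<cdot> m)"
        using stage_agrees [OF Good3_perm(1) [OF 1(1)]] by blast
      show ?thesis unfolding if_P [OF True]
        using Good3_perm(1) [OF 2(1)] 2(2-5) 2(6) [OF agrees_perm(1)] by blast
    next
      case False
      show ?thesis unfolding if_not_P [OF False] using stage_agrees [OF 1(1)] by blast
    qed
    then obtain x2 y2 z2 N2 where 2: "Good3 x2 y2 z2 N2" "x1 \<preceq> x2" "y1 \<preceq> y2" "z1 \<preceq> z2" "N1 \<epsilon> N2"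
      and seg: "\<And>a b d. agrees x2 y2 z2 N2 a b d \<Longrightarrow> (if even_nat j
        then (\<forall>k. k \<epsilon> N2 \<longrightarrow> \<not> k \<epsilon> N1 \<longrightarrow> a \<cdot> k = d \<cdot> k) \<and> (\<exists>m. m \<epsilon> N2 \<and> \<not> m \<epsilon> N1 \<and> b \<cdot> m \<noteq> a \<cdot> m)
        else (\<forall>k. k \<epsilon> N2 \<longrightarrow> \<not> k \<epsilon> N1 \<longrightarrow> b \<cdot> k = d \<cdot> k) \<and> (\<exists>m. m \<epsilon> N2 \<and> \<not> m \<epsilon> N1 \<and> a \<cdot> m \<noteq> b \<cdot> m))"
      by blast
    have N2: "N2 \<epsilon> omega" using 2(1) unfolding Good3_def by blast
    have N12: "N1 \<epsilon> succ N2" using 2(5) by simp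
    have N02: "N \<epsilon> succ N2" by (rule lt_le_trans [OF 1(5)]) (use om_succ_mono [OF N2 2(5)] N2 in simp_all)
    have "c \<cdot> N2 = succ j \<and> (\<forall>i. i \<epsilon> N2 \<longrightarrow> \<not> i \<epsilon> N \<longrightarrow> \<not> odd_one d a b i)"
      if ag: "agrees x2 y2 z2 N2 a b d" and run: "count_run a b d c N N2" and c0: "c \<cdot> N = empty" for a b d c
    proof -
      note runs = count_run_split [OF run N12 1(5) N2 N1]
      have ag1: "agrees x1 y1 z1 N1 a b d" by (rule agrees_mono [OF ag 1(1) 2(2,3,4) N12 N2])
      have c1: "c \<cdot> N1 = j" and no1: "\<And>i. i \<epsilon> N1 \<Longrightarrow> \<not> i \<epsilon> N \<Longrightarrow> \<not> odd_one d a b i"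
        using cnt [OF ag1 runs(1) c0] by blast+
      have r2: "c \<cdot> succ i = cstep a b d i (c \<cdot> i)" if "i \<epsilon> N2" "\<not> i \<epsilon> N1" for i
        using runs(2) that unfolding count_run_def by blast
      define T where "T i \<longleftrightarrow> a \<cdot> i \<noteq> b \<cdot> i" for i
      have Tp: "pdef (\<lambda>\<rho>. T (\<rho> 0))" unfolding T_def by (intro pdef_intros)
      have ev: "even_nat (succ j) \<longleftrightarrow> \<not> even_nat j" by (rule even_nat_succ [OF succ.hyps])
      have ex: "\<exists>m. m \<epsilon> N2 \<and> \<not> m \<epsilon> N1 \<and> T m" using seg [OF ag] unfolding T_def by (auto split: if_splits)
      have "\<not> N2 \<epsilon> N1" using mem_asym [OF 2(5)] .
      \<comment> \<open>Only the real chosen by the parity of \<open>j\<close> can be odd on this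
        segment. Hence no reset occurs, and a position with \<open>T\<close> moves the counter
        exactly when the parity of its value is that of \<open>j\<close>.\<close>
      have val: "cstep a b d i k = (if T i \<and> (even_nat k \<longleftrightarrow> even_nat j) then succ k else k) \<and> \<not> odd_one d a b i"
        if i: "i \<epsilon> N2" "\<not> i \<epsilon> N1" for i k
      proof (cases "even_nat j")
        case True
        have e: "d \<cdot> i = a \<cdot> i" using seg [OF ag] i unfolding if_P [OF True] by simp
        show ?thesis unfolding cstep_def odd_one_def T_def e using True by auto
      next
        case False
        have e: "d \<cdot> i = b \<cdot> i" using seg [OF ag] i unfolding if_not_P [OF False] by simp
        show ?thesis unfolding cstep_def odd_one_def T_def e using False by auto
      qed
      have sw: "(c \<cdot> N2 = j \<and> (\<forall>m. m \<epsilon> N2 \<longrightarrow> \<not> m \<epsilon> N1 \<longrightarrow> \<not> T m)) \<or> (c \<cdot> N2 = succ j \<and> (\<exists>m. m \<epsilon> N2 \<and> \<not> m \<epsilon> N1 \<and> T m))"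
      proof (rule switch [where T = T, OF N1 N2 Tp c1 _ _ _ N2 \<open>\<not> N2 \<epsilon> N1\<close>])
        fix i assume i: "i \<epsilon> N2" "\<not> i \<epsilon> N1"
        note v = conjunct1 [OF val [OF i]]
        show "c \<cdot> succ i = succ j" if "T i" "c \<cdot> i = j" using r2 [OF i] v that by simp
        show "c \<cdot> succ i = c \<cdot> i" if "\<not> T i" using r2 [OF i] v that by simp
        show "c \<cdot> succ i = succ j" if "c \<cdot> i = succ j" using r2 [OF i] v that ev by simp
      qed simp
      have "\<not> odd_one d a b i" if "i \<epsilon> N2" "\<not> i \<epsilon> N" for i
        using no1 [of i] val [of i] that by (cases "i \<epsilon> N1") blast+
      then show ?thesis using sw ex by blast
    qed
    then show "\<exists>x' y' z' N'. Good3 x' y' z' N' \<and> x \<preceq> x' \<and> y \<preceq> y' \<and> z \<preceq> z' \<and> N \<epsilon> succ N' \<and>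
      (\<forall>a b d c. agrees x' y' z' N' a b d \<longrightarrow> count_run a b d c N N' \<longrightarrow> c \<cdot> N = empty \<longrightarrow>
        c \<cdot> N' = succ j \<and> (\<forall>i. i \<epsilon> N' \<longrightarrow> \<not> i \<epsilon> N \<longrightarrow> \<not> odd_one d a b i))"
      using 2(1) le_trans [OF 1(2) 2(2)] le_trans [OF 1(3) 2(3)] le_trans [OF 1(4) 2(4)] N02 by blast
  qed
qed

text \<open>The third run is made odd. The counter keeps the value it had on entry up to the first
  reset, which reads that value; it is 0 from then on, so further resets of the segment read
  0.\<close>

lemma reset_stage:
  assumes "Good3 x y z N"
  shows "\<exists>x' y' z' N'. Good3 x' y' z' N' \<and> x \<preceq> x' \<and> y \<preceq> y' \<and> z \<preceq> z' \<and> N \<epsilon> N' \<and>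
    (\<forall>a b d. agrees x' y' z' N' a b d \<longrightarrow> (\<exists>i. i \<epsilon> N' \<and> \<not> i \<epsilon> N \<and> odd_one d a b i) \<and>
     (\<forall>c. count_run a b d c N N' \<longrightarrow> c \<cdot> N' = empty \<and>
      (\<forall>i. i \<epsilon> N' \<longrightarrow> \<not> i \<epsilon> N \<longrightarrow> odd_one d a b i \<longrightarrow> c \<cdot> i = empty \<or> c \<cdot> i = c \<cdot> N) \<and>
      (\<exists>i. i \<epsilon> N' \<and> \<not> i \<epsilon> N \<and> odd_one d a b i \<and> c \<cdot> i = c \<cdot> N)))"
proof -
  have N: "N \<epsilon> omega" using assms unfolding Good3_def by blast
  obtain z' x' y' N' where 1: "Good3 z' x' y' N'" "z \<preceq> z'" "x \<preceq> x'" "y \<preceq> y'" "N \<epsilon> N'"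
    and seg: "\<And>a b d. agrees z' x' y' N' a b d \<Longrightarrow> (\<forall>k. k \<epsilon> N' \<longrightarrow> \<not> k \<epsilon> N \<longrightarrow> b \<cdot> k = d \<cdot> k) \<and>
          (\<exists>m. m \<epsilon> N' \<and> \<not> m \<epsilon> N \<and> a \<cdot> m \<noteq> b \<cdot> m)"
    using stage_agrees [OF Good3_perm(1) [OF Good3_perm(2) [OF assms]]] by blast
  have N': "N' \<epsilon> omega" using 1(1) unfolding Good3_def by blast
  have "(\<exists>i. i \<epsilon> N' \<and> \<not> i \<epsilon> N \<and> odd_one d a b i) \<and>
     (\<forall>c. count_run a b d c N N' \<longrightarrow> c \<cdot> N' = empty \<and>
      (\<forall>i. i \<epsilon> N' \<longrightarrow> \<not> i \<epsilon> N \<longrightarrow> odd_one d a b i \<longrightarrow> c \<cdot> i = empty \<or> c \<cdot> i = c \<cdot> N) \<and>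
      (\<exists>i. i \<epsilon> N' \<and> \<not> i \<epsilon> N \<and> odd_one d a b i \<and> c \<cdot> i = c \<cdot> N))"
    if ag: "agrees x' y' z' N' a b d" for a b d
  proof (intro conjI)
    note s = seg [OF agrees_perm(1) [OF agrees_perm(2) [OF ag]]]
    have eq: "a \<cdot> i = b \<cdot> i" if "i \<epsilon> N'" "\<not> i \<epsilon> N" for i using s that by blast
    show ex: "\<exists>i. i \<epsilon> N' \<and> \<not> i \<epsilon> N \<and> odd_one d a b i" using s unfolding odd_one_def by blast
    show "\<forall>c. count_run a b d c N N' \<longrightarrow> c \<cdot> N' = empty \<and>
      (\<forall>i. i \<epsilon> N' \<longrightarrow> \<not> i \<epsilon> N \<longrightarrow> odd_one d a b i \<longrightarrow> c \<cdot> i = empty \<or> c \<cdot> i = c \<cdot> N) \<and>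
      (\<exists>i. i \<epsilon> N' \<and> \<not> i \<epsilon> N \<and> odd_one d a b i \<and> c \<cdot> i = c \<cdot> N)"
    proof (intro allI impI)
      fix c assume run: "count_run a b d c N N'"
      define T where "T i \<longleftrightarrow> odd_one d a b i" for i
      have Tp: "pdef (\<lambda>\<rho>. T (\<rho> 0))" unfolding T_def by (intro pdef_intros)
      have val: "c \<cdot> succ i = (if T i then empty else c \<cdot> i)" if i: "i \<epsilon> N'" "\<not> i \<epsilon> N" for i
        using run i eq [OF i] unfolding count_run_def cstep_def T_def odd_one_def by auto
      have sw: "(c \<cdot> i = c \<cdot> N \<and> (\<forall>m. m \<epsilon> i \<longrightarrow> \<not> m \<epsilon> N \<longrightarrow> \<not> T m)) \<or> (c \<cdot> i = empty \<and> (\<exists>m. m \<epsilon> i \<and> \<not> m \<epsilon> N \<and> T m))"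
        if "i \<epsilon> omega" "\<not> i \<epsilon> N" "i \<epsilon> succ N'" for i
        by (rule switch [where T = T, OF N N' Tp refl _ _ _ that]) (use val in simp_all)
      have "\<not> N' \<epsilon> N" using mem_asym [OF 1(5)] .
      then have c': "c \<cdot> N' = empty" using sw [OF N'] ex unfolding T_def by auto
      have in01: "c \<cdot> i = empty \<or> c \<cdot> i = c \<cdot> N" if "i \<epsilon> N'" "\<not> i \<epsilon> N" for i
        using sw [OF omega_trans [OF N' that(1)] that(2)] that(1) by auto
      obtain i0 where i0: "i0 \<epsilon> N'" "\<not> i0 \<epsilon> N" "T i0" using ex unfolding T_def by blast
      \<comment> \<open>The witness for reading the value on entry is the least reset position of
        the segment.\<close>
      have "pdef (\<lambda>\<rho>. \<rho> 0 \<epsilon> N' \<and> \<not> \<rho> 0 \<epsilon> N \<and> T (\<rho> 0))" by (intro pdef_intros Tp)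
      then obtain i where i: "i \<epsilon> omega" "i \<epsilon> N' \<and> \<not> i \<epsilon> N \<and> T i"
        "\<And>k. k \<epsilon> i \<Longrightarrow> \<not> (k \<epsilon> N' \<and> \<not> k \<epsilon> N \<and> T k)"
        using om_least [where P = "\<lambda>i. i \<epsilon> N' \<and> \<not> i \<epsilon> N \<and> T i", OF _ omega_trans [OF N' i0(1)]] i0 by blast
      have "\<not> (\<exists>m. m \<epsilon> i \<and> \<not> m \<epsilon> N \<and> T m)" using i(2,3) om_trans [OF _ _ N'] by blast
      then have "c \<cdot> i = c \<cdot> N" using sw [OF i(1)] i(2) by auto
      then show "c \<cdot> N' = empty \<and>
        (\<forall>i. i \<epsilon> N' \<longrightarrow> \<not> i \<epsilon> N \<longrightarrow> odd_one d a b i \<longrightarrow> c \<cdot> i = empty \<or> c \<cdot> i = c \<cdot> N) \<and>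
        (\<exists>i. i \<epsilon> N' \<and> \<not> i \<epsilon> N \<and> odd_one d a b i \<and> c \<cdot> i = c \<cdot> N)"
        using c' in01 i(2) unfolding T_def by blast
    qed
  qed
  then show ?thesis using Good3_perm(2) [OF Good3_perm(1) [OF 1(1)]] 1(2-5) by blast
qed

text \<open>
  The initial stage, with the first real odd, leaves the counter at 0; it is there to make all
  three pairs of reals differ infinitely often, whatever the values of \<open>j\<close> are.
\<close>

lemma round:
  assumes Good3: "Good3 x y z N" and j: "j \<epsilon> omega"
  shows "\<exists>x' y' z' N'. Good3 x' y' z' N' \<and> x \<preceq> x' \<and> y \<preceq> y' \<and> z \<preceq> z' \<and> N \<epsilon> N' \<and>
    dm (W \<cdot> x) \<epsilon> dm (W \<cdot> x') \<and> dm (W \<cdot> y) \<epsilon> dm (W \<cdot> y') \<and> dm (W \<cdot> z) \<epsilon> dm (W \<cdot> z') \<and>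
    (\<forall>a b d. agrees x' y' z' N' a b d \<longrightarrow>
      (\<exists>i. i \<epsilon> N' \<and> \<not> i \<epsilon> N \<and> odd_one a b d i) \<and> (\<exists>i. i \<epsilon> N' \<and> \<not> i \<epsilon> N \<and> odd_one d a b i) \<and>
      (\<forall>c. count_run a b d c N N' \<longrightarrow> c \<cdot> N = empty \<longrightarrow> c \<cdot> N' = empty \<and>
        (\<forall>i. i \<epsilon> N' \<longrightarrow> \<not> i \<epsilon> N \<longrightarrow> odd_one d a b i \<longrightarrow> c \<cdot> i = empty \<or> c \<cdot> i = j) \<and>
        (\<exists>i. i \<epsilon> N' \<and> \<not> i \<epsilon> N \<and> odd_one d a b i \<and> c \<cdot> i = j)))"
proof -
  have N: "N \<epsilon> omega" using Good3 unfolding Good3_def by blast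
  obtain x1 y1 z1 N1 where 1: "Good3 x1 y1 z1 N1" "x \<preceq> x1" "y \<preceq> y1" "z \<preceq> z1" "N \<epsilon> N1"
    "dm (W \<cdot> x) \<epsilon> dm (W \<cdot> x1)" "dm (W \<cdot> y) \<epsilon> dm (W \<cdot> y1)" "dm (W \<cdot> z) \<epsilon> dm (W \<cdot> z1)"
    and seg1: "\<And>a b d. agrees x1 y1 z1 N1 a b d \<Longrightarrow> (\<forall>k. k \<epsilon> N1 \<longrightarrow> \<not> k \<epsilon> N \<longrightarrow> b \<cdot> k = d \<cdot> k) \<and>
          (\<exists>m. m \<epsilon> N1 \<and> \<not> m \<epsilon> N \<and> a \<cdot> m \<noteq> b \<cdot> m)"
    using stage_agrees [OF Good3] by blast
  have N1: "N1 \<epsilon> omega" using 1(1) unfolding Good3_def by blast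
  obtain x2 y2 z2 N2 where 2: "Good3 x2 y2 z2 N2" "x1 \<preceq> x2" "y1 \<preceq> y2" "z1 \<preceq> z2" "N1 \<epsilon> succ N2"
    and seg2: "\<And>a b d c. agrees x2 y2 z2 N2 a b d \<Longrightarrow> count_run a b d c N1 N2 \<Longrightarrow> c \<cdot> N1 = empty \<Longrightarrow>
      c \<cdot> N2 = j \<and> (\<forall>i. i \<epsilon> N2 \<longrightarrow> \<not> i \<epsilon> N1 \<longrightarrow> \<not> odd_one d a b i)"
    using count_to [OF j] 1(1) by blast
  have N2: "N2 \<epsilon> omega" using 2(1) unfolding Good3_def by blast
  obtain x3 y3 z3 N3 where 3: "Good3 x3 y3 z3 N3" "x2 \<preceq> x3" "y2 \<preceq> y3" "z2 \<preceq> z3" "N2 \<epsilon> N3"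
    and seg3: "\<And>a b d. agrees x3 y3 z3 N3 a b d \<Longrightarrow> (\<exists>i. i \<epsilon> N3 \<and> \<not> i \<epsilon> N2 \<and> odd_one d a b i) \<and>
     (\<forall>c. count_run a b d c N2 N3 \<longrightarrow> c \<cdot> N3 = empty \<and>
      (\<forall>i. i \<epsilon> N3 \<longrightarrow> \<not> i \<epsilon> N2 \<longrightarrow> odd_one d a b i \<longrightarrow> c \<cdot> i = empty \<or> c \<cdot> i = c \<cdot> N2) \<and>
      (\<exists>i. i \<epsilon> N3 \<and> \<not> i \<epsilon> N2 \<and> odd_one d a b i \<and> c \<cdot> i = c \<cdot> N2))"
    using reset_stage [OF 2(1)] by blast
  have N3: "N3 \<epsilon> omega" using 3(1) unfolding Good3_def by blast
  have N02: "N \<epsilon> N2" by (rule lt_le_trans [OF 1(5) 2(5) N2])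
  have N03: "N \<epsilon> N3" by (rule om_trans [OF N02 3(5) N3])
  have N13: "N1 \<epsilon> N3" by (rule le_lt_trans [OF 2(5) 3(5) N3])
  have l13: "x1 \<preceq> x3" "y1 \<preceq> y3" "z1 \<preceq> z3" using le_trans 2 3 by blast+
  have sub1: "i \<epsilon> N3" if "i \<epsilon> N1" for i by (rule om_trans [OF that N13 N3])
  have sub2: "\<not> i \<epsilon> N" if "\<not> i \<epsilon> N2" for i using that om_trans [OF _ N02 N2] by blast
  have body: "(\<exists>i. i \<epsilon> N3 \<and> \<not> i \<epsilon> N \<and> odd_one a b d i) \<and> (\<exists>i. i \<epsilon> N3 \<and> \<not> i \<epsilon> N \<and> odd_one d a b i) \<and>
      (\<forall>c. count_run a b d c N N3 \<longrightarrow> c \<cdot> N = empty \<longrightarrow> c \<cdot> N3 = empty \<and>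
        (\<forall>i. i \<epsilon> N3 \<longrightarrow> \<not> i \<epsilon> N \<longrightarrow> odd_one d a b i \<longrightarrow> c \<cdot> i = empty \<or> c \<cdot> i = j) \<and>
        (\<exists>i. i \<epsilon> N3 \<and> \<not> i \<epsilon> N \<and> odd_one d a b i \<and> c \<cdot> i = j))"
    if ag: "agrees x3 y3 z3 N3 a b d" for a b d
  proof (intro conjI)
    have ag2: "agrees x2 y2 z2 N2 a b d" by (rule agrees_mono [OF ag 2(1) 3(2,3,4) _ N3]) (use 3(5) in simp)
    have ag1: "agrees x1 y1 z1 N1 a b d" by (rule agrees_mono [OF ag 1(1) l13 _ N3]) (use N13 in simp)
    note s1 = seg1 [OF ag1] and s3 = seg3 [OF ag]
    show "\<exists>i. i \<epsilon> N3 \<and> \<not> i \<epsilon> N \<and> odd_one a b d i" using s1 sub1 unfolding odd_one_def by blast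
    show "\<exists>i. i \<epsilon> N3 \<and> \<not> i \<epsilon> N \<and> odd_one d a b i" using s3 sub2 by blast
    show "\<forall>c. count_run a b d c N N3 \<longrightarrow> c \<cdot> N = empty \<longrightarrow> c \<cdot> N3 = empty \<and>
        (\<forall>i. i \<epsilon> N3 \<longrightarrow> \<not> i \<epsilon> N \<longrightarrow> odd_one d a b i \<longrightarrow> c \<cdot> i = empty \<or> c \<cdot> i = j) \<and>
        (\<exists>i. i \<epsilon> N3 \<and> \<not> i \<epsilon> N \<and> odd_one d a b i \<and> c \<cdot> i = j)"
    proof (intro allI impI)
      fix c assume run: "count_run a b d c N N3" and c0: "c \<cdot> N = empty"
      have run2: "count_run a b d c N N2" and run23: "count_run a b d c N2 N3"
        using count_run_split [OF run _ _ N3 N2] 3(5) N02 by simp_all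
      have run1: "count_run a b d c N N1" and run12: "count_run a b d c N1 N2"
        using count_run_split [OF run2 2(5) _ N2 N1] 1(5) by simp_all
      \<comment> \<open>Only the first real can be odd on this segment, and it moves the counter
        from odd values only; hence 0 persists.\<close>
      have val: "c \<cdot> succ i = empty" if "c \<cdot> i = empty" "i \<epsilon> N1" "\<not> i \<epsilon> N" for i
        using run1 that s1 unfolding count_run_def cstep_def odd_one_def by auto
      have "\<not> N1 \<epsilon> N" by (rule mem_asym [OF 1(5)])
      have aux: "i \<epsilon> omega \<Longrightarrow> \<not> i \<epsilon> N \<longrightarrow> i \<epsilon> succ N1 \<longrightarrow> c \<cdot> i = empty" for i
      proof (induction i rule: om_induct)
        case def show ?case by (intro pdef_intros)
      next
        case 0 show ?case using om_zero_cases [OF N] c0 by auto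
      next
        case (succ i)
        show ?case
        proof (intro impI)
          assume a: "\<not> succ i \<epsilon> N" "succ i \<epsilon> succ N1"
          have iN: "i \<epsilon> N1" using om_succ_mono_iff [OF N1 succ.hyps] a(2) by blast
          show "c \<cdot> succ i = empty"
          proof (cases "i \<epsilon> N")
            case True
            then have "succ i = N" using om_succ_mono [OF N True] a(1) by auto
            then show ?thesis using c0 by simp
          next
            case False
            then show ?thesis using val [OF _ iN False] succ.IH iN by simp
          qed
        qed
      qed
      have c1: "c \<cdot> N1 = empty" using aux [OF N1] \<open>\<not> N1 \<epsilon> N\<close> by simp
      have c2: "c \<cdot> N2 = j" and no2: "\<And>i. i \<epsilon> N2 \<Longrightarrow> \<not> i \<epsilon> N1 \<Longrightarrow> \<not> odd_one d a b i"
        using seg2 [OF ag2 run12 c1] by blast+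
      have no1: "\<not> odd_one d a b i" if "i \<epsilon> N1" "\<not> i \<epsilon> N" for i
        using s1 that unfolding odd_one_def by metis
      have s: "c \<cdot> N3 = empty \<and>
        (\<forall>i. i \<epsilon> N3 \<longrightarrow> \<not> i \<epsilon> N2 \<longrightarrow> odd_one d a b i \<longrightarrow> c \<cdot> i = empty \<or> c \<cdot> i = j) \<and>
        (\<exists>i. i \<epsilon> N3 \<and> \<not> i \<epsilon> N2 \<and> odd_one d a b i \<and> c \<cdot> i = j)"
        using mp [OF spec [OF conjunct2 [OF s3], of c] run23] unfolding c2 .
      \<comment> \<open>Resets happen in the last of the three segments only, so the values read are
        those described by the reset stage.\<close>
      have no: "\<not> i \<epsilon> N2" if "odd_one d a b i" "\<not> i \<epsilon> N" for i
        using no1 [of i] no2 [of i] that by blast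
      show "c \<cdot> N3 = empty \<and>
        (\<forall>i. i \<epsilon> N3 \<longrightarrow> \<not> i \<epsilon> N \<longrightarrow> odd_one d a b i \<longrightarrow> c \<cdot> i = empty \<or> c \<cdot> i = j) \<and>
        (\<exists>i. i \<epsilon> N3 \<and> \<not> i \<epsilon> N \<and> odd_one d a b i \<and> c \<cdot> i = j)"
        using s no sub2 by blast
    qed
  qed
  have "dm (W \<cdot> x) \<epsilon> dm (W \<cdot> x3)" "dm (W \<cdot> y) \<epsilon> dm (W \<cdot> y3)" "dm (W \<cdot> z) \<epsilon> dm (W \<cdot> z3)"
    using le_W_dm [OF l13(1) 1(6)] le_W_dm [OF l13(2) 1(7)] le_W_dm [OF l13(3) 1(8)] .
  moreover have "x \<preceq> x3" "y \<preceq> y3" "z \<preceq> z3"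
    using le_trans [OF 1(2) l13(1)] le_trans [OF 1(3) l13(2)] le_trans [OF 1(4) l13(3)] .
  ultimately show ?thesis
    by - (rule exI [of _ x3], rule exI [of _ y3], rule exI [of _ z3], rule exI [of _ N3],
      (rule conjI, ((rule 3(1) N03 | assumption)+)[1])+, intro allI impI, erule body)
qed

section \<open>The Jonsson map\<close>

text \<open>One round is spent on each \<open>n\<close>. The sequence \<open>c\<close> may be any
  solution of the recursion, whatever its start: a preliminary reset brings it to 0, and only the
  positions below \<open>N0\<close> remain uncontrolled.\<close>

lemma realise:
  assumes t: "func t omega (num 2)"
  shows "\<exists>v1 v2 v3 N0. (\<exists>u. opair u v1 \<epsilon> R) \<and> (\<exists>u. opair u v2 \<epsilon> R) \<and> (\<exists>u. opair u v3 \<epsilon> R) \<and>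
    func v1 omega (num 2) \<and> func v2 omega (num 2) \<and> func v3 omega (num 2) \<and>
    \<not> E0 v1 v2 \<and> \<not> E0 v1 v3 \<and> \<not> E0 v2 v3 \<and> N0 \<epsilon> omega \<and>
    (\<forall>c. (\<forall>i. i \<epsilon> omega \<longrightarrow> c \<cdot> succ i = cstep v1 v2 v3 i (c \<cdot> i)) \<longrightarrow>
      (\<forall>n. n \<epsilon> omega \<longrightarrow>
        ((\<exists>i. i \<epsilon> omega \<and> \<not> i \<epsilon> N0 \<and> odd_one v3 v1 v2 i \<and> c \<cdot> i = succ n) \<longleftrightarrow> t \<cdot> n = succ empty)))"
proof -
  obtain \<pi> where \<pi>: "\<pi> \<epsilon> C" using C_ex by blast
  \<comment> \<open>All three runs may start from the same condition, as the stages separate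
    them.\<close>
  have "same_len3 \<pi> \<pi> \<pi>" unfolding same_len3_def using \<pi> by simp
  then obtain x0 y0 z0 M0 where Good3_0: "Good3 x0 y0 z0 M0" using resync [OF _ om_0] by blast
  \<comment> \<open>This reset makes the counter 0 at \<open>M1\<close> regardless of the digits
    before it.\<close>
  obtain x1 y1 z1 M1 where Good3_1: "Good3 x1 y1 z1 M1"
    and reset: "\<And>a b d c. agrees x1 y1 z1 M1 a b d \<Longrightarrow> count_run a b d c M0 M1 \<Longrightarrow> c \<cdot> M1 = empty"
    using reset_stage [OF Good3_0] by blast
  have M1: "M1 \<epsilon> omega" using Good3_1 unfolding Good3_def by blast
  \<comment> \<open>The target \<open>n + 1\<close> announces that bit \<open>n\<close> is 1. The
    target 0 adds no information, since a reset that reads 0 codes no bit.\<close>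
  define J where "J n = (if t \<cdot> n = succ empty then succ n else empty)" for n
  have J_pterm [pdef_intros]: "pterm s \<Longrightarrow> pterm (\<lambda>\<rho>. J (s \<rho>))" for s
    unfolding J_def by (intro pdef_intros)
  have Jm: "J n \<epsilon> omega" if "n \<epsilon> omega" for n using that by (simp add: J_def)
  define p1 where "p1 q = pfst q" for q
  define p2 where "p2 q = pfst (psnd q)" for q
  define p3 where "p3 q = pfst (psnd (psnd q))" for q
  define p4 where "p4 q = psnd (psnd (psnd q))" for q
  have p_pterm [pdef_intros]: "pterm s \<Longrightarrow> pterm (\<lambda>\<rho>. p1 (s \<rho>))" "pterm s \<Longrightarrow> pterm (\<lambda>\<rho>. p2 (s \<rho>))"
    "pterm s \<Longrightarrow> pterm (\<lambda>\<rho>. p3 (s \<rho>))" "pterm s \<Longrightarrow> pterm (\<lambda>\<rho>. p4 (s \<rho>))" for s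
    unfolding p1_def p2_def p3_def p4_def by (intro pdef_intros, assumption)+
  define quad where "quad x y z N = opair x (opair y (opair z N))" for x y z N
  have p_quad [simp]: "p1 (quad x y z N) = x" "p2 (quad x y z N) = y" "p3 (quad x y z N) = z" "p4 (quad x y z N) = N" for x y z N
    unfolding p1_def p2_def p3_def p4_def quad_def by simp_all
  define inT where "inT q \<longleftrightarrow> Good3 (p1 q) (p2 q) (p3 q) (p4 q)" for q
  have "pdef (\<lambda>\<rho>. inT (\<rho> 0))" unfolding inT_def by (intro pdef_intros)
  then obtain T where T: "\<And>q. q \<epsilon> T \<longleftrightarrow> q \<epsilon> prod C (prod C (prod C omega)) \<and> inT q"
    using sep_ex [where P = inT] by blast
  have quadT: "quad x y z N \<epsilon> T" if "Good3 x y z N" for x y z N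
  proof -
    have "x \<epsilon> C" "y \<epsilon> C" "z \<epsilon> C" "N \<epsilon> omega" using that unfolding Good3_def same_len3_def by blast+
    then show ?thesis unfolding T inT_def p_quad using that by (simp add: quad_def)
  qed
  define Rel where "Rel n q q' \<longleftrightarrow> p1 q \<preceq> p1 q' \<and> p2 q \<preceq> p2 q' \<and> p3 q \<preceq> p3 q' \<and> p4 q \<epsilon> p4 q' \<and>
    dm (W \<cdot> p1 q) \<epsilon> dm (W \<cdot> p1 q') \<and> dm (W \<cdot> p2 q) \<epsilon> dm (W \<cdot> p2 q') \<and> dm (W \<cdot> p3 q) \<epsilon> dm (W \<cdot> p3 q') \<and>
    (\<forall>a b d. agrees (p1 q') (p2 q') (p3 q') (p4 q') a b d \<longrightarrow>
      (\<exists>i. i \<epsilon> p4 q' \<and> \<not> i \<epsilon> p4 q \<and> odd_one a b d i) \<and> (\<exists>i. i \<epsilon> p4 q' \<and> \<not> i \<epsilon> p4 q \<and> odd_one d a b i) \<and>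
      (\<forall>c. count_run a b d c (p4 q) (p4 q') \<longrightarrow> c \<cdot> p4 q = empty \<longrightarrow> c \<cdot> p4 q' = empty \<and>
        (\<forall>i. i \<epsilon> p4 q' \<longrightarrow> \<not> i \<epsilon> p4 q \<longrightarrow> odd_one d a b i \<longrightarrow> c \<cdot> i = empty \<or> c \<cdot> i = J n) \<and>
        (\<exists>i. i \<epsilon> p4 q' \<and> \<not> i \<epsilon> p4 q \<and> odd_one d a b i \<and> c \<cdot> i = J n)))" for n q q'
  have "\<exists>g. func g omega T \<and> g \<cdot> empty = quad x1 y1 z1 M1 \<and> (\<forall>n. n \<epsilon> omega \<longrightarrow> Rel n (g \<cdot> n) (g \<cdot> succ n))"
  proof (rule dependent_choice)
    show "countable T"
      by (rule countable_subset [OF countable_prod [OF C_countable countable_prod [OF C_countable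
            countable_prod [OF C_countable countable_omega]]]]) (simp add: T)
    show "pdef (\<lambda>\<rho>. Rel (\<rho> 0) (\<rho> 1) (\<rho> 2))" unfolding Rel_def agrees_def count_run_def by (intro pdef_intros)
    show "quad x1 y1 z1 M1 \<epsilon> T" by (rule quadT [OF Good3_1])
    fix n q assume n: "n \<epsilon> omega" and q: "q \<epsilon> T"
    have "Good3 (p1 q) (p2 q) (p3 q) (p4 q)" using q T inT_def by blast
    from round [OF this Jm [OF n]] obtain x' y' z' N' where *: "Good3 x' y' z' N'" "Rel n q (quad x' y' z' N')"
      unfolding Rel_def p_quad by blast
    show "\<exists>q'. q' \<epsilon> T \<and> Rel n q q'" using quadT [OF *(1)] *(2) by blast
  qed
  then obtain g where g: "func g omega T" "g \<cdot> empty = quad x1 y1 z1 M1"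
    and rel: "\<And>n. n \<epsilon> omega \<Longrightarrow> Rel n (g \<cdot> n) (g \<cdot> succ n)" by blast
  have Good3n: "Good3 (p1 (g \<cdot> n)) (p2 (g \<cdot> n)) (p3 (g \<cdot> n)) (p4 (g \<cdot> n))" if "n \<epsilon> omega" for n
    using ap_mem [OF g(1) that] T inT_def by blast
  have gC: "p1 (g \<cdot> n) \<epsilon> C" "p2 (g \<cdot> n) \<epsilon> C" "p3 (g \<cdot> n) \<epsilon> C" "p4 (g \<cdot> n) \<epsilon> omega" if "n \<epsilon> omega" for n
    using Good3n [OF that] unfolding Good3_def same_len3_def by blast+
  have pt: "pterm (\<lambda>\<rho>. p1 (g \<cdot> \<rho> 0))" "pterm (\<lambda>\<rho>. p2 (g \<cdot> \<rho> 0))" "pterm (\<lambda>\<rho>. p3 (g \<cdot> \<rho> 0))"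
    "pterm (\<lambda>\<rho>. p4 (g \<cdot> \<rho> 0))" by (intro pdef_intros)+
  have r: "p1 (g \<cdot> n) \<preceq> p1 (g \<cdot> succ n) \<and> dm (W \<cdot> p1 (g \<cdot> n)) \<epsilon> dm (W \<cdot> p1 (g \<cdot> succ n))"
    "p2 (g \<cdot> n) \<preceq> p2 (g \<cdot> succ n) \<and> dm (W \<cdot> p2 (g \<cdot> n)) \<epsilon> dm (W \<cdot> p2 (g \<cdot> succ n))"
    "p3 (g \<cdot> n) \<preceq> p3 (g \<cdot> succ n) \<and> dm (W \<cdot> p3 (g \<cdot> n)) \<epsilon> dm (W \<cdot> p3 (g \<cdot> succ n))"
    "p4 (g \<cdot> n) \<epsilon> p4 (g \<cdot> succ n)" if "n \<epsilon> omega" for n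
    using rel [OF that] unfolding Rel_def by blast+
  obtain u1 v1 where v1: "opair u1 v1 \<epsilon> R" "func v1 omega (num 2)"
    "\<And>n k. n \<epsilon> omega \<Longrightarrow> k \<epsilon> dm (W \<cdot> p1 (g \<cdot> n)) \<Longrightarrow> v1 \<cdot> k = W \<cdot> p1 (g \<cdot> n) \<cdot> k"
    using limit_term [OF pt(1) gC(1) r(1)] by blast
  obtain u2 v2 where v2: "opair u2 v2 \<epsilon> R" "func v2 omega (num 2)"
    "\<And>n k. n \<epsilon> omega \<Longrightarrow> k \<epsilon> dm (W \<cdot> p2 (g \<cdot> n)) \<Longrightarrow> v2 \<cdot> k = W \<cdot> p2 (g \<cdot> n) \<cdot> k"
    using limit_term [OF pt(2) gC(2) r(2)] by blast
  obtain u3 v3 where v3: "opair u3 v3 \<epsilon> R" "func v3 omega (num 2)"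
    "\<And>n k. n \<epsilon> omega \<Longrightarrow> k \<epsilon> dm (W \<cdot> p3 (g \<cdot> n)) \<Longrightarrow> v3 \<cdot> k = W \<cdot> p3 (g \<cdot> n) \<cdot> k"
    using limit_term [OF pt(3) gC(3) r(3)] by blast
  have ag: "agrees (p1 (g \<cdot> n)) (p2 (g \<cdot> n)) (p3 (g \<cdot> n)) (p4 (g \<cdot> n)) v1 v2 v3" if n: "n \<epsilon> omega" for n
    unfolding agrees_def
  proof (intro allI impI)
    fix k assume "k \<epsilon> p4 (g \<cdot> n)"
    then have "k \<epsilon> dm (W \<cdot> p1 (g \<cdot> n))" "k \<epsilon> dm (W \<cdot> p2 (g \<cdot> n))" "k \<epsilon> dm (W \<cdot> p3 (g \<cdot> n))"
      using Good3n [OF n] unfolding Good3_def by blast+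
    then show "v1 \<cdot> k = W \<cdot> p1 (g \<cdot> n) \<cdot> k \<and> v2 \<cdot> k = W \<cdot> p2 (g \<cdot> n) \<cdot> k \<and> v3 \<cdot> k = W \<cdot> p3 (g \<cdot> n) \<cdot> k"
      using v1(3) [OF n] v2(3) [OF n] v3(3) [OF n] by simp
  qed
  define N where "N n = p4 (g \<cdot> n)" for n
  have N_pterm [pdef_intros]: "pterm s \<Longrightarrow> pterm (\<lambda>\<rho>. N (s \<rho>))" for s
    unfolding N_def by (intro pdef_intros)
  have Nm: "N n \<epsilon> omega" if "n \<epsilon> omega" for n unfolding N_def by (rule gC(4) [OF that])
  have Ns: "N n \<epsilon> N (succ n)" if "n \<epsilon> omega" for n unfolding N_def by (rule r(4) [OF that])
  have Nge: "n \<epsilon> N (succ n)" if "n \<epsilon> omega" for n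
    by (rule increasing_ge [where d = N, OF _ Nm Ns that]) (intro pdef_intros)
  have o1: "\<exists>i. i \<epsilon> N (succ n) \<and> \<not> i \<epsilon> N n \<and> odd_one v1 v2 v3 i"
    and o3: "\<exists>i. i \<epsilon> N (succ n) \<and> \<not> i \<epsilon> N n \<and> odd_one v3 v1 v2 i" if "n \<epsilon> omega" for n
    using rel [OF that] ag [OF om_succ [OF that]] unfolding Rel_def N_def by blast+
  have seg: "c \<cdot> N (succ n) = empty"
      "\<And>i. i \<epsilon> N (succ n) \<Longrightarrow> \<not> i \<epsilon> N n \<Longrightarrow> odd_one v3 v1 v2 i \<Longrightarrow> c \<cdot> i = empty \<or> c \<cdot> i = J n"
      "\<exists>i. i \<epsilon> N (succ n) \<and> \<not> i \<epsilon> N n \<and> odd_one v3 v1 v2 i \<and> c \<cdot> i = J n"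
    if "n \<epsilon> omega" "count_run v1 v2 v3 c (N n) (N (succ n))" "c \<cdot> N n = empty" for n c
    using rel [OF that(1)] ag [OF om_succ [OF that(1)]] that(2,3) unfolding Rel_def N_def by blast+
  have far: "\<exists>i. i \<epsilon> omega \<and> n \<epsilon> i \<and> odd_one v1 v2 v3 i" "\<exists>i. i \<epsilon> omega \<and> n \<epsilon> i \<and> odd_one v3 v1 v2 i"
    if n: "n \<epsilon> omega" for n
  proof -
    have n1: "succ n \<epsilon> omega" using n by simp
    have gt: "i \<epsilon> omega \<and> n \<epsilon> i" if "i \<epsilon> N (succ (succ n))" "\<not> i \<epsilon> N (succ n)" for i
    proof -
      have io: "i \<epsilon> omega" by (rule omega_trans [OF Nm [OF om_succ [OF n1]] that(1)])
      have "N (succ n) \<epsilon> succ i" using om_not_mem [OF io Nm [OF n1]] that(2) by blast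
      then show ?thesis using lt_le_trans [OF Nge [OF n] _ io] io by blast
    qed
    show "\<exists>i. i \<epsilon> omega \<and> n \<epsilon> i \<and> odd_one v1 v2 v3 i" using o1 [OF n1] gt by blast
    show "\<exists>i. i \<epsilon> omega \<and> n \<epsilon> i \<and> odd_one v3 v1 v2 i" using o3 [OF n1] gt by blast
  qed
  \<comment> \<open>Positions where \<open>v1\<close> is odd separate it from \<open>v2\<close> and
    \<open>v3\<close>; those where \<open>v3\<close> is odd separate \<open>v2\<close> from
    \<open>v3\<close>.\<close>
  have n12: "\<not> E0 v1 v2" unfolding E0_ap [OF v1(2) v2(2)] using far(1) unfolding odd_one_def by blast
  have n13: "\<not> E0 v1 v3" unfolding E0_ap [OF v1(2) v3(2)] using far(1) unfolding odd_one_def by metis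
  have n23: "\<not> E0 v2 v3" unfolding E0_ap [OF v2(2) v3(2)] using far(2) unfolding odd_one_def by metis
  \<comment> \<open>Every position from the initial bound on lies in the segment of some round,
    found by taking the least bound above it.\<close>
  have cover: "\<exists>n. n \<epsilon> omega \<and> i \<epsilon> N (succ n) \<and> \<not> i \<epsilon> N n" if i: "i \<epsilon> omega" "\<not> i \<epsilon> N empty" for i
  proof -
    have "pdef (\<lambda>\<rho>. i \<epsilon> N (\<rho> 0))" by (intro pdef_intros)
    then obtain m where m: "m \<epsilon> omega" "i \<epsilon> N m" "\<And>k. k \<epsilon> m \<Longrightarrow> \<not> i \<epsilon> N k"
      using om_least [where P = "\<lambda>m. i \<epsilon> N m", OF _ om_succ [OF i(1)] Nge [OF i(1)]] by blast
    from m(1) show ?thesis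
    proof (cases rule: om_succE)
      case 1 then show ?thesis using m(2) i(2) by simp
    next
      case (2 n) then show ?thesis using m(2,3) by auto
    qed
  qed
  have N0le: "n \<epsilon> omega \<Longrightarrow> N empty \<epsilon> succ (N n)" for n
  proof (induction n rule: om_induct)
    case def show ?case by (intro pdef_intros)
  next
    case 0 show ?case by simp
  next
    case (succ n)
    have "N empty \<epsilon> N (succ n)" by (rule le_lt_trans [OF succ.IH Ns [OF succ.hyps] Nm [OF om_succ [OF succ.hyps]]])
    then show ?case by simp
  qed
  have main: "(\<exists>i. i \<epsilon> omega \<and> \<not> i \<epsilon> N empty \<and> odd_one v3 v1 v2 i \<and> c \<cdot> i = succ n) \<longleftrightarrow> t \<cdot> n = succ empty"
    if c: "\<forall>i. i \<epsilon> omega \<longrightarrow> c \<cdot> succ i = cstep v1 v2 v3 i (c \<cdot> i)" and n: "n \<epsilon> omega" for c n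
  proof -
    have run: "count_run v1 v2 v3 c A B" if "B \<epsilon> omega" for A B
      unfolding count_run_def using c omega_trans [OF that] by blast
    have N0: "N empty = M1" unfolding N_def g(2) by simp
    have ag0: "agrees x1 y1 z1 M1 v1 v2 v3" using ag [OF om_0] unfolding g(2) p_quad .
    have c0: "k \<epsilon> omega \<Longrightarrow> c \<cdot> N k = empty" for k
    proof (induction k rule: om_induct)
      case def show ?case by (intro pdef_intros)
    next
      case 0 show ?case unfolding N0 by (rule reset [OF ag0 run [OF M1]])
    next
      case (succ k) show ?case by (rule seg(1) [OF succ.hyps run [OF Nm [OF om_succ [OF succ.hyps]]] succ.IH])
    qed
    note sg = seg(2,3) [OF _ run [OF Nm [OF om_succ]] c0]
    show ?thesis
    proof
      assume "\<exists>i. i \<epsilon> omega \<and> \<not> i \<epsilon> N empty \<and> odd_one v3 v1 v2 i \<and> c \<cdot> i = succ n"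
      then obtain i where i: "i \<epsilon> omega" "\<not> i \<epsilon> N empty" "odd_one v3 v1 v2 i" "c \<cdot> i = succ n" by blast
      obtain m where m: "m \<epsilon> omega" "i \<epsilon> N (succ m)" "\<not> i \<epsilon> N m" using cover [OF i(1,2)] by blast
      have "succ n = J m" using sg(1) [OF m(1) m(1) m(1) m(2,3) i(3)] i(4) by simp
      then show "t \<cdot> n = succ empty" unfolding J_def by (auto split: if_splits)
    next
      assume tn: "t \<cdot> n = succ empty"
      have Jn: "J n = succ n" unfolding J_def using tn by simp
      obtain i where i: "i \<epsilon> N (succ n)" "\<not> i \<epsilon> N n" "odd_one v3 v1 v2 i" "c \<cdot> i = J n"
        using sg(2) [OF n n n] by blast
      have "i \<epsilon> omega" by (rule omega_trans [OF Nm [OF om_succ [OF n]] i(1)])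
      moreover have "\<not> i \<epsilon> N empty" using lt_le_trans [OF _ N0le [OF n] Nm [OF n]] i(2) by blast
      ultimately show "\<exists>i. i \<epsilon> omega \<and> \<not> i \<epsilon> N empty \<and> odd_one v3 v1 v2 i \<and> c \<cdot> i = succ n"
        using i(3,4) Jn by auto
    qed
  qed
  show ?thesis
    by (rule exI [of _ v1], rule exI [of _ v2], rule exI [of _ v3], rule exI [of _ "N empty"])
      (use v1(1,2) v2(1,2) v3(1,2) n12 n13 n23 Nm [OF om_0] main in blast)
qed

end

context ZF_model
begin

section \<open>The code of three reals\<close>

definition counter :: "'a \<Rightarrow> 'a \<Rightarrow> 'a \<Rightarrow> 'a \<Rightarrow> bool" where
  "counter x y z c \<longleftrightarrow> func c omega omega \<and> c \<cdot> empty = empty \<and>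
    (\<forall>i. i \<epsilon> omega \<longrightarrow> c \<cdot> succ i = cstep x y z i (c \<cdot> i))"

lemma cstep_cases: "cstep x y z i k = empty \<or> cstep x y z i k = succ k \<or> cstep x y z i k = k"
  unfolding cstep_def by simp

lemma counter_ex: "\<exists>c. counter x y z c"
  unfolding counter_def
proof (rule prim_rec [where st = "cstep x y z"])
  show "pterm (\<lambda>\<rho>. cstep x y z (\<rho> 0) (\<rho> 1))" by (intro pdef_intros)
  show "cstep x y z n k \<epsilon> omega" if "k \<epsilon> omega" for n k using cstep_cases [of x y z n k] that by auto
qed simp

text \<open>A step raises the counter by at most one, so a large value can be read at a large
  position only.\<close>

lemma counter_le: "counter x y z c \<Longrightarrow> i \<epsilon> omega \<Longrightarrow> c \<cdot> i \<epsilon> succ i"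
proof -
  assume c: "counter x y z c"
  show "i \<epsilon> omega \<Longrightarrow> c \<cdot> i \<epsilon> succ i"
  proof (induction i rule: om_induct)
    case def show ?case by (intro pdef_intros)
  next
    case 0 show ?case using c unfolding counter_def by simp
  next
    case (succ i)
    have s: "c \<cdot> succ i = cstep x y z i (c \<cdot> i)" using c succ.hyps unfolding counter_def by blast
    consider "c \<cdot> succ i = empty" | "c \<cdot> succ i = succ (c \<cdot> i)" | "c \<cdot> succ i = c \<cdot> i"
      using cstep_cases [of x y z i "c \<cdot> i"] unfolding s by blast
    then show ?case
    proof cases
      case 1 show ?thesis unfolding 1 by (rule zero_mem_succ [OF om_succ [OF succ.hyps]])
    next
      case 2 show ?thesis unfolding 2 by (rule om_succ_mono [OF om_succ [OF succ.hyps] succ.IH])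
    next
      case 3 show ?thesis unfolding 3 using succ.IH by simp
    qed
  qed
qed

text \<open>The shift from \<open>n\<close> to \<open>n + 1\<close> ignores the value 0, which
  consecutive resets read whatever is being coded.\<close>

definition code_bit :: "'a \<Rightarrow> 'a \<Rightarrow> 'a \<Rightarrow> 'a \<Rightarrow> bool" where
  "code_bit x y z n \<longleftrightarrow> (\<exists>c i. counter x y z c \<and> i \<epsilon> omega \<and> odd_one z x y i \<and> c \<cdot> i = succ n)"

lemma pdef_code_bit [pdef_intros]:
  "pterm t \<Longrightarrow> pterm u \<Longrightarrow> pterm v \<Longrightarrow> pterm w \<Longrightarrow> pdef (\<lambda>\<rho>. code_bit (t \<rho>) (u \<rho>) (v \<rho>) (w \<rho>))"
  by (rule pdef_subst4 [where P = code_bit]) (unfold code_bit_def counter_def, intro pdef_intros)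

definition code_real :: "'a \<Rightarrow> 'a \<Rightarrow> 'a \<Rightarrow> 'a" where
  "code_real x y z = Lam omega (\<lambda>n. if code_bit x y z n then succ empty else empty)"

lemma pterm_code_real [pdef_intros]:
  "pterm t \<Longrightarrow> pterm u \<Longrightarrow> pterm v \<Longrightarrow> pterm (\<lambda>\<rho>. code_real (t \<rho>) (u \<rho>) (v \<rho>))"
proof -
  assume "pterm t" "pterm u" "pterm v"
  then have "pterm (\<lambda>\<rho>. t (\<lambda>n. \<rho> (Suc n)))" "pterm (\<lambda>\<rho>. u (\<lambda>n. \<rho> (Suc n)))" "pterm (\<lambda>\<rho>. v (\<lambda>n. \<rho> (Suc n)))"
    using pterm_rename by blast+
  then show "pterm (\<lambda>\<rho>. code_real (t \<rho>) (u \<rho>) (v \<rho>))"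
    unfolding code_real_def by (intro pdef_intros)
qed

lemma code_real:
  shows func_code_real: "func (code_real x y z) omega (num 2)"
    and "n \<epsilon> omega \<Longrightarrow> code_real x y z \<cdot> n = (if code_bit x y z n then succ empty else empty)"
proof -
  have pt: "pterm (\<lambda>\<rho>. if code_bit x y z (\<rho> 0) then succ empty else empty)" by (intro pdef_intros)
  show "func (code_real x y z) omega (num 2)" unfolding code_real_def by (rule func_Lam [OF pt]) simp
  show "n \<epsilon> omega \<Longrightarrow> code_real x y z \<cdot> n = (if code_bit x y z n then succ empty else empty)"
    unfolding code_real_def by (rule ap_Lam [OF pt])
qed

text \<open>\<open>M\<close> bounds the differences between the two triples, and \<open>L\<close> is
  a reset beyond it if there is one. A reset reading \<open>n + 1\<close> lies beyond
  \<open>n\<close>, hence beyond \<open>L\<close>; so the alternative without resets is impossible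
  and \<open>L\<close> is a reset common to both triples. Both counters are 0 right after
  \<open>L\<close> and run identically from there.\<close>

lemma code_bit_transfer:
  assumes M: "M \<epsilon> omega" "L \<epsilon> omega" "M \<epsilon> L"
    and same: "\<And>k. k \<epsilon> omega \<Longrightarrow> M \<epsilon> k \<Longrightarrow> x \<cdot> k = x' \<cdot> k \<and> y \<cdot> k = y' \<cdot> k \<and> z \<cdot> k = z' \<cdot> k"
    and L: "odd_one z x y L \<or> (\<forall>i. i \<epsilon> omega \<longrightarrow> M \<epsilon> i \<longrightarrow> \<not> odd_one z x y i)"
    and bit: "code_bit x y z n" and n: "n \<epsilon> omega" "L \<epsilon> n"
  shows "code_bit x' y' z' n"
proof -
  obtain c i where c: "counter x y z c" "i \<epsilon> omega" "odd_one z x y i" "c \<cdot> i = succ n"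
    using bit unfolding code_bit_def by blast
  have "n \<epsilon> i" using counter_le [OF c(1,2)] om_succ_mono_iff [OF c(2) n(1)] unfolding c(4) by blast
  then have Li: "L \<epsilon> i" using om_trans [OF n(2) _ c(2)] by blast
  then have Mi: "M \<epsilon> i" using om_trans [OF M(3) _ c(2)] by blast
  then have oL: "odd_one z x y L" using L c(2,3) by blast
  obtain c' where c': "counter x' y' z' c'" using counter_ex by blast
  have st: "c \<cdot> succ i = cstep x y z i (c \<cdot> i)" "c' \<cdot> succ i = cstep x' y' z' i (c' \<cdot> i)" if "i \<epsilon> omega" for i
    using c(1) c' that unfolding counter_def by blast+
  have odd_same: "odd_one z x y i = odd_one z' x' y' i" "cstep x y z i k = cstep x' y' z' i k"
    if "i \<epsilon> omega" "M \<epsilon> i" for i k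
  proof -
    have e: "x \<cdot> i = x' \<cdot> i" "y \<cdot> i = y' \<cdot> i" "z \<cdot> i = z' \<cdot> i" using same [OF that] by blast+
    show "odd_one z x y i = odd_one z' x' y' i" "cstep x y z i k = cstep x' y' z' i k"
      unfolding cstep_def odd_one_def e by (rule refl)+
  qed
  have "i \<epsilon> omega \<Longrightarrow> L \<epsilon> i \<longrightarrow> c \<cdot> i = c' \<cdot> i" for i
  proof (induction i rule: om_induct)
    case def show ?case by (intro pdef_intros)
  next
    case 0 show ?case by simp
  next
    case (succ i)
    show ?case
    proof
      assume "L \<epsilon> succ i"
      then consider "L = i" | "L \<epsilon> i" by auto
      then show "c \<cdot> succ i = c' \<cdot> succ i"
      proof cases
        case 1
        have "odd_one z x y i" "odd_one z' x' y' i" using oL odd_same(1) [OF succ.hyps] M(3) unfolding 1 by blast+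
        then show ?thesis unfolding st [OF succ.hyps] unfolding cstep_def by simp
      next
        case 2
        have "M \<epsilon> i" by (rule om_trans [OF M(3) 2 succ.hyps])
        then show ?thesis unfolding st [OF succ.hyps] using succ.IH 2 odd_same(2) [OF succ.hyps] by simp
      qed
    qed
  qed
  then have "c' \<cdot> i = succ n" using c(2,4) Li by simp
  then show ?thesis unfolding code_bit_def using c' c(2,3) odd_same(1) [OF c(2) Mi] by blast
qed

section \<open>Eventual equality and its classes\<close>

lemma E0_refl: "func x omega A \<Longrightarrow> E0 x x"
  unfolding E0_def using om_0 by blast

lemma E0_sym: "E0 x y \<Longrightarrow> E0 y x"
  unfolding E0_def by metis

lemma E0_trans: "E0 x y \<Longrightarrow> E0 y z \<Longrightarrow> E0 x z"
proof -
  assume "E0 x y" "E0 y z"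
  then obtain m n where m: "m \<epsilon> omega" "\<forall>k. k \<epsilon> omega \<and> m \<epsilon> k \<longrightarrow> app x k = app y k"
    and n: "n \<epsilon> omega" "\<forall>k. k \<epsilon> omega \<and> n \<epsilon> k \<longrightarrow> app y k = app z k" unfolding E0_def by blast
  obtain l where l: "l \<epsilon> omega" "m \<epsilon> l" "n \<epsilon> l" using om_upper2 [OF m(1) n(1)] by blast
  have "app x k = app z k" if k: "k \<epsilon> omega" "l \<epsilon> k" for k
  proof -
    have "m \<epsilon> k" "n \<epsilon> k" using om_trans [OF _ k(2,1)] l by blast+
    then show ?thesis using m(2) n(2) k(1) by simp
  qed
  then show ?thesis unfolding E0_def using l(1) by blast
qed

text \<open>The bits beyond \<open>L\<close> depend only on the reals beyond \<open>M\<close>, by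
  transfer in both directions.\<close>

lemma code_real_E0:
  assumes x: "func x omega A" "func x' omega A'" and y: "func y omega B" "func y' omega B'"
    and z: "func z omega D" "func z' omega D'" and e: "E0 x x'" "E0 y y'" "E0 z z'"
  shows "E0 (code_real x y z) (code_real x' y' z')"
proof -
  obtain n1 where n1: "n1 \<epsilon> omega" "\<And>k. k \<epsilon> omega \<Longrightarrow> n1 \<epsilon> k \<Longrightarrow> x \<cdot> k = x' \<cdot> k"
    using e(1) unfolding E0_ap [OF x] by blast
  obtain n2 where n2: "n2 \<epsilon> omega" "\<And>k. k \<epsilon> omega \<Longrightarrow> n2 \<epsilon> k \<Longrightarrow> y \<cdot> k = y' \<cdot> k"
    using e(2) unfolding E0_ap [OF y] by blast
  obtain n3 where n3: "n3 \<epsilon> omega" "\<And>k. k \<epsilon> omega \<Longrightarrow> n3 \<epsilon> k \<Longrightarrow> z \<cdot> k = z' \<cdot> k"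
    using e(3) unfolding E0_ap [OF z] by blast
  obtain m where m: "m \<epsilon> omega" "n1 \<epsilon> m" "n2 \<epsilon> m" using om_upper2 [OF n1(1) n2(1)] by blast
  obtain M where M: "M \<epsilon> omega" "m \<epsilon> M" "n3 \<epsilon> M" using om_upper2 [OF m(1) n3(1)] by blast
  have same: "x \<cdot> k = x' \<cdot> k \<and> y \<cdot> k = y' \<cdot> k \<and> z \<cdot> k = z' \<cdot> k" if k: "k \<epsilon> omega" "M \<epsilon> k" for k
  proof -
    have "m \<epsilon> k" "n3 \<epsilon> k" using om_trans [OF _ k(2,1)] M by blast+
    moreover have "n1 \<epsilon> k" "n2 \<epsilon> k" using om_trans [OF _ \<open>m \<epsilon> k\<close> k(1)] m by blast+
    ultimately show ?thesis using n1(2) n2(2) n3(2) k(1) by blast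
  qed
  have same': "x' \<cdot> k = x \<cdot> k \<and> y' \<cdot> k = y \<cdot> k \<and> z' \<cdot> k = z \<cdot> k" if "k \<epsilon> omega" "M \<epsilon> k" for k
    using same [OF that] by simp
  have odd: "odd_one z x y i = odd_one z' x' y' i" if "i \<epsilon> omega" "M \<epsilon> i" for i
    using same [OF that] unfolding odd_one_def by simp
  \<comment> \<open>If no reset occurs beyond \<open>M\<close>, the successor of \<open>M\<close>
    serves as \<open>L\<close>, and no bit beyond it is set in either code.\<close>
  have "\<exists>L. L \<epsilon> omega \<and> M \<epsilon> L \<and> (odd_one z x y L \<or> (\<forall>i. i \<epsilon> omega \<longrightarrow> M \<epsilon> i \<longrightarrow> \<not> odd_one z x y i))"
  proof (cases "\<exists>i. i \<epsilon> omega \<and> M \<epsilon> i \<and> odd_one z x y i")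
    case True then show ?thesis by blast
  next
    case False then show ?thesis using M(1) by (intro exI [of _ "succ M"]) auto
  qed
  then obtain L where L: "L \<epsilon> omega" "M \<epsilon> L"
    "odd_one z x y L \<or> (\<forall>i. i \<epsilon> omega \<longrightarrow> M \<epsilon> i \<longrightarrow> \<not> odd_one z x y i)" by blast
  have L': "odd_one z' x' y' L \<or> (\<forall>i. i \<epsilon> omega \<longrightarrow> M \<epsilon> i \<longrightarrow> \<not> odd_one z' x' y' i)"
    using L odd by blast
  show ?thesis
    unfolding E0_ap [OF func_code_real func_code_real]
  proof (intro exI [of _ L] conjI allI impI L(1))
    fix n assume n: "n \<epsilon> omega \<and> L \<epsilon> n"
    have "code_bit x y z n \<longleftrightarrow> code_bit x' y' z' n"
    proof
      show "code_bit x' y' z' n" if "code_bit x y z n"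
        by (rule code_bit_transfer [OF M(1) L(1,2) same L(3) that conjunct1 [OF n] conjunct2 [OF n]])
      show "code_bit x y z n" if "code_bit x' y' z' n"
        by (rule code_bit_transfer [OF M(1) L(1,2) same' L' that conjunct1 [OF n] conjunct2 [OF n]])
    qed
    then show "code_real x y z \<cdot> n = code_real x' y' z' \<cdot> n" using code_real(2) n by simp
  qed
qed

lemma mem_cantor: "x \<epsilon> cantor \<longleftrightarrow> func x omega (num 2)" by (rule mem_fun_space)

lemma class_self: "x \<epsilon> cantor \<Longrightarrow> x \<epsilon> E0_class x"
  using mem_E0_class E0_refl mem_cantor by blast

lemma class_eq_iff:
  assumes "x \<epsilon> cantor" "y \<epsilon> cantor" shows "E0_class x = E0_class y \<longleftrightarrow> E0 x y"
proof
  assume "E0_class x = E0_class y"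
  then have "y \<epsilon> E0_class x" using class_self [OF assms(2)] by simp
  then show "E0 x y" using mem_E0_class [OF assms(1)] by blast
next
  assume "E0 x y"
  then show "E0_class x = E0_class y"
    using mem_E0_class [OF assms(1)] mem_E0_class [OF assms(2)] E0_trans E0_sym by (intro set_eqI) blast
qed

lemma mem_class:
  assumes "q \<epsilon> cantor_mod_E0" "x \<epsilon> q" shows "x \<epsilon> cantor" "q = E0_class x"
proof -
  obtain w where w: "w \<epsilon> cantor" "q = E0_class w" using assms(1) mem_cantor_mod_E0 by blast
  then have "x \<epsilon> cantor \<and> E0 w x" using assms(2) mem_E0_class by blast
  then show "x \<epsilon> cantor" "q = E0_class x" using class_eq_iff [OF w(1)] w(2) by auto
qed

lemma class_mem: "x \<epsilon> cantor \<Longrightarrow> E0_class x \<epsilon> cantor_mod_E0"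
  using mem_cantor_mod_E0 by blast

lemma num3: "num 3 = succ (succ (succ empty))" by (simp add: numeral_3_eq_3)

lemma mem_three: "i \<epsilon> num 3 \<longleftrightarrow> i = empty \<or> i = succ empty \<or> i = succ (succ empty)"
  by (auto simp: num3)

section \<open>The map on triples of classes\<close>

text \<open>\<open>R\<close> holds of \<open>u\<close> and \<open>v\<close> when \<open>f\<close>
  sends the class of \<open>v\<close> to the class of \<open>u\<close>. Surjectivity of
  \<open>f\<close> makes \<open>R\<close> total; that \<open>f\<close> is an injective function
  makes \<open>R\<close> respect E0 in both directions.\<close>

theorem AD_realise:
  assumes AD: AD and X: "subset X cantor_mod_E0" and f: "bijection f X cantor_mod_E0"
    and t: "t \<epsilon> cantor"
  shows "\<exists>v1 v2 v3. v1 \<epsilon> cantor \<and> v2 \<epsilon> cantor \<and> v3 \<epsilon> cantor \<and>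
    E0_class v1 \<epsilon> X \<and> E0_class v2 \<epsilon> X \<and> E0_class v3 \<epsilon> X \<and>
    \<not> E0 v1 v2 \<and> \<not> E0 v1 v3 \<and> \<not> E0 v2 v3 \<and> E0 (code_real v1 v2 v3) t"
proof -
  have ff: "func f X cantor_mod_E0" using f unfolding bijection_def by blast
  have "pdef (\<lambda>\<rho>. \<exists>a b. opair a b \<epsilon> f \<and> psnd (\<rho> 0) \<epsilon> a \<and> pfst (\<rho> 0) \<epsilon> b)" by (intro pdef_intros)
  then obtain R where "\<And>p. p \<epsilon> R \<longleftrightarrow> p \<epsilon> prod cantor cantor \<and> (\<exists>a b. opair a b \<epsilon> f \<and> psnd p \<epsilon> a \<and> pfst p \<epsilon> b)"
    using sep_ex [where P = "\<lambda>p. \<exists>a b. opair a b \<epsilon> f \<and> psnd p \<epsilon> a \<and> pfst p \<epsilon> b"] by blast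
  then have R: "opair u v \<epsilon> R \<longleftrightarrow> u \<epsilon> cantor \<and> v \<epsilon> cantor \<and> (\<exists>a b. opair a b \<epsilon> f \<and> v \<epsilon> a \<and> u \<epsilon> b)" for u v
    by simp
  have RE: "u \<epsilon> cantor" "v \<epsilon> cantor" "E0_class v \<epsilon> X" "opair (E0_class v) (E0_class u) \<epsilon> f" if uv: "opair u v \<epsilon> R" for u v
  proof -
    obtain a b where ab: "opair a b \<epsilon> f" "v \<epsilon> a" "u \<epsilon> b" and "u \<epsilon> cantor" "v \<epsilon> cantor" using uv R by blast
    have a: "a \<epsilon> X" "b \<epsilon> cantor_mod_E0" using func_opair_iff [OF ff] ap_mem [OF ff] ab(1) by auto
    have "a \<epsilon> cantor_mod_E0" using a(1) X unfolding subset_def by blast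
    then have "a = E0_class v" "b = E0_class u" using mem_class a(2) ab by blast+
    then show "u \<epsilon> cantor" "v \<epsilon> cantor" "E0_class v \<epsilon> X" "opair (E0_class v) (E0_class u) \<epsilon> f"
      using a ab \<open>u \<epsilon> cantor\<close> \<open>v \<epsilon> cantor\<close> by simp_all
  qed
  have total: "\<exists>v. func v omega (num 2) \<and> opair u v \<epsilon> R" if "func u omega (num 2)" for u
  proof -
    have u: "u \<epsilon> cantor" using that mem_cantor by blast
    obtain a where a: "a \<epsilon> X" "opair a (E0_class u) \<epsilon> f"
      using f class_mem [OF u] unfolding bijection_def by blast
    have "a \<epsilon> cantor_mod_E0" using a(1) X unfolding subset_def by blast
    then obtain v where v: "v \<epsilon> cantor" "a = E0_class v" using mem_cantor_mod_E0 by blast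
    have "opair u v \<epsilon> R" unfolding R using u v a class_self by blast
    then show ?thesis using v(1) mem_cantor by blast
  qed
  have inv: "E0 u u' \<longleftrightarrow> E0 v v'" if uv: "opair u v \<epsilon> R" and uv': "opair u' v' \<epsilon> R" for u v u' v'
  proof -
    note r = RE [OF uv] and r' = RE [OF uv']
    have "E0_class u = E0_class u' \<longleftrightarrow> E0_class v = E0_class v'"
    proof
      assume e: "E0_class u = E0_class u'"
      have "\<exists>!x. x \<epsilon> X \<and> opair x (E0_class u) \<epsilon> f" using f class_mem [OF r(1)] unfolding bijection_def by blast
      then show "E0_class v = E0_class v'" using r(3,4) r'(3,4) e by auto
    next
      assume e: "E0_class v = E0_class v'"
      then show "E0_class u = E0_class u'" using r(4) r'(4) func_opair_iff [OF ff] by simp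
    qed
    then show ?thesis using class_eq_iff r(1,2) r'(1,2) by blast
  qed
  obtain C S W L where sys: "condition_system R C S W L" using AD_conditions [OF AD total] by blast
  interpret conditions mem R C S W L by unfold_locales (rule sys, rule inv)
  have tf: "func t omega (num 2)" using t mem_cantor by blast
  obtain v1 v2 v3 N0 u1 u2 u3 where v: "opair u1 v1 \<epsilon> R" "opair u2 v2 \<epsilon> R" "opair u3 v3 \<epsilon> R"
    "\<not> E0 v1 v2" "\<not> E0 v1 v3" "\<not> E0 v2 v3" and N0: "N0 \<epsilon> omega" and
    cnt: "\<And>c n. (\<forall>i. i \<epsilon> omega \<longrightarrow> c \<cdot> succ i = cstep v1 v2 v3 i (c \<cdot> i)) \<Longrightarrow> n \<epsilon> omega \<Longrightarrow>
        ((\<exists>i. i \<epsilon> omega \<and> \<not> i \<epsilon> N0 \<and> odd_one v3 v1 v2 i \<and> c \<cdot> i = succ n) \<longleftrightarrow> t \<cdot> n = succ empty)"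
    using realise [OF tf] by blast
  have "E0 (code_real v1 v2 v3) t"
    unfolding E0_ap [OF func_code_real tf]
  proof (intro exI [of _ N0] conjI allI impI N0)
    fix n assume n: "n \<epsilon> omega \<and> N0 \<epsilon> n"
    have "code_bit v1 v2 v3 n \<longleftrightarrow> t \<cdot> n = succ empty"
    proof
      assume "code_bit v1 v2 v3 n"
      then obtain c i where c: "counter v1 v2 v3 c" "i \<epsilon> omega" "odd_one v3 v1 v2 i" "c \<cdot> i = succ n"
        unfolding code_bit_def by blast
      \<comment> \<open>A value \<open>n + 1\<close> is read beyond position \<open>n\<close>, hence
        beyond \<open>N0\<close>, where \<open>cnt\<close> controls the resets.\<close>
      have "n \<epsilon> i" using counter_le [OF c(1,2)] om_succ_mono_iff [OF c(2)] n unfolding c(4) by blast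
      then have "N0 \<epsilon> i" using om_trans [OF _ _ c(2)] n by blast
      then have "\<not> i \<epsilon> N0" by (rule mem_asym)
      then show "t \<cdot> n = succ empty" using cnt [of c n] c n unfolding counter_def by blast
    next
      assume tn: "t \<cdot> n = succ empty"
      obtain c where c: "counter v1 v2 v3 c" using counter_ex by blast
      then have "\<exists>i. i \<epsilon> omega \<and> \<not> i \<epsilon> N0 \<and> odd_one v3 v1 v2 i \<and> c \<cdot> i = succ n"
        using cnt [of c n] n tn unfolding counter_def by blast
      then show "code_bit v1 v2 v3 n" unfolding code_bit_def using c by blast
    qed
    moreover have "t \<cdot> n = empty \<or> t \<cdot> n = succ empty" using ap_mem [OF tf] n mem_two by blast
    ultimately show "code_real v1 v2 v3 \<cdot> n = t \<cdot> n" using code_real(2) n by auto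
  qed
  then show ?thesis
    using RE(2,3) [OF v(1)] RE(2,3) [OF v(2)] RE(2,3) [OF v(3)] v(4-6) by blast
qed

theorem AD_Jonsson_map:
  assumes AD: AD
  shows "\<exists>F. func F (distinct_tuples (num 3) cantor_mod_E0) cantor_mod_E0 \<and>
    (\<forall>X. subset X cantor_mod_E0 \<and> equipollent X cantor_mod_E0 \<longrightarrow>
      image F (distinct_tuples (num 3) X) = cantor_mod_E0)"
proof -
  let ?Q = cantor_mod_E0 and ?D = "distinct_tuples (num 3) cantor_mod_E0"
  define P where "P s q \<longleftrightarrow> (\<exists>x y z. x \<epsilon> s \<cdot> empty \<and> y \<epsilon> s \<cdot> succ empty \<and> z \<epsilon> s \<cdot> succ (succ empty) \<and>
    code_real x y z \<epsilon> q)" for s q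
  have "pdef (\<lambda>\<rho>. P (pfst (\<rho> 0)) (psnd (\<rho> 0)))" unfolding P_def by (intro pdef_intros)
  then obtain F where "\<And>p. p \<epsilon> F \<longleftrightarrow> p \<epsilon> prod ?D ?Q \<and> P (pfst p) (psnd p)"
    using sep_ex [where P = "\<lambda>p. P (pfst p) (psnd p)"] by blast
  then have F1: "opair s q \<epsilon> F \<longleftrightarrow> s \<epsilon> ?D \<and> q \<epsilon> ?Q \<and> P s q" and F2: "p \<epsilon> F \<Longrightarrow> p \<epsilon> prod ?D ?Q" for s q p
    by simp_all
  have three: "empty \<epsilon> num 3" "succ empty \<epsilon> num 3" "succ (succ empty) \<epsilon> num 3" by (simp_all add: mem_three)
  have uniq: "q = E0_class (code_real x y z)"
    if s: "s \<epsilon> ?D" and q: "q \<epsilon> ?Q" "P s q" and x: "x \<epsilon> s \<cdot> empty" "y \<epsilon> s \<cdot> succ empty" "z \<epsilon> s \<cdot> succ (succ empty)"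
    for s q x y z
  proof -
    obtain x' y' z' where x': "x' \<epsilon> s \<cdot> empty" "y' \<epsilon> s \<cdot> succ empty" "z' \<epsilon> s \<cdot> succ (succ empty)"
      "code_real x' y' z' \<epsilon> q" using q(2) unfolding P_def by blast
    have sf: "func s (num 3) ?Q" using s mem_distinct_tuples by blast
    have sm: "s \<cdot> i \<epsilon> ?Q" if "i \<epsilon> num 3" for i by (rule ap_mem [OF sf that])
    have E: "func v omega (num 2) \<and> func v' omega (num 2) \<and> E0 v' v" if "i \<epsilon> num 3" "v \<epsilon> s \<cdot> i" "v' \<epsilon> s \<cdot> i" for i v v'
      using mem_class [OF sm [OF that(1)] that(2)] mem_class [OF sm [OF that(1)] that(3)] class_eq_iff mem_cantor by auto
    note e = E [OF three(1) x(1) x'(1)] E [OF three(2) x(2) x'(2)] E [OF three(3) x(3) x'(3)]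
    have "E0 (code_real x' y' z') (code_real x y z)"
      by (rule code_real_E0) (use e in blast)+
    then show ?thesis
      using mem_class [OF q(1) x'(4)] class_eq_iff [of "code_real x' y' z'" "code_real x y z"] func_code_real mem_cantor by simp
  qed
  have F: "func F ?D ?Q"
    unfolding func_def
  proof (intro conjI allI impI)
    show "\<exists>s q. s \<epsilon> ?D \<and> q \<epsilon> ?Q \<and> p = opair s q" if "p \<epsilon> F" for p using F2 [OF that] mem_prod by blast
    fix s assume s: "s \<epsilon> ?D"
    have sf: "func s (num 3) ?Q" using s mem_distinct_tuples by blast
    have "\<exists>x. x \<epsilon> s \<cdot> i" if "i \<epsilon> num 3" for i
      using ap_mem [OF sf that] mem_cantor_mod_E0 class_self by metis
    then obtain x y z where x: "x \<epsilon> s \<cdot> empty" "y \<epsilon> s \<cdot> succ empty" "z \<epsilon> s \<cdot> succ (succ empty)"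
      using three by meson
    have c: "code_real x y z \<epsilon> cantor" using func_code_real mem_cantor by blast
    show "\<exists>!q. opair s q \<epsilon> F"
    proof (rule ex1I [of _ "E0_class (code_real x y z)"])
      have "P s (E0_class (code_real x y z))" unfolding P_def using x class_self [OF c] by blast
      then show "opair s (E0_class (code_real x y z)) \<epsilon> F" unfolding F1 using s class_mem [OF c] by blast
      show "q = E0_class (code_real x y z)" if "opair s q \<epsilon> F" for q
        using that uniq [OF _ _ _ x] unfolding F1 by blast
    qed
  qed
  have "image F (distinct_tuples (num 3) X) = ?Q" if X: "subset X ?Q" and eq: "equipollent X ?Q" for X
  proof (rule set_eqI)
    fix q
    show "q \<epsilon> image F (distinct_tuples (num 3) X) \<longleftrightarrow> q \<epsilon> ?Q"
      unfolding mem_image [OF F]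
    proof
      show "q \<epsilon> ?Q" if "\<exists>s. s \<epsilon> distinct_tuples (num 3) X \<and> opair s q \<epsilon> F" using that F1 by blast
    next
      assume "q \<epsilon> ?Q"
      then obtain t where t: "t \<epsilon> cantor" "q = E0_class t" using mem_cantor_mod_E0 by blast
      obtain f where f: "bijection f X ?Q" using eq unfolding equipollent_def by blast
      obtain v1 v2 v3 where v: "v1 \<epsilon> cantor" "v2 \<epsilon> cantor" "v3 \<epsilon> cantor"
        "E0_class v1 \<epsilon> X" "E0_class v2 \<epsilon> X" "E0_class v3 \<epsilon> X"
        "\<not> E0 v1 v2" "\<not> E0 v1 v3" "\<not> E0 v2 v3" "E0 (code_real v1 v2 v3) t"
        using AD_realise [OF AD X f t(1)] by blast
      have ne: "E0_class v1 \<noteq> E0_class v2" "E0_class v1 \<noteq> E0_class v3" "E0_class v2 \<noteq> E0_class v3"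
        using class_eq_iff v by blast+
      define h where "h i = (if i = empty then E0_class v1 else if i = succ empty then E0_class v2 else E0_class v3)" for i
      have hp: "pterm (\<lambda>\<rho>. h (\<rho> 0))" unfolding h_def by (intro pdef_intros)
      define s where "s = Lam (num 3) h"
      have sX: "func s (num 3) X" unfolding s_def by (rule func_Lam [OF hp]) (use v(4-6) in \<open>simp add: h_def\<close>)
      have sv: "s \<cdot> i = h i" if "i \<epsilon> num 3" for i unfolding s_def by (rule ap_Lam [OF hp that])
      have sQ: "func s (num 3) ?Q" by (rule func_cod [OF sX]) (use ap_mem [OF sX] X in \<open>auto simp: subset_def\<close>)
      have h: "h empty = E0_class v1" "h (succ empty) = E0_class v2" "h (succ (succ empty)) = E0_class v3"
        unfolding h_def by simp_all
      have "app s i \<noteq> app s j" if "i \<epsilon> num 3" "j \<epsilon> num 3" "i \<noteq> j" for i j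
        using that(3) ne unfolding app_ap [OF sX that(1)] app_ap [OF sX that(2)] sv [OF that(1)] sv [OF that(2)]
        using that(1,2) h unfolding mem_three by metis
      then have d: "s \<epsilon> distinct_tuples (num 3) X" "s \<epsilon> ?D" unfolding mem_distinct_tuples using sX sQ by blast+
      have "code_real v1 v2 v3 \<epsilon> q"
        unfolding t(2) mem_E0_class [OF t(1)] using E0_sym [OF v(10)] func_code_real mem_cantor by blast
      then have "P s q" unfolding P_def sv [OF three(1)] sv [OF three(2)] sv [OF three(3)] h
        using class_self v(1-3) by blast
      then have "opair s q \<epsilon> F" unfolding F1 using d(2) \<open>q \<epsilon> ?Q\<close> by blast
      then show "\<exists>s. s \<epsilon> distinct_tuples (num 3) X \<and> opair s q \<epsilon> F" using d(1) by blast
    qed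
  qed
  then show ?thesis using F by blast
qed

end

theorem theorem10p4:
  fixes mem :: "'a \<Rightarrow> 'a \<Rightarrow> bool"
  assumes "ZF_model mem" and "set_universe.AD mem"
  shows "let Q = set_universe.cantor_mod_E0 mem; three = set_universe.num mem 3 in
    \<not> set_universe.Jonsson mem three Q \<and>
    (\<exists>F. set_universe.func mem F (set_universe.distinct_tuples mem three Q) Q \<and>
      (\<forall>X. set_universe.subset mem X Q \<and> set_universe.equipollent mem X Q \<longrightarrow>
        set_universe.image mem F (set_universe.distinct_tuples mem three X) = Q))"
proof -
  interpret ZF_model mem by (rule assms(1))
  from AD_Jonsson_map [OF assms(2)] obtain F where
    F: "func F (distinct_tuples (num 3) cantor_mod_E0) cantor_mod_E0"
      "\<And>X. subset X cantor_mod_E0 \<Longrightarrow> equipollent X cantor_mod_E0 \<Longrightarrow>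
        image F (distinct_tuples (num 3) X) = cantor_mod_E0"
    by blast
  then have "\<not> Jonsson (num 3) cantor_mod_E0" unfolding Jonsson_def by blast
  then show ?thesis unfolding Let_def using F by blast
qed

end
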